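(* Let a self-adjoint operator $A$ have infinite matrix representation $A_\infty$. Let $u,v\in\ell^2_0$, and let the finite approximations have the elements $[A_n]_{i,j}=[A_\infty]_{i,j}$, $[u_n]_i=[u]_i$, $[v_n]_i=[v]_i$ for $i,j=0,1,\ldots,n$. Let $f:\mathbb{R}\to\mathbb{R}$ be Riemann--Stieltjes integrable with respect to $A$ and quadratically bounded, that is, for all $x\in\mathbb{R}$, $|f(x)|\le a+b\,x^2$ for some positive $a$ and $b$. Then $$u_n^*\,f(A_n)\,v_n\to u^*\,f(A_\infty)\,v\quad\text{as }n\to\infty.$$
   Context: $\ell^2$ is the Hilbert space of absolutely square-summable sequences (indexed from $0$), $e_i$ are its standard basis vectors, and $\ell^2_0\subset\ell^2$ is the space of finite linear combinations of the $e_i$. The expression $u^*f(A_\infty)v$ is understood as the form value $\langle\operatorname{sgn}(f)\sqrt{|f|}(A_\infty)u,\sqrt{|f|}(A_\infty)v\rangle$. A self-adjoint operator $A$ on a Hilbert space has an infinite matrix representation with respect to an orthonormal basis $\phi_0,\phi_1,\ldots$ of that space if $\phi_i$ lies in the domain of $A$ (i.e. $\|A\phi_i\|<\infty$) for all $i$. The matrix is $[A_\infty]_{i,j}=\langle\phi_i,A\phi_j\rangle$. By standing convention, $A_\infty$ is then regarded as an operator on $\ell^2$ acting by matrix multiplication with domain $D(A_\infty)=\{v\in\ell^2:\|A_\infty v\|<\infty\}$, this operator is self-adjoint, and it is identified with $A$ under the isomorphism $v\mapsto\sum_i v_i\phi_i$ (so that $D(A_\infty)$ corresponds to $D(A)$).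 Let $E(t)$ be the (right-continuous) spectral family of $A$. A function $f$ is Riemann--Stieltjes integrable on $[a,b]$ with respect to a non-decreasing $\rho$ if the sums $\sum_kf(\xi_k)(\rho(t_k)-\rho(t_{k-1}))$ converge for all partitions $a=t_0<\dots<t_n=b$ with mesh tending to $0$ and any $\xi_k\in[t_{k-1},t_k]$. $f$ is Riemann--Stieltjes integrable with respect to the self-adjoint operator $A$ if, over every finite interval with endpoints that are not eigenvalues of $A$, it is Riemann--Stieltjes integrable with respect to $\|E(t)\phi\|^2$ for all $\phi$ in the Hilbert space. *)

theory Defs
  imports "HOL-Analysis.Analysis" "Jordan_Normal_Form.Schur_Decomposition"
begin

section \<open>Complex Hilbert spaces\<close>

text \<open>The norm, metric and topology are those of the underlying real inner product space, whose
  inner product is the real part of the complex one. The complex inner product is conjugate-linear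
  in its first argument.\<close>

class complex_hilbert_space = real_inner + complete_space +
  fixes scaleC :: "complex \<Rightarrow> 'a \<Rightarrow> 'a" (infixr "*\<^sub>C" 75)
    and cinner :: "'a \<Rightarrow> 'a \<Rightarrow> complex"
  assumes scaleC_add_right: "a *\<^sub>C (x + y) = a *\<^sub>C x + a *\<^sub>C y"
    and scaleC_add_left: "(a + b) *\<^sub>C x = a *\<^sub>C x + b *\<^sub>C x"
    and scaleC_scaleC: "a *\<^sub>C (b *\<^sub>C x) = (a * b) *\<^sub>C x"
    and scaleR_eq_scaleC: "r *\<^sub>R x = complex_of_real r *\<^sub>C x"
    and cinner_commute: "cinner x y = cnj (cinner y x)"
    and cinner_add_left: "cinner (x + y) z = cinner x z + cinner y z"
    and cinner_scaleC_left: "cinner (a *\<^sub>C x) y = cnj a * cinner x y"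
    and inner_eq_Re_cinner: "inner x y = Re (cinner x y)"

definition orthonormal_basis :: "(nat \<Rightarrow> 'a::complex_hilbert_space) \<Rightarrow> bool" where
  "orthonormal_basis \<phi> \<longleftrightarrow>
     (\<forall>i j. cinner (\<phi> i) (\<phi> j) = (if i = j then 1 else 0)) \<and>
     (\<forall>x. (\<lambda>i. cinner (\<phi> i) x *\<^sub>C \<phi> i) sums x)"


section \<open>The Hilbert space of square-summable sequences\<close>

typedef ell2 = "{x :: nat \<Rightarrow> complex. summable (\<lambda>i. (cmod (x i))\<^sup>2)}"
  morphisms ell2_nth Abs_ell2
proof
  show "(\<lambda>i. 0) \<in> {x :: nat \<Rightarrow> complex. summable (\<lambda>i. (cmod (x i))\<^sup>2)}"
    by simp
qed

lemma summable_ell2: "summable (\<lambda>i. (cmod (ell2_nth x i))\<^sup>2)"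
  using ell2_nth[of x] by simp

lemma ell2_eqI: "(\<And>i. ell2_nth x i = ell2_nth y i) \<Longrightarrow> x = y"
  by (metis ell2_nth_inject ext)

lemma ell2_nth_Abs: "summable (\<lambda>i. (cmod (x i))\<^sup>2) \<Longrightarrow> ell2_nth (Abs_ell2 x) = x"
  by (rule Abs_ell2_inverse) simp

lemma cmod_add_square_le: "(cmod (a + b))\<^sup>2 \<le> 2 * (cmod a)\<^sup>2 + 2 * (cmod b)\<^sup>2"
proof -
  have "(cmod (a + b))\<^sup>2 \<le> (cmod a + cmod b)\<^sup>2"
    by (intro power_mono norm_triangle_ineq) simp
  also have "\<dots> \<le> 2 * (cmod a)\<^sup>2 + 2 * (cmod b)\<^sup>2"
    using sum_squares_bound[of "cmod a" "cmod b"] by (simp add: power2_sum)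
  finally show ?thesis .
qed

lemma summable_square_add:
  assumes "summable (\<lambda>i. (cmod (x i))\<^sup>2)" and "summable (\<lambda>i. (cmod (y i))\<^sup>2)"
  shows "summable (\<lambda>i. (cmod (x i + y i))\<^sup>2)"
proof (rule summable_comparison_test')
  show "summable (\<lambda>i. 2 * (cmod (x i))\<^sup>2 + 2 * (cmod (y i))\<^sup>2)"
    using assms by (intro summable_add summable_mult)
  show "norm ((cmod (x i + y i))\<^sup>2) \<le> 2 * (cmod (x i))\<^sup>2 + 2 * (cmod (y i))\<^sup>2" if "i \<ge> 0" for i
    using cmod_add_square_le[of "x i" "y i"] by simp
qed

lemma summable_square_mult:
  assumes "summable (\<lambda>i. (cmod (x i))\<^sup>2)"
  shows "summable (\<lambda>i. (cmod (c * x i))\<^sup>2)"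
  using summable_mult[OF assms, of "(cmod c)\<^sup>2"] by (simp add: norm_mult power_mult_distrib)

lemma summable_ell2_prod: "summable (\<lambda>i. cnj (ell2_nth x i) * ell2_nth y i)"
proof (rule summable_comparison_test')
  show "summable (\<lambda>i. (cmod (ell2_nth x i))\<^sup>2 + (cmod (ell2_nth y i))\<^sup>2)"
    by (intro summable_add summable_ell2)
  show "norm (cnj (ell2_nth x i) * ell2_nth y i)
      \<le> (cmod (ell2_nth x i))\<^sup>2 + (cmod (ell2_nth y i))\<^sup>2" if "i \<ge> 0" for i
  proof -
    have "0 \<le> cmod (ell2_nth x i) * cmod (ell2_nth y i)" by simp
    then have "cmod (ell2_nth x i) * cmod (ell2_nth y i)
        \<le> (cmod (ell2_nth x i))\<^sup>2 + (cmod (ell2_nth y i))\<^sup>2"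
      using sum_squares_bound[of "cmod (ell2_nth x i)" "cmod (ell2_nth y i)"] by linarith
    then show ?thesis by (simp add: norm_mult)
  qed
qed

instantiation ell2 :: real_inner
begin

definition "0 = Abs_ell2 (\<lambda>i. 0)"
definition "x + y = Abs_ell2 (\<lambda>i. ell2_nth x i + ell2_nth y i)"
definition "- x = Abs_ell2 (\<lambda>i. - ell2_nth x i)"
definition "x - y = Abs_ell2 (\<lambda>i. ell2_nth x i - ell2_nth y i)"
definition "r *\<^sub>R x = Abs_ell2 (\<lambda>i. complex_of_real r * ell2_nth x i)"
definition "inner x y = Re (\<Sum>i. cnj (ell2_nth x i) * ell2_nth y i)"
definition "norm x = sqrt (\<Sum>i. (cmod (ell2_nth x i))\<^sup>2)"
definition "sgn x = inverse (norm x) *\<^sub>R x" for x :: ell2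
definition "dist x y = norm (x - y)" for x y :: ell2
definition "uniformity = (INF e\<in>{0 <..}. principal {(x :: ell2, y). dist x y < e})"
definition "open U \<longleftrightarrow> (\<forall>x\<in>U. \<forall>\<^sub>F (x', y) in uniformity. x' = x \<longrightarrow> y \<in> U)" for U :: "ell2 set"

lemma ell2_nth_zero: "ell2_nth 0 i = 0"
  unfolding zero_ell2_def by (subst ell2_nth_Abs) auto

lemma ell2_nth_add: "ell2_nth (x + y) i = ell2_nth x i + ell2_nth y i"
  unfolding plus_ell2_def by (subst ell2_nth_Abs) (auto intro: summable_square_add summable_ell2)

lemma ell2_nth_uminus: "ell2_nth (- x) i = - ell2_nth x i"
  unfolding uminus_ell2_def by (subst ell2_nth_Abs) (auto intro: summable_ell2)

lemma ell2_nth_minus: "ell2_nth (x - y) i = ell2_nth x i - ell2_nth y i"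
proof -
  have "summable (\<lambda>i. (cmod (ell2_nth x i + - ell2_nth y i))\<^sup>2)"
    by (rule summable_square_add) (auto intro: summable_ell2)
  then show ?thesis
    unfolding minus_ell2_def by (subst ell2_nth_Abs) auto
qed

lemma ell2_nth_scaleR: "ell2_nth (r *\<^sub>R x) i = complex_of_real r * ell2_nth x i"
  unfolding scaleR_ell2_def
  by (subst ell2_nth_Abs) (auto intro: summable_square_mult summable_ell2)

lemma inner_ell2_self: "inner x x = (\<Sum>i. (cmod (ell2_nth x i))\<^sup>2)" for x :: ell2
proof -
  have "cnj z * z = complex_of_real ((cmod z)\<^sup>2)" for z
    by (metis complex_norm_square mult.commute)
  then have "(\<Sum>i. cnj (ell2_nth x i) * ell2_nth x i)
      = complex_of_real (\<Sum>i. (cmod (ell2_nth x i))\<^sup>2)"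
    using suminf_of_real[OF summable_ell2[of x], where 'a = complex] by simp
  then show ?thesis by (simp add: inner_ell2_def)
qed

instance
proof
  fix x y z :: ell2 and r s :: real
  note nth = ell2_nth_zero ell2_nth_add ell2_nth_uminus ell2_nth_minus ell2_nth_scaleR
  show "x + y + z = x + (y + z)" "x + y = y + x" "0 + x = x" "- x + x = 0" "x - y = x + - y"
    "r *\<^sub>R (x + y) = r *\<^sub>R x + r *\<^sub>R y" "(r + s) *\<^sub>R x = r *\<^sub>R x + s *\<^sub>R x"
    "r *\<^sub>R s *\<^sub>R x = (r * s) *\<^sub>R x" "1 *\<^sub>R x = x"
    by (auto intro!: ell2_eqI simp: nth algebra_simps)
  show "sgn x = inverse (norm x) *\<^sub>R x" by (simp add: sgn_ell2_def)
  show "dist x y = norm (x - y)" by (simp add: dist_ell2_def)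
  show "uniformity = (INF e\<in>{0 <..}. principal {(x :: ell2, y). dist x y < e})"
    by (simp add: uniformity_ell2_def)
  show "open U \<longleftrightarrow> (\<forall>x\<in>U. \<forall>\<^sub>F (x', y) in uniformity. x' = x \<longrightarrow> y \<in> U)"
    for U :: "ell2 set"
    by (simp add: open_ell2_def)
  have "(\<Sum>i. cnj (ell2_nth y i) * ell2_nth x i) = cnj (\<Sum>i. cnj (ell2_nth x i) * ell2_nth y i)"
    using bounded_linear.suminf[OF bounded_linear_cnj summable_ell2_prod[of x y]]
    by (simp add: mult.commute)
  then show "inner x y = inner y x" by (simp add: inner_ell2_def)
  show "inner (x + y) z = inner x z + inner y z"
    by (simp add: inner_ell2_def nth distrib_right suminf_add[symmetric] summable_ell2_prod)
  show "inner (r *\<^sub>R x) y = r * inner x y"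
    by (simp add: inner_ell2_def nth mult.assoc suminf_mult summable_ell2_prod)
  show "0 \<le> inner x x"
    by (simp add: inner_ell2_self suminf_nonneg summable_ell2)
  show "inner x x = 0 \<longleftrightarrow> x = 0"
    using suminf_eq_zero_iff[OF summable_ell2[of x]]
    by (auto simp: inner_ell2_self nth intro: ell2_eqI)
  show "norm x = sqrt (inner x x)"
    by (simp add: inner_ell2_self norm_ell2_def)
qed

end

lemma cmod_ell2_nth_le: "cmod (ell2_nth x i) \<le> norm x"
proof -
  have "(cmod (ell2_nth x i))\<^sup>2 \<le> (\<Sum>i. (cmod (ell2_nth x i))\<^sup>2)"
    using sum_le_suminf[OF summable_ell2[of x], of "{i}"] by simp
  then show ?thesis
    unfolding norm_ell2_def by (rule real_le_rsqrt)
qed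

instance ell2 :: complete_space
proof
  fix X :: "nat \<Rightarrow> ell2"
  assume X: "Cauchy X"
  have "Cauchy (\<lambda>n. ell2_nth (X n) i)" for i
  proof (rule metric_CauchyI)
    fix e :: real assume "e > 0"
    then obtain N where N: "\<And>m n. m \<ge> N \<Longrightarrow> n \<ge> N \<Longrightarrow> dist (X m) (X n) < e"
      using metric_CauchyD[OF X] by blast
    have "dist (ell2_nth (X m) i) (ell2_nth (X n) i) < e" if "m \<ge> N" "n \<ge> N" for m n
      using N[OF that] cmod_ell2_nth_le[of "X m - X n" i]
      by (simp add: dist_norm ell2_nth_minus)
    then show "\<exists>N. \<forall>m\<ge>N. \<forall>n\<ge>N. dist (ell2_nth (X m) i) (ell2_nth (X n) i) < e" by blast
  qed
  then have "\<exists>l. (\<lambda>n. ell2_nth (X n) i) \<longlonglongrightarrow> l" for i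
    using Cauchy_convergent convergent_def by blast
  then obtain y where y: "\<And>i. (\<lambda>n. ell2_nth (X n) i) \<longlonglongrightarrow> y i" by metis
  have key: "summable (\<lambda>i. (cmod (ell2_nth (X n) i - y i))\<^sup>2) \<and>
      (\<Sum>i. (cmod (ell2_nth (X n) i - y i))\<^sup>2) \<le> e\<^sup>2"
    if N: "\<And>m n. m \<ge> N \<Longrightarrow> n \<ge> N \<Longrightarrow> dist (X m) (X n) < e" and n: "n \<ge> N" for N n e
  proof -
    have "(\<Sum>i<k. (cmod (ell2_nth (X n) i - y i))\<^sup>2) \<le> e\<^sup>2" for k
    proof (rule LIMSEQ_le_const2)
      show "(\<lambda>m. \<Sum>i<k. (cmod (ell2_nth (X n) i - ell2_nth (X m) i))\<^sup>2)
          \<longlonglongrightarrow> (\<Sum>i<k. (cmod (ell2_nth (X n) i - y i))\<^sup>2)"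
        by (intro tendsto_intros y)
      have "(\<Sum>i<k. (cmod (ell2_nth (X n) i - ell2_nth (X m) i))\<^sup>2) \<le> e\<^sup>2" if m: "m \<ge> N" for m
      proof -
        have "(\<Sum>i<k. (cmod (ell2_nth (X n - X m) i))\<^sup>2) \<le> (\<Sum>i. (cmod (ell2_nth (X n - X m) i))\<^sup>2)"
          by (intro sum_le_suminf summable_ell2) auto
        also have "\<dots> = (norm (X n - X m))\<^sup>2"
          by (simp add: norm_ell2_def suminf_nonneg summable_ell2)
        also have "\<dots> \<le> e\<^sup>2"
          using N[OF n m] by (intro power_mono) (auto simp: dist_norm)
        finally show ?thesis by (simp add: ell2_nth_minus)
      qed
      then show "\<exists>N. \<forall>m\<ge>N. (\<Sum>i<k. (cmod (ell2_nth (X n) i - ell2_nth (X m) i))\<^sup>2) \<le> e\<^sup>2" by blast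
    qed
    moreover from this have "summable (\<lambda>i. (cmod (ell2_nth (X n) i - y i))\<^sup>2)"
      by (intro summableI_nonneg_bounded[where x = "e\<^sup>2"]) auto
    ultimately show ?thesis by (auto intro: suminf_le_const)
  qed
  obtain N where "\<And>m n. m \<ge> N \<Longrightarrow> n \<ge> N \<Longrightarrow> dist (X m) (X n) < 1"
    using metric_CauchyD[OF X, of 1] by auto
  from key[OF this, of N] have "summable (\<lambda>i. (cmod (ell2_nth (X N) i - y i))\<^sup>2)" by simp
  then have "summable (\<lambda>i. (cmod (y i - ell2_nth (X N) i))\<^sup>2)" by (simp add: norm_minus_commute)
  from summable_square_add[OF this summable_ell2[of "X N"]]
  have sy: "summable (\<lambda>i. (cmod (y i))\<^sup>2)" by simp
  have "X \<longlonglongrightarrow> Abs_ell2 y"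
  proof (rule metric_LIMSEQ_I)
    fix e :: real assume e: "e > 0"
    then obtain N where N: "\<And>m n. m \<ge> N \<Longrightarrow> n \<ge> N \<Longrightarrow> dist (X m) (X n) < e / 2"
      using metric_CauchyD[OF X, of "e / 2"] by auto
    have "dist (X n) (Abs_ell2 y) < e" if "n \<ge> N" for n
    proof -
      have "dist (X n) (Abs_ell2 y) = sqrt (\<Sum>i. (cmod (ell2_nth (X n) i - y i))\<^sup>2)"
        by (simp add: dist_norm norm_ell2_def ell2_nth_minus ell2_nth_Abs[OF sy])
      also have "\<dots> \<le> sqrt ((e / 2)\<^sup>2)"
        using key[OF N that] by (intro real_sqrt_le_mono) auto
      also have "\<dots> < e" using e by simp
      finally show ?thesis .
    qed
    then show "\<exists>N. \<forall>n\<ge>N. dist (X n) (Abs_ell2 y) < e" by blast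
  qed
  then show "convergent X" by (auto simp: convergent_def)
qed

instantiation ell2 :: complex_hilbert_space
begin

definition "c *\<^sub>C x = Abs_ell2 (\<lambda>i. c * ell2_nth x i)"
definition "cinner x y = (\<Sum>i. cnj (ell2_nth x i) * ell2_nth y i)"

lemma ell2_nth_scaleC: "ell2_nth (c *\<^sub>C x) i = c * ell2_nth x i"
  unfolding scaleC_ell2_def
  by (subst ell2_nth_Abs) (auto intro: summable_square_mult summable_ell2)

instance
proof
  fix x y z :: ell2 and a b :: complex and r :: real
  note nth = ell2_nth_zero ell2_nth_add ell2_nth_scaleR ell2_nth_scaleC
  show "a *\<^sub>C (x + y) = a *\<^sub>C x + a *\<^sub>C y" "(a + b) *\<^sub>C x = a *\<^sub>C x + b *\<^sub>C x"
    "a *\<^sub>C b *\<^sub>C x = (a * b) *\<^sub>C x" "r *\<^sub>R x = complex_of_real r *\<^sub>C x"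
    by (auto intro!: ell2_eqI simp: nth algebra_simps)
  show "cinner x y = cnj (cinner y x)"
    using bounded_linear.suminf[OF bounded_linear_cnj summable_ell2_prod[of y x]]
    by (simp add: cinner_ell2_def mult.commute)
  show "cinner (x + y) z = cinner x z + cinner y z"
    by (simp add: cinner_ell2_def nth distrib_right suminf_add[symmetric] summable_ell2_prod)
  show "cinner (a *\<^sub>C x) y = cnj a * cinner x y"
    by (simp add: cinner_ell2_def nth mult.assoc suminf_mult summable_ell2_prod)
  show "inner x y = Re (cinner x y)"
    by (simp add: cinner_ell2_def inner_ell2_def)
qed

end

definition ell2_unit :: "nat \<Rightarrow> ell2" where
  "ell2_unit i = Abs_ell2 (\<lambda>k. if k = i then 1 else 0)"

definition ell2_fin :: "ell2 set" where
  "ell2_fin = {v. \<exists>n c. v = (\<Sum>i<n. c i *\<^sub>C ell2_unit i)}"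


section \<open>Self-adjoint operators and infinite matrices\<close>

text \<open>A possibly unbounded operator is given by its domain \<open>D\<close> and a function \<open>A\<close>, whose values
  outside \<open>D\<close> are irrelevant.\<close>

definition self_adjoint_operator ::
    "'a::complex_hilbert_space set \<Rightarrow> ('a \<Rightarrow> 'a) \<Rightarrow> bool" where
  "self_adjoint_operator D A \<longleftrightarrow>
     0 \<in> D \<and> (\<forall>x\<in>D. \<forall>y\<in>D. x + y \<in> D) \<and> (\<forall>c. \<forall>x\<in>D. c *\<^sub>C x \<in> D) \<and>
     closure D = UNIV \<and>
     (\<forall>x\<in>D. \<forall>y\<in>D. A (x + y) = A x + A y) \<and> (\<forall>c. \<forall>x\<in>D. A (c *\<^sub>C x) = c *\<^sub>C A x) \<and>
     (\<forall>x\<in>D. \<forall>y\<in>D. cinner x (A y) = cinner (A x) y) \<and>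
     {y. \<exists>z. \<forall>x\<in>D. cinner y (A x) = cinner z x} = D"

definition eigenvalue_of :: "'a::complex_hilbert_space set \<Rightarrow> ('a \<Rightarrow> 'a) \<Rightarrow> real \<Rightarrow> bool" where
  "eigenvalue_of D A t \<longleftrightarrow> (\<exists>x\<in>D. x \<noteq> 0 \<and> A x = t *\<^sub>R x)"

definition matrix_domain :: "(nat \<Rightarrow> nat \<Rightarrow> complex) \<Rightarrow> ell2 set" where
  "matrix_domain M =
     {v. (\<forall>i. summable (\<lambda>j. M i j * ell2_nth v j)) \<and>
         summable (\<lambda>i. (cmod (\<Sum>j. M i j * ell2_nth v j))\<^sup>2)}"

definition matrix_operator :: "(nat \<Rightarrow> nat \<Rightarrow> complex) \<Rightarrow> ell2 \<Rightarrow> ell2" where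
  "matrix_operator M v = Abs_ell2 (\<lambda>i. \<Sum>j. M i j * ell2_nth v j)"

definition basis_iso :: "(nat \<Rightarrow> 'a::complex_hilbert_space) \<Rightarrow> ell2 \<Rightarrow> 'a" where
  "basis_iso \<phi> v = (\<Sum>i. ell2_nth v i *\<^sub>C \<phi> i)"

text \<open>The last three conjuncts are the convention under which the matrix is identified with the
  operator. It excludes, for instance, bases whose span is not a core for \<open>A\<close>; for those the matrix
  operator on its maximal domain is a proper extension of \<open>A\<close>.\<close>

definition has_matrix_representation ::
    "'a::complex_hilbert_space set \<Rightarrow> ('a \<Rightarrow> 'a) \<Rightarrow> (nat \<Rightarrow> 'a) \<Rightarrow> (nat \<Rightarrow> nat \<Rightarrow> complex) \<Rightarrow> bool"
  where
  "has_matrix_representation D A \<phi> M \<longleftrightarrow>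
     orthonormal_basis \<phi> \<and>
     (\<forall>i. \<phi> i \<in> D) \<and>
     (\<forall>i j. M i j = cinner (\<phi> i) (A (\<phi> j))) \<and>
     self_adjoint_operator (matrix_domain M) (matrix_operator M) \<and>
     basis_iso \<phi> ` matrix_domain M = D \<and>
     (\<forall>v\<in>matrix_domain M. basis_iso \<phi> (matrix_operator M v) = A (basis_iso \<phi> v))"


section \<open>Riemann--Stieltjes integrals\<close>

definition has_RS_integral ::
    "(real \<Rightarrow> real) \<Rightarrow> (real \<Rightarrow> 'b::real_normed_vector) \<Rightarrow> real \<Rightarrow> real \<Rightarrow> 'b \<Rightarrow> bool" where
  "has_RS_integral f \<rho> a b I \<longleftrightarrow>
     (\<forall>\<epsilon>>0. \<exists>\<delta>>0. \<forall>n t \<xi>.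
        t 0 = a \<and> t n = b \<and>
        (\<forall>k<n. t k < t (Suc k) \<and> t (Suc k) - t k < \<delta> \<and> \<xi> k \<in> {t k..t (Suc k)}) \<longrightarrow>
        norm ((\<Sum>k<n. f (\<xi> k) *\<^sub>R (\<rho> (t (Suc k)) - \<rho> (t k))) - I) < \<epsilon>)"

definition RS_integrable ::
    "(real \<Rightarrow> real) \<Rightarrow> (real \<Rightarrow> 'b::real_normed_vector) \<Rightarrow> real \<Rightarrow> real \<Rightarrow> bool" where
  "RS_integrable f \<rho> a b \<longleftrightarrow> (\<exists>I. has_RS_integral f \<rho> a b I)"

text \<open>The improper integral over the whole real line.\<close>

definition has_RS_integral_line ::
    "(real \<Rightarrow> real) \<Rightarrow> (real \<Rightarrow> 'b::real_normed_vector) \<Rightarrow> 'b \<Rightarrow> bool" where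
  "has_RS_integral_line f \<rho> y \<longleftrightarrow>
     (\<exists>I. (\<forall>a b. a < b \<longrightarrow> has_RS_integral f \<rho> a b (I a b)) \<and>
          ((\<lambda>(a, b). I a b) \<longlongrightarrow> y) (at_bot \<times>\<^sub>F at_top))"


section \<open>Spectral families and functions of operators\<close>

text \<open>\<open>E\<close> is a right-continuous resolution of the identity, and \<open>A\<close> is the integral of \<open>t dE(t)\<close>
  with its natural domain.\<close>

definition spectral_family ::
    "'a::complex_hilbert_space set \<Rightarrow> ('a \<Rightarrow> 'a) \<Rightarrow> (real \<Rightarrow> 'a \<Rightarrow> 'a) \<Rightarrow> bool" where
  "spectral_family D A E \<longleftrightarrow>
     (\<forall>t x y. E t (x + y) = E t x + E t y) \<and>
     (\<forall>t c x. E t (c *\<^sub>C x) = c *\<^sub>C E t x) \<and>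
     (\<forall>t x y. cinner (E t x) y = cinner x (E t y)) \<and>
     (\<forall>s t x. E s (E t x) = E (min s t) x) \<and>
     (\<forall>t x. ((\<lambda>s. E s x) \<longlongrightarrow> E t x) (at_right t)) \<and>
     (\<forall>x. ((\<lambda>t. E t x) \<longlongrightarrow> 0) at_bot) \<and>
     (\<forall>x. ((\<lambda>t. E t x) \<longlongrightarrow> x) at_top) \<and>
     D = {x. \<exists>c. has_RS_integral_line (\<lambda>t. t\<^sup>2) (\<lambda>t. (norm (E t x))\<^sup>2) c} \<and>
     (\<forall>x\<in>D. has_RS_integral_line (\<lambda>t. t) (\<lambda>t. E t x) (A x))"

text \<open>Integrability with respect to the operator \<open>A\<close> on \<open>D\<close> whose spectral family is \<open>E\<close>.\<close>

definition RS_integrable_operator ::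
    "(real \<Rightarrow> real) \<Rightarrow> 'a::complex_hilbert_space set \<Rightarrow> ('a \<Rightarrow> 'a) \<Rightarrow> (real \<Rightarrow> 'a \<Rightarrow> 'a) \<Rightarrow> bool" where
  "RS_integrable_operator f D A E \<longleftrightarrow>
     (\<forall>a b. a < b \<and> \<not> eigenvalue_of D A a \<and> \<not> eigenvalue_of D A b \<longrightarrow>
        (\<forall>x. RS_integrable f (\<lambda>t. (norm (E t x))\<^sup>2) a b))"

text \<open>The vector \<open>g(A) x\<close>, where \<open>E\<close> is the spectral family of \<open>A\<close>: the strong integral of
  \<open>g(t) dE(t) x\<close>, provided that it exists.\<close>

definition operator_function ::
    "(real \<Rightarrow> real) \<Rightarrow> (real \<Rightarrow> 'a::complex_hilbert_space \<Rightarrow> 'a) \<Rightarrow> 'a \<Rightarrow> 'a" where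
  "operator_function g E x = (THE y. has_RS_integral_line g (\<lambda>t. E t x) y)"

definition form_value ::
    "(real \<Rightarrow> real) \<Rightarrow> (real \<Rightarrow> 'a::complex_hilbert_space \<Rightarrow> 'a) \<Rightarrow> 'a \<Rightarrow> 'a \<Rightarrow> complex" where
  "form_value f E u v =
     cinner (operator_function (\<lambda>t. sgn (f t) * sqrt \<bar>f t\<bar>) E u)
            (operator_function (\<lambda>t. sqrt \<bar>f t\<bar>) E v)"


section \<open>Finite sections\<close>

definition section_mat :: "(nat \<Rightarrow> nat \<Rightarrow> complex) \<Rightarrow> nat \<Rightarrow> complex mat" where
  "section_mat M n = Matrix.mat (Suc n) (Suc n) (\<lambda>(i, j). M i j)"

definition section_vec :: "ell2 \<Rightarrow> nat \<Rightarrow> complex Matrix.vec" where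
  "section_vec v n = Matrix.vec (Suc n) (ell2_nth v)"

text \<open>A function of a Hermitian matrix \<open>B\<close>, defined by unitary diagonalisation; the result does not
  depend on the diagonalisation chosen.\<close>

definition matrix_function :: "(real \<Rightarrow> real) \<Rightarrow> complex mat \<Rightarrow> complex mat" where
  "matrix_function f B =
     (let n = dim_row B in
      THE C. \<exists>U (d :: nat \<Rightarrow> real).
        U \<in> carrier_mat n n \<and> U * mat_adjoint U = 1\<^sub>m n \<and>
        B = U * mat_diag n (\<lambda>i. complex_of_real (d i)) * mat_adjoint U \<and>
        C = U * mat_diag n (\<lambda>i. complex_of_real (f (d i))) * mat_adjoint U)"

end

theory Submission
  imports Defs
begin

text \<open>
  By polarisation it is enough to treat \<open>u = v = x\<close> for a finite sequence \<open>x\<close>. Let \<open>w n j\<close> and \<open>d n j\<close>,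
  \<open>j \<le> n\<close>, be orthonormal eigenvectors and the eigenvalues of the finite section \<open>A\<^sub>n\<close>. Then the left-hand
  side is the sum of \<open>f (d n j) * (cmod (cinner (w n j) x))\<^sup>2\<close> over \<open>j \<le> n\<close>: an integral of \<open>f\<close> with respect
  to a step function. The right-hand side is the improper Riemann--Stieltjes integral of \<open>f\<close> with respect
  to the square norm of \<open>F t x\<close> (\<open>form_value_integral\<close>). So the theorem says that the spectral
  distributions of \<open>x\<close> converge, strongly enough for the integrand \<open>f\<close>.

  The matrix operator on its maximal domain is the adjoint of its restriction to the finite sequences.
  Since it is self-adjoint, the finite sequences are a core (\<open>finite_sequences_core\<close>). On a finite
  sequence \<open>y\<close>, and for large \<open>n\<close>, the section acts like the whole matrix as far as its own eigenvectors can
  tell: \<open>cinner (w n j) (A y) = d n j * cinner (w n j) y\<close>. These two facts give a concentration property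
  (\<open>part_concentration\<close>). Let \<open>x\<close> have its spectral support within distance \<open>r\<close> from \<open>c\<close>. The
  components of \<open>x\<close> in the eigenspaces of \<open>A\<^sub>n\<close> with eigenvalues at distance at least \<open>r + \<delta>\<close> from \<open>c\<close>
  are multiplied by at least \<open>r + \<delta>\<close> when \<open>A - c\<close> is applied, whereas \<open>A - c\<close> multiplies the norm of \<open>x\<close> by at most \<open>r\<close> and preserves
  the spectral support. Iteration shows that these components tend to zero. Neither resolvents nor a
  continuous functional calculus are involved.

  Concentration implies that the distribution functions converge at the continuity points of the limit
  (\<open>distr_limit\<close>). On a partition by continuity points the weight of every cell therefore converges,
  and within a cell the values of \<open>f\<close> differ by at most its oscillation, whose weighted sum is small by
  Darboux's criterion; this gives convergence on bounded intervals (\<open>weighted_limit_interval\<close>). For the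
  tails, the sum of \<open>(d n j)\<^sup>2 * (cmod (cinner (w n j) x))\<^sup>2\<close> over the far eigenvalues is the square norm of
  the far part of \<open>A x\<close>, which is small by concentration, so a quadratic bound on \<open>f\<close> suffices
  (\<open>weighted_tail\<close>).

  Two points remain. The vectors whose inner product is the form value have to exist: the
  Riemann--Stieltjes sums of two partitions are compared on the products of their cells, where the
  spectral projections are orthogonal (\<open>vector_integral_exists\<close>). And integrability is assumed for the
  spectral family \<open>E\<close> of \<open>A\<close>, on intervals without eigenvalues at the ends, but used for \<open>F\<close>. The limit
  result applies to \<open>E\<close> as well, with the same weights, so the distribution functions of the finite
  sequences agree (\<open>distr_eq_if_same_weights\<close>); and the eigenvalues are countable
  (\<open>countable_eigenvalues\<close>).
\<close>

section \<open>Complex inner products\<close>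

lemma scaleC_zero_left: "0 *\<^sub>C x = (0::'a::complex_hilbert_space)"
  using scaleR_eq_scaleC[of 0 x] by simp

lemma scaleC_zero_right: "c *\<^sub>C 0 = (0::'a::complex_hilbert_space)"
  using scaleC_add_right[of c 0 "0::'a"] by simp

lemma scaleC_minus_one: "(-1) *\<^sub>C x = - (x::'a::complex_hilbert_space)"
  using scaleR_eq_scaleC[of "-1" x] by simp

lemma scaleC_minus_left: "(- c) *\<^sub>C x = - (c *\<^sub>C (x::'a::complex_hilbert_space))"
  using scaleC_scaleC[of "-1" c x] by (simp add: scaleC_minus_one)

lemma scaleC_minus_right: "c *\<^sub>C (- x) = - (c *\<^sub>C (x::'a::complex_hilbert_space))"
  using scaleC_add_right[of c x "-x"] by (simp add: scaleC_zero_right add_eq_0_iff)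

lemma scaleC_diff_right: "c *\<^sub>C (x - y) = c *\<^sub>C x - c *\<^sub>C (y::'a::complex_hilbert_space)"
  using scaleC_add_right[of c x "-y"] by (simp add: scaleC_minus_right)

lemma scaleC_sum_right: "c *\<^sub>C (\<Sum>i\<in>I. f i) = (\<Sum>i\<in>I. c *\<^sub>C (f i :: 'a::complex_hilbert_space))"
  by (induction I rule: infinite_finite_induct) (auto simp: scaleC_zero_right scaleC_add_right)

lemma cinner_add_right: "cinner x (y + z) = cinner x y + cinner x (z::'a::complex_hilbert_space)"
  by (metis cinner_commute cinner_add_left complex_cnj_add)

lemma cinner_scaleC_right: "cinner x (a *\<^sub>C y) = a * cinner x (y::'a::complex_hilbert_space)"
  by (metis cinner_commute cinner_scaleC_left complex_cnj_cnj complex_cnj_mult)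

lemma cinner_zero_left: "cinner 0 (x::'a::complex_hilbert_space) = 0"
  using cinner_add_left[of 0 0 x] by simp

lemma cinner_zero_right: "cinner (x::'a::complex_hilbert_space) 0 = 0"
  using cinner_add_right[of x 0 0] by simp

lemma cinner_scaleR_left: "cinner (r *\<^sub>R x) y = of_real r * cinner x (y::'a::complex_hilbert_space)"
  by (simp add: scaleR_eq_scaleC cinner_scaleC_left)

lemma cinner_scaleR_right: "cinner x (r *\<^sub>R y) = of_real r * cinner x (y::'a::complex_hilbert_space)"
  by (simp add: scaleR_eq_scaleC cinner_scaleC_right)

lemma cinner_minus_left: "cinner (- x) y = - cinner x (y::'a::complex_hilbert_space)"
  using cinner_scaleR_left[of "-1" x y] by simp

lemma cinner_minus_right: "cinner x (- y) = - cinner x (y::'a::complex_hilbert_space)"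
  using cinner_scaleR_right[of x "-1" y] by simp

lemma cinner_diff_left: "cinner (x - y) z = cinner x z - cinner y (z::'a::complex_hilbert_space)"
  using cinner_add_left[of x "-y" z] by (simp add: cinner_minus_left)

lemma cinner_diff_right: "cinner x (y - z) = cinner x y - cinner x (z::'a::complex_hilbert_space)"
  using cinner_add_right[of x y "-z"] by (simp add: cinner_minus_right)

lemma cinner_sum_left: "cinner (\<Sum>i\<in>I. f i) y = (\<Sum>i\<in>I. cinner (f i) (y::'a::complex_hilbert_space))"
  by (induction I rule: infinite_finite_induct) (auto simp: cinner_zero_left cinner_add_left)

lemma cinner_sum_right: "cinner y (\<Sum>i\<in>I. f i) = (\<Sum>i\<in>I. cinner (y::'a::complex_hilbert_space) (f i))"
  by (induction I rule: infinite_finite_induct) (auto simp: cinner_zero_right cinner_add_right)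

lemma cinner_self: "cinner x x = of_real ((norm (x::'a::complex_hilbert_space))\<^sup>2)"
proof -
  have "Im (cinner x x) = 0"
    using cinner_commute[of x x] by (metis complex_cnj_zero_iff cnj.simps(2) equation_minus_iff neg_equal_zero)
  then show ?thesis
    by (simp add: complex_eq_iff power2_norm_eq_inner inner_eq_Re_cinner)
qed

lemma norm_scaleC: "norm (c *\<^sub>C x) = cmod c * norm (x::'a::complex_hilbert_space)"
proof -
  have "complex_of_real ((norm (c *\<^sub>C x))\<^sup>2) = cinner (c *\<^sub>C x) (c *\<^sub>C x)"
    by (rule cinner_self[symmetric])
  also have "\<dots> = (c * cnj c) * cinner x x"
    by (simp add: cinner_scaleC_left cinner_scaleC_right)
  also have "\<dots> = of_real ((cmod c * norm x)\<^sup>2)"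
    by (simp only: complex_norm_square[symmetric] cinner_self power_mult_distrib of_real_mult)
  finally have "(norm (c *\<^sub>C x))\<^sup>2 = (cmod c * norm x)\<^sup>2"
    using of_real_eq_iff by blast
  then show ?thesis by simp
qed

text \<open>Multiplying one argument by a phase makes the complex inner product real, which reduces the
  complex Cauchy--Schwarz inequality to the real one.\<close>

lemma cmod_cinner_le: "cmod (cinner x y) \<le> norm x * norm (y::'a::complex_hilbert_space)"
proof (cases "cinner x y = 0")
  case False
  define c where "c = cnj (sgn (cinner x y))"
  have c: "cmod c = 1" using False by (simp add: c_def norm_sgn)
  have "c * cinner x y = of_real (cmod (cinner x y))"
    using False complex_norm_square[of "cinner x y"]
    by (simp add: c_def sgn_eq field_simps power2_eq_square)
  then have "cmod (cinner x y) = Re (cinner x (c *\<^sub>C y))"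
    by (simp add: cinner_scaleC_right)
  also have "\<dots> \<le> norm x * norm (c *\<^sub>C y)"
    using norm_cauchy_schwarz[of x "c *\<^sub>C y"] by (simp add: inner_eq_Re_cinner)
  finally show ?thesis by (simp add: norm_scaleC c)
qed simp

lemma bounded_bilinear_cinner: "bounded_bilinear (cinner :: 'a::complex_hilbert_space \<Rightarrow> _)"
  by standard
    (auto simp: cinner_add_left cinner_add_right cinner_scaleR_left cinner_scaleR_right
      scaleR_conv_of_real cmod_cinner_le intro: exI[of _ 1])

lemmas tendsto_cinner = bounded_bilinear.tendsto[OF bounded_bilinear_cinner]

lemma bounded_linear_scaleC: "bounded_linear ((*\<^sub>C) c :: 'a::complex_hilbert_space \<Rightarrow> _)"
  by (rule bounded_linear_intro[of _ "cmod c"])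
    (auto simp: scaleC_add_right scaleR_eq_scaleC scaleC_scaleC norm_scaleC mult.commute)

lemma norm_sum_orthogonal:
  fixes f :: "'i \<Rightarrow> 'a::complex_hilbert_space"
  assumes "finite I" and "\<And>i j. i \<in> I \<Longrightarrow> j \<in> I \<Longrightarrow> i \<noteq> j \<Longrightarrow> cinner (f i) (f j) = 0"
  shows "(norm (\<Sum>i\<in>I. f i))\<^sup>2 = (\<Sum>i\<in>I. (norm (f i))\<^sup>2)"
  using assms
  by (intro norm_sum_Pythagorean) (auto simp: pairwise_def real_inner_class.orthogonal_def inner_eq_Re_cinner)

definition corthonormal :: "'i set \<Rightarrow> ('i \<Rightarrow> 'a::complex_hilbert_space) \<Rightarrow> bool" where
  "corthonormal I w \<longleftrightarrow> (\<forall>i\<in>I. \<forall>j\<in>I. cinner (w i) (w j) = (if i = j then 1 else 0))"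

text \<open>Both Bessel's inequality and Parseval's identity are read off from this formula: the left-hand side
  is nonnegative, and it vanishes when \<open>x\<close> is recovered from its coefficients.\<close>

lemma norm_diff_projection:
  fixes x :: "'a::complex_hilbert_space"
  assumes "finite I" "corthonormal I w"
  shows "(norm (x - (\<Sum>i\<in>I. cinner (w i) x *\<^sub>C w i)))\<^sup>2 = (norm x)\<^sup>2 - (\<Sum>i\<in>I. (cmod (cinner (w i) x))\<^sup>2)"
proof -
  define p where "p = (\<Sum>i\<in>I. cinner (w i) x *\<^sub>C w i)"
  define S where "S = (\<Sum>i\<in>I. (cmod (cinner (w i) x))\<^sup>2)"
  have px: "cinner p x = of_real S"
    by (simp add: p_def S_def cinner_sum_left cinner_scaleC_left mult.commute
        complex_norm_square[symmetric])
  have "cinner p p = (\<Sum>i\<in>I. \<Sum>j\<in>I. cinner (w i) x * (cnj (cinner (w j) x) * cinner (w j) (w i)))"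
    by (simp add: p_def cinner_sum_left cinner_sum_right cinner_scaleC_left cinner_scaleC_right
      sum_distrib_left)
  also have "\<dots> = (\<Sum>i\<in>I. \<Sum>j\<in>I. if i = j then cinner (w i) x * cnj (cinner (w j) x) else 0)"
    using assms(2) by (intro sum.cong refl) (auto simp: corthonormal_def)
  also have "\<dots> = of_real S"
    using assms(1) by (simp add: S_def mult.commute complex_norm_square[symmetric])
  finally have pp: "cinner p p = of_real S" .
  have xp: "cinner x p = of_real S" using cinner_commute[of x p] px by simp
  have "complex_of_real ((norm (x - p))\<^sup>2) = of_real ((norm x)\<^sup>2 - S)"
    by (simp only: cinner_self[symmetric] cinner_diff_left cinner_diff_right px xp pp)
      (simp add: cinner_self)
  then show ?thesis unfolding p_def S_def using of_real_eq_iff by blast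
qed

lemma Bessel_inequality:
  fixes x :: "'a::complex_hilbert_space"
  assumes "finite I" "corthonormal I w"
  shows "(\<Sum>i\<in>I. (cmod (cinner (w i) x))\<^sup>2) \<le> (norm x)\<^sup>2"
  using norm_diff_projection[OF assms, of x] zero_le_power2[of "norm (x - (\<Sum>i\<in>I. cinner (w i) x *\<^sub>C w i))"]
  by linarith

text \<open>A minimising sequence for the distance from \<open>x\<close> to the subspace is a Cauchy sequence, by the
  parallelogram law.\<close>

lemma orthogonal_projection_exists:
  fixes S :: "'a::{real_inner,complete_space} set"
  assumes S: "0 \<in> S" "\<And>x y. x \<in> S \<Longrightarrow> y \<in> S \<Longrightarrow> x + y \<in> S" "\<And>r x. x \<in> S \<Longrightarrow> r *\<^sub>R x \<in> S"
    and closed: "closed S"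
  shows "\<exists>q\<in>S. \<forall>s\<in>S. inner (x - q) s = 0"
proof -
  define d where "d = infdist x S"
  have ne: "S \<noteq> {}" using S(1) by blast
  have d0: "0 \<le> d" by (simp add: d_def infdist_nonneg)
  have dle: "d \<le> norm (x - s)" if "s \<in> S" for s
    using infdist_le[OF that, of x] by (simp add: d_def dist_norm)
  \<comment> \<open>The distance is an infimum, and is squared here to suit the parallelogram law.\<close>
  have ex: "\<exists>s\<in>S. (norm (x - s))\<^sup>2 < d\<^sup>2 + e" if e: "e > 0" for e
  proof -
    have "d < sqrt (d\<^sup>2 + e)" using e d0 real_less_rsqrt by simp
    then have "\<exists>s\<in>S. dist x s < sqrt (d\<^sup>2 + e)"
      using cInf_lessD[of "dist x ` S" "sqrt (d\<^sup>2 + e)"] ne by (auto simp: d_def infdist_notempty)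
    then obtain s where s: "s \<in> S" "dist x s < sqrt (d\<^sup>2 + e)" by blast
    then have "(dist x s)\<^sup>2 < (sqrt (d\<^sup>2 + e))\<^sup>2" by (intro power_strict_mono) auto
    then show ?thesis using s(1) e by (auto simp: dist_norm)
  qed
  have "\<forall>n. \<exists>s. s \<in> S \<and> (norm (x - s))\<^sup>2 < d\<^sup>2 + 1 / real (Suc n)"
  proof
    fix n show "\<exists>s. s \<in> S \<and> (norm (x - s))\<^sup>2 < d\<^sup>2 + 1 / real (Suc n)"
      using ex[of "1 / real (Suc n)"] by auto
  qed
  then obtain s where s: "\<And>n. s n \<in> S" "\<And>n. (norm (x - s n))\<^sup>2 < d\<^sup>2 + 1 / real (Suc n)"
    by metis
  have par: "(norm (s m - s n))\<^sup>2 \<le> 2 / real (Suc m) + 2 / real (Suc n)" for m n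
  proof -
    have "(1/2) *\<^sub>R (s m + s n) \<in> S"
      using S s(1) by blast
    then have "d\<^sup>2 \<le> (norm (x - (1/2) *\<^sub>R (s m + s n)))\<^sup>2"
      using dle d0 by (intro power_mono) auto
    moreover have "(norm (s m - s n))\<^sup>2 + 4 * (norm (x - (1/2) *\<^sub>R (s m + s n)))\<^sup>2
        = 2 * (norm (x - s m))\<^sup>2 + 2 * (norm (x - s n))\<^sup>2"
      by (simp add: power2_norm_eq_inner inner_diff_left inner_diff_right inner_add_left
          inner_add_right inner_commute algebra_simps)
    moreover have "2 * (norm (x - s m))\<^sup>2 + 2 * (norm (x - s n))\<^sup>2
        \<le> 4 * d\<^sup>2 + 2 * (1 / real (Suc m)) + 2 * (1 / real (Suc n))"
      using s(2)[of m] s(2)[of n] by linarith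
    ultimately show ?thesis by simp
  qed
  have "Cauchy s"
  proof (rule CauchyI)
    fix e :: real assume e: "e > 0"
    then obtain N where N: "4 / e\<^sup>2 < real N" using reals_Archimedean2 by blast
    have "norm (s m - s n) < e" if mn: "m \<ge> N" "n \<ge> N" for m n
    proof -
      have "0 < real N" by (rule le_less_trans[OF _ N]) simp
      then have N0: "N > 0" by simp
      have "2 / real (Suc m) \<le> 2 / real N" "2 / real (Suc n) \<le> 2 / real N"
        using mn N0 by (auto intro!: divide_left_mono)
      then have "(norm (s m - s n))\<^sup>2 \<le> 4 / real N" using par[of m n] by simp
      also have "\<dots> < e\<^sup>2" using N N0 e by (simp add: field_simps)
      finally show ?thesis using e by (simp add: power_less_imp_less_base less_imp_le)
    qed
    then show "\<exists>N. \<forall>m\<ge>N. \<forall>n\<ge>N. norm (s m - s n) < e" by blast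
  qed
  then obtain q where q: "s \<longlonglongrightarrow> q" using Cauchy_convergent convergent_def by blast
  have qS: "q \<in> S" using closed s(1) q closed_sequentially by blast
  have qd: "(norm (x - q))\<^sup>2 \<le> d\<^sup>2"
  proof (rule LIMSEQ_le)
    show "(\<lambda>n. (norm (x - s n))\<^sup>2) \<longlonglongrightarrow> (norm (x - q))\<^sup>2" by (intro tendsto_intros q)
    have "(\<lambda>n. d\<^sup>2 + 1 / real (Suc n)) \<longlonglongrightarrow> d\<^sup>2 + 0"
      by (intro tendsto_intros LIMSEQ_Suc lim_1_over_n)
    then show "(\<lambda>n. d\<^sup>2 + 1 / real (Suc n)) \<longlonglongrightarrow> d\<^sup>2" by simp
  qed (use s(2) less_imp_le in blast)
  \<comment> \<open>Moving \<open>q\<close> along \<open>w\<close> by the optimal amount \<open>r\<close> would come closer to \<open>x\<close>.\<close>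
  have "inner (x - q) w = 0" if w: "w \<in> S" for w
  proof (cases "w = 0")
    case False
    define r where "r = inner (x - q) w / (norm w)\<^sup>2"
    have "q + r *\<^sub>R w \<in> S" using S qS w by blast
    then have "d\<^sup>2 \<le> (norm (x - (q + r *\<^sub>R w)))\<^sup>2" using dle d0 by (intro power_mono) auto
    also have "\<dots> = (norm (x - q))\<^sup>2 - 2 * r * inner (x - q) w + r * r * (norm w)\<^sup>2"
      by (simp add: power2_norm_eq_inner inner_diff_left inner_diff_right inner_add_left
          inner_add_right inner_commute algebra_simps)
    also have "\<dots> = (norm (x - q))\<^sup>2 - (inner (x - q) w)\<^sup>2 / (norm w)\<^sup>2"
      using False by (simp add: r_def field_simps power2_eq_square)
    finally have "(inner (x - q) w)\<^sup>2 / (norm w)\<^sup>2 \<le> 0" using qd by linarith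
    then show ?thesis using False by (simp add: divide_le_0_iff)
  qed simp
  then show ?thesis using qS by blast
qed

section \<open>Riemann--Stieltjes integrals as limits along tagged partitions\<close>

text \<open>The number of cells, the division points and the tags.\<close>

type_synonym tagging = "nat \<times> (nat \<Rightarrow> real) \<times> (nat \<Rightarrow> real)"

definition tagged :: "real \<Rightarrow> real \<Rightarrow> real \<Rightarrow> tagging \<Rightarrow> bool" where
  "tagged a b \<delta> = (\<lambda>(n, t, \<xi>). t 0 = a \<and> t n = b \<and>
     (\<forall>k<n. t k < t (Suc k) \<and> t (Suc k) - t k < \<delta> \<and> \<xi> k \<in> {t k..t (Suc k)}))"

text \<open>The filter of tagged partitions whose mesh tends to zero. Stating integrals as limits along it gives
  uniqueness, linearity and products of integrals from the general theory of limits.\<close>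

definition refining :: "real \<Rightarrow> real \<Rightarrow> tagging filter" where
  "refining a b = (INF \<delta>\<in>{0<..}. principal {p. tagged a b \<delta> p})"

definition RS_sum :: "(real \<Rightarrow> real) \<Rightarrow> (real \<Rightarrow> 'b::real_normed_vector) \<Rightarrow> tagging \<Rightarrow> 'b" where
  "RS_sum f \<rho> = (\<lambda>(n, t, \<xi>). \<Sum>k<n. f (\<xi> k) *\<^sub>R (\<rho> (t (Suc k)) - \<rho> (t k)))"

lemma eventually_refining: "eventually P (refining a b) \<longleftrightarrow> (\<exists>\<delta>>0. \<forall>p. tagged a b \<delta> p \<longrightarrow> P p)"
proof -
  have "eventually P (refining a b) \<longleftrightarrow> (\<exists>\<delta>\<in>{0<..}. eventually P (principal {p. tagged a b \<delta> p}))"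
    unfolding refining_def
  proof (rule eventually_INF_base)
    fix \<delta> \<eta> :: real assume "\<delta> \<in> {0<..}" "\<eta> \<in> {0<..}"
    then show "\<exists>\<epsilon>\<in>{0<..}. principal {p. tagged a b \<epsilon> p}
        \<le> inf (principal {p. tagged a b \<delta> p}) (principal {p. tagged a b \<eta> p})"
      by (intro bexI[of _ "min \<delta> \<eta>"]) (auto simp: tagged_def)
  qed auto
  then show ?thesis by (auto simp: eventually_principal)
qed

lemma eventually_tagged: "\<delta> > 0 \<Longrightarrow> eventually (tagged a b \<delta>) (refining a b)"
  by (auto simp: eventually_refining)

lemma has_RS_integral_iff: "has_RS_integral f \<rho> a b I \<longleftrightarrow> (RS_sum f \<rho> \<longlongrightarrow> I) (refining a b)"
  unfolding has_RS_integral_def tendsto_iff eventually_refining tagged_def RS_sum_def dist_norm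
  by auto

text \<open>The uniform partition, with each inner point moved by less than a quarter of the mesh into a
  prescribed dense set.\<close>

lemma fine_partition_in_dense_set:
  assumes ab: "a < b" and \<delta>: "\<delta> > 0" and C: "a \<in> C" "b \<in> C"
    and dense: "\<And>p q. p < q \<Longrightarrow> \<exists>r\<in>C. p < r \<and> r < q"
  shows "\<exists>n t. tagged a b \<delta> (n, t, t) \<and> (\<forall>k\<le>n. t k \<in> C)"
proof -
  obtain n where n: "2 * (b - a) / \<delta> < real n" using reals_Archimedean2 by blast
  have "0 < 2 * (b - a) / \<delta>" using ab \<delta> by simp
  then have n0: "0 < real n" using n by linarith
  define h where "h = (b - a) / real n"
  have h0: "0 < h" using ab n0 by (simp add: h_def)
  have h1: "h < \<delta> / 2" using n n0 \<delta> by (simp add: h_def field_simps)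
  have "\<exists>r. r \<in> C \<and> a + real k * h - h / 4 < r \<and> r < a + real k * h + h / 4" for k
    using dense[of "a + real k * h - h / 4" "a + real k * h + h / 4"] h0 by auto
  then obtain r where r: "\<And>k. r k \<in> C" "\<And>k. a + real k * h - h / 4 < r k"
      "\<And>k. r k < a + real k * h + h / 4"
    by metis
  define t where "t k = (if k = 0 then a else if k = n then b else r k)" for k
  have b: "b = a + real n * h" using n0 by (simp add: h_def)
  have t: "a + real k * h - h / 4 < t k" "t k < a + real k * h + h / 4" for k
    using r[of k] h0 b by (auto simp: t_def)
  have "tagged a b \<delta> (n, t, t)"
    unfolding tagged_def
  proof (clarsimp, intro conjI allI impI)
    show "t 0 = a" by (simp add: t_def)
    show "t n = b" using n0 by (simp add: t_def)
    fix k assume "k < n"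
    have s: "a + real (Suc k) * h = a + real k * h + h" by (simp add: algebra_simps)
    show lt: "t k < t (Suc k)" using t[of k] t[of "Suc k"] h0 s by linarith
    show "t (Suc k) - t k < \<delta>" using t[of k] t[of "Suc k"] h0 h1 s by linarith
    show "t k \<le> t (Suc k)" using lt by simp
  qed
  moreover have "\<forall>k\<le>n. t k \<in> C" using C r by (auto simp: t_def)
  ultimately show ?thesis by blast
qed

lemma refining_neq_bot: assumes "a < b" shows "refining a b \<noteq> bot"
  unfolding trivial_limit_def eventually_refining
proof clarify
  fix \<delta> :: real assume \<delta>: "\<delta> > 0" "\<forall>p. tagged a b \<delta> p \<longrightarrow> False"
  show False
    using fine_partition_in_dense_set[OF assms \<delta>(1), of UNIV] dense \<delta>(2) by auto
qed

lemma has_RS_integral_unique: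
  "has_RS_integral f \<rho> a b I \<Longrightarrow> has_RS_integral f \<rho> a b J \<Longrightarrow> a < b \<Longrightarrow> I = J"
  unfolding has_RS_integral_iff using tendsto_unique refining_neq_bot by blast

lemma tagged_le:
  assumes p: "tagged a b \<delta> (n, t, \<xi>)" and ij: "i \<le> j" "j \<le> n"
  shows "t i \<le> t j"
  using ij
proof (induction j rule: dec_induct)
  case (step j)
  then have "t j < t (Suc j)" using p by (simp add: tagged_def)
  then show ?case using step by auto
qed simp

lemma tagged_cell:
  assumes "tagged a b \<delta> (n, t, \<xi>)" "k < n"
  shows "t k < t (Suc k)" "t (Suc k) - t k < \<delta>" "t k \<le> \<xi> k" "\<xi> k \<le> t (Suc k)"
  using assms by (auto simp: tagged_def)

lemma tagged_ends:
  assumes "tagged a b \<delta> (n, t, \<xi>)" shows "t 0 = a" "t n = b"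
  using assms by (auto simp: tagged_def)

lemma taggedI:
  assumes "t 0 = a" "t n = b" "\<And>k. k < n \<Longrightarrow> t k < t (Suc k)" "\<And>k. k < n \<Longrightarrow> t (Suc k) - t k < \<delta>"
    "\<And>k. k < n \<Longrightarrow> t k \<le> \<xi> k" "\<And>k. k < n \<Longrightarrow> \<xi> k \<le> t (Suc k)"
  shows "tagged a b \<delta> (n, t, \<xi>)"
  using assms by (auto simp: tagged_def)

lemma tagged_range:
  assumes "tagged a b \<delta> (n, t, \<xi>)" "k \<le> n" shows "a \<le> t k" "t k \<le> b"
  using tagged_le[OF assms(1), of 0 k] tagged_le[OF assms(1), of k n] tagged_ends[OF assms(1)] assms(2)
  by simp_all

lemma tagged_tag_range:
  assumes "tagged a b \<delta> (n, t, \<xi>)" "k < n" shows "a \<le> \<xi> k" "\<xi> k \<le> b"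
  using tagged_range[OF assms(1), of k] tagged_range[OF assms(1), of "Suc k"] tagged_cell[OF assms] assms(2)
  by linarith+

lemma tagged_retag:
  assumes "tagged a b \<delta> (n, t, \<xi>)" "\<And>k. k < n \<Longrightarrow> \<eta> k \<in> {t k..t (Suc k)}"
  shows "tagged a b \<delta> (n, t, \<eta>)"
  using assms by (auto simp: tagged_def)

text \<open>At the index \<open>n\<close> the second partition is used; its first point is the last point of the first one.\<close>

definition juxtapose :: "tagging \<Rightarrow> tagging \<Rightarrow> tagging" where
  "juxtapose = (\<lambda>(n, t, \<xi>) (m, s, \<eta>). (n + m, (\<lambda>k. if k < n then t k else s (k - n)),
     (\<lambda>k. if k < n then \<xi> k else \<eta> (k - n))))"

lemma sum_lessThan_add: "(\<Sum>k<n + m. g k) = (\<Sum>k<n. g k) + (\<Sum>k<m. g (n + k))"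
  for g :: "nat \<Rightarrow> 'b::comm_monoid_add"
  by (induction m) (auto simp: add.assoc)

lemma tagged_juxtapose:
  assumes "tagged a c \<delta> p" "tagged c b \<delta> q" shows "tagged a b \<delta> (juxtapose p q)"
proof -
  obtain n t \<xi> m s \<eta> where pq: "p = (n, t, \<xi>)" "q = (m, s, \<eta>)" by (cases p, cases q)
  note P = assms(1)[unfolded pq] and Q = assms(2)[unfolded pq]
  define T where "T k = (if k < n then t k else s (k - n))" for k
  define X where "X k = (if k < n then \<xi> k else \<eta> (k - n))" for k
  have L: "T k = t k" if "k \<le> n" for k
    using that tagged_ends[OF P] tagged_ends[OF Q] by (cases "k = n") (simp_all add: T_def)
  have R: "T (n + k) = s k" for k by (simp add: T_def)
  have "T k < T (Suc k) \<and> T (Suc k) - T k < \<delta> \<and> T k \<le> X k \<and> X k \<le> T (Suc k)" if "k < n + m" for k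
  proof (cases "k < n")
    case True
    then show ?thesis using tagged_cell[OF P True] L[of k] L[of "Suc k"] by (simp add: X_def)
  next
    case False
    then obtain j where j: "k = n + j" "j < m" using \<open>k < n + m\<close> by (metis le_Suc_ex nat_add_left_cancel_less not_less)
    then show ?thesis using tagged_cell[OF Q j(2)] R[of j] R[of "Suc j"] by (simp add: X_def)
  qed
  moreover have "T 0 = a" using L[of 0] tagged_ends[OF P] by simp
  moreover have "T (n + m) = b" using R[of m] tagged_ends[OF Q] by simp
  ultimately have "tagged a b \<delta> (n + m, T, X)" by (intro taggedI) auto
  then show ?thesis unfolding pq juxtapose_def T_def X_def by simp
qed

lemma sum_juxtapose:
  fixes H :: "real \<Rightarrow> real \<Rightarrow> real \<Rightarrow> 'b::comm_monoid_add"
  assumes P: "tagged a c \<delta> (n, t, \<xi>)" and Q: "tagged c b \<delta> (m, s, \<eta>)"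
  defines "T \<equiv> \<lambda>k. if k < n then t k else s (k - n)"
    and "X \<equiv> \<lambda>k. if k < n then \<xi> k else \<eta> (k - n)"
  shows "(\<Sum>k<n + m. H (X k) (T k) (T (Suc k)))
    = (\<Sum>k<n. H (\<xi> k) (t k) (t (Suc k))) + (\<Sum>k<m. H (\<eta> k) (s k) (s (Suc k)))"
proof -
  have L: "T k = t k" if "k \<le> n" for k
    using that tagged_ends[OF P] tagged_ends[OF Q] by (cases "k = n") (simp_all add: T_def)
  have R: "T (n + k) = s k" for k by (simp add: T_def)
  have "(\<Sum>k<n. H (X k) (T k) (T (Suc k))) = (\<Sum>k<n. H (\<xi> k) (t k) (t (Suc k)))"
    by (intro sum.cong refl) (simp add: L X_def)
  moreover have "(\<Sum>k<m. H (X (n + k)) (T (n + k)) (T (Suc (n + k)))) = (\<Sum>k<m. H (\<eta> k) (s k) (s (Suc k)))"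
    using R[of "Suc _"] by (intro sum.cong refl) (simp add: R X_def)
  ultimately show ?thesis unfolding sum_lessThan_add by simp
qed

lemma RS_sum_juxtapose:
  assumes "tagged a c \<delta> p" "tagged c b \<delta> q"
  shows "RS_sum f \<rho> (juxtapose p q) = RS_sum f \<rho> p + RS_sum f \<rho> q"
proof -
  obtain n t \<xi> m s \<eta> where pq: "p = (n, t, \<xi>)" "q = (m, s, \<eta>)" by (cases p, cases q)
  show ?thesis
    using sum_juxtapose[OF assms[unfolded pq], of "\<lambda>x y z. f x *\<^sub>R (\<rho> z - \<rho> y)"]
    unfolding pq RS_sum_def juxtapose_def by simp
qed

lemma eventually_tagged_pair:
  assumes "\<delta> > 0"
  shows "\<forall>\<^sub>F x in refining a c \<times>\<^sub>F refining c b. tagged a c \<delta> (fst x) \<and> tagged c b \<delta> (snd x)"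
  using eventually_prodI[OF eventually_tagged eventually_tagged, OF assms assms] .

lemma filterlim_juxtapose:
  "filterlim (\<lambda>(p, q). juxtapose p q) (refining a b) (refining a c \<times>\<^sub>F refining c b)"
  unfolding filterlim_iff
proof clarify
  fix P assume "eventually P (refining a b)"
  then obtain \<delta> where \<delta>: "\<delta> > 0" "\<And>p. tagged a b \<delta> p \<Longrightarrow> P p" unfolding eventually_refining by blast
  have "\<forall>\<^sub>F x in refining a c \<times>\<^sub>F refining c b. tagged a c \<delta> (fst x) \<and> tagged c b \<delta> (snd x)"
    by (rule eventually_tagged_pair[OF \<delta>(1)])
  then show "\<forall>\<^sub>F x in refining a c \<times>\<^sub>F refining c b. P (case x of (p, q) \<Rightarrow> juxtapose p q)"
  proof (rule eventually_mono)
    fix x assume "tagged a c \<delta> (fst x) \<and> tagged c b \<delta> (snd x)"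
    then show "P (case x of (p, q) \<Rightarrow> juxtapose p q)"
      using \<delta>(2)[OF tagged_juxtapose[of a c \<delta> "fst x" b "snd x"]] by (simp add: case_prod_beta)
  qed
qed

text \<open>Additivity over intervals, for integrals that are known to exist: juxtaposition turns two fine
  partitions into a fine partition of the whole interval, and the sums add up.\<close>

lemma has_RS_integral_combine:
  assumes "has_RS_integral f \<rho> a c I" "has_RS_integral f \<rho> c b J" "has_RS_integral f \<rho> a b K"
    and "a < c" "c < b"
  shows "K = I + J"
proof (rule tendsto_unique)
  let ?F = "refining a c \<times>\<^sub>F refining c b"
  show "?F \<noteq> bot" using refining_neq_bot assms(4,5) by (simp add: prod_filter_eq_bot)
  show "((\<lambda>x. RS_sum f \<rho> (case x of (p, q) \<Rightarrow> juxtapose p q)) \<longlongrightarrow> K) ?F"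
    using filterlim_compose[OF assms(3)[unfolded has_RS_integral_iff] filterlim_juxtapose] .
  have "((\<lambda>x. RS_sum f \<rho> (fst x) + RS_sum f \<rho> (snd x)) \<longlongrightarrow> I + J) ?F"
    by (rule tendsto_add[OF filterlim_compose[OF assms(1)[unfolded has_RS_integral_iff] filterlim_fst]
          filterlim_compose[OF assms(2)[unfolded has_RS_integral_iff] filterlim_snd]])
  moreover have "\<forall>\<^sub>F x in ?F. tagged a c 1 (fst x) \<and> tagged c b 1 (snd x)"
    by (rule eventually_tagged_pair) simp
  then have "\<forall>\<^sub>F x in ?F. RS_sum f \<rho> (fst x) + RS_sum f \<rho> (snd x)
      = RS_sum f \<rho> (case x of (p, q) \<Rightarrow> juxtapose p q)"
    by (rule eventually_mono) (simp add: RS_sum_juxtapose[of a c 1 _ b] case_prod_beta)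
  ultimately show "((\<lambda>x. RS_sum f \<rho> (case x of (p, q) \<Rightarrow> juxtapose p q)) \<longlongrightarrow> I + J) ?F"
    by (rule Lim_transform_eventually)
qed

lemma Cauchy_imp_has_RS_integral:
  fixes \<rho> :: "real \<Rightarrow> 'b::{real_normed_vector,complete_space}"
  assumes ab: "a < b"
    and Cauchy: "\<And>\<epsilon>. \<epsilon> > 0 \<Longrightarrow> \<exists>P. eventually P (refining a b) \<and>
      (\<forall>p q. P p \<longrightarrow> P q \<longrightarrow> norm (RS_sum f \<rho> p - RS_sum f \<rho> q) < \<epsilon>)"
  shows "\<exists>I. has_RS_integral f \<rho> a b I"
proof -
  let ?G = "filtermap (RS_sum f \<rho>) (refining a b)"
  have "cauchy_filter ?G"
    unfolding cauchy_filter_metric_filtermap dist_norm using Cauchy by blast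
  moreover have "?G \<noteq> bot" using refining_neq_bot[OF ab] by (simp add: filtermap_bot_iff)
  ultimately have "\<exists>I\<in>UNIV. ?G \<le> nhds I"
    using complete_UNIV[where 'a = 'b] unfolding complete_uniform by simp
  then show ?thesis by (auto simp: has_RS_integral_iff filterlim_def)
qed

text \<open>Darboux's criterion, with two arbitrary tags in each cell in place of the supremum and the infimum.
  In this form it applies to tags that are chosen later, at the eigenvalues of a finite section or in a
  second partition.\<close>

definition small_oscillation :: "(real \<Rightarrow> real) \<Rightarrow> (real \<Rightarrow> real) \<Rightarrow> real \<Rightarrow> real \<Rightarrow> bool" where
  "small_oscillation f \<rho> a b \<longleftrightarrow> (\<forall>\<epsilon>>0. \<exists>\<delta>>0. \<forall>n t \<xi> \<eta>. tagged a b \<delta> (n, t, \<xi>) \<longrightarrow> tagged a b \<delta> (n, t, \<eta>) \<longrightarrow>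
     (\<Sum>k<n. \<bar>f (\<xi> k) - f (\<eta> k)\<bar> * (\<rho> (t (Suc k)) - \<rho> (t k))) < \<epsilon>)"

text \<open>Two tags in the same cell can be ordered by the value of \<open>f\<close>, so that the sum of the absolute
  differences is itself a difference of two Riemann--Stieltjes sums.\<close>

lemma RS_integrable_imp_small_oscillation:
  assumes "RS_integrable f \<rho> a b" shows "small_oscillation f \<rho> a b"
  unfolding small_oscillation_def
proof (intro allI impI)
  fix \<epsilon> :: real assume \<epsilon>: "\<epsilon> > 0"
  obtain I where "(RS_sum f \<rho> \<longlongrightarrow> I) (refining a b)"
    using assms by (auto simp: RS_integrable_def has_RS_integral_iff)
  then have "\<forall>\<^sub>F p in refining a b. dist (RS_sum f \<rho> p) I < \<epsilon> / 2"
    using \<epsilon> by (intro tendstoD) auto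
  then obtain \<delta> where \<delta>: "\<delta> > 0" "\<And>p. tagged a b \<delta> p \<Longrightarrow> dist (RS_sum f \<rho> p) I < \<epsilon> / 2"
    unfolding eventually_refining by blast
  have "(\<Sum>k<n. \<bar>f (\<xi> k) - f (\<eta> k)\<bar> * (\<rho> (t (Suc k)) - \<rho> (t k))) < \<epsilon>"
    if p: "tagged a b \<delta> (n, t, \<xi>)" "tagged a b \<delta> (n, t, \<eta>)" for n t \<xi> \<eta>
  proof -
    define \<mu> where "\<mu> k = (if f (\<eta> k) \<le> f (\<xi> k) then \<xi> k else \<eta> k)" for k
    define \<nu> where "\<nu> k = (if f (\<eta> k) \<le> f (\<xi> k) then \<eta> k else \<xi> k)" for k
    have "\<mu> k \<in> {t k..t (Suc k)}" "\<nu> k \<in> {t k..t (Suc k)}" if "k < n" for k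
      using that p by (auto simp: \<mu>_def \<nu>_def tagged_def)
    then have t: "tagged a b \<delta> (n, t, \<mu>)" "tagged a b \<delta> (n, t, \<nu>)"
      using tagged_retag[OF p(1)] by blast+
    have "(\<Sum>k<n. \<bar>f (\<xi> k) - f (\<eta> k)\<bar> * (\<rho> (t (Suc k)) - \<rho> (t k)))
        = RS_sum f \<rho> (n, t, \<mu>) - RS_sum f \<rho> (n, t, \<nu>)"
      unfolding RS_sum_def by (auto simp: sum_subtractf[symmetric] \<mu>_def \<nu>_def algebra_simps intro!: sum.cong)
    also have "\<dots> < \<epsilon>" using \<delta>(2)[OF t(1)] \<delta>(2)[OF t(2)] by (simp add: dist_real_def abs_if split: if_splits)
    finally show ?thesis .
  qed
  then show "\<exists>\<delta>>0. \<forall>n t \<xi> \<eta>. tagged a b \<delta> (n, t, \<xi>) \<longrightarrow> tagged a b \<delta> (n, t, \<eta>) \<longrightarrow>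
     (\<Sum>k<n. \<bar>f (\<xi> k) - f (\<eta> k)\<bar> * (\<rho> (t (Suc k)) - \<rho> (t k))) < \<epsilon>"
    using \<delta>(1) by blast
qed

lemma small_oscillationE:
  assumes "small_oscillation f \<rho> a b" "\<epsilon> > 0"
  obtains \<delta> where "\<delta> > 0"
    "\<And>n t \<xi> \<eta>. tagged a b \<delta> (n, t, \<xi>) \<Longrightarrow> tagged a b \<delta> (n, t, \<eta>) \<Longrightarrow>
       (\<Sum>k<n. \<bar>f (\<xi> k) - f (\<eta> k)\<bar> * (\<rho> (t (Suc k)) - \<rho> (t k))) < \<epsilon>"
  using assms unfolding small_oscillation_def by blast

text \<open>A partition of the smaller interval extends to one of the larger interval with the same mesh,
  whose additional cells contribute nothing negative.\<close>

lemma small_oscillation_subinterval: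
  assumes f: "small_oscillation f \<rho> a b" and mono: "mono \<rho>" and sub: "a < a'" "b' < b"
  shows "small_oscillation f \<rho> a' b'"
  unfolding small_oscillation_def
proof (intro allI impI)
  fix \<epsilon> :: real assume \<epsilon>: "\<epsilon> > 0"
  obtain \<delta> where \<delta>: "\<delta> > 0" "\<And>n t \<xi> \<eta>. tagged a b \<delta> (n, t, \<xi>) \<Longrightarrow> tagged a b \<delta> (n, t, \<eta>) \<Longrightarrow>
     (\<Sum>k<n. \<bar>f (\<xi> k) - f (\<eta> k)\<bar> * (\<rho> (t (Suc k)) - \<rho> (t k))) < \<epsilon>"
    using small_oscillationE[OF f \<epsilon>] by blast
  obtain n1 t1 where L: "tagged a a' \<delta> (n1, t1, t1)"
    using fine_partition_in_dense_set[OF sub(1) \<delta>(1), of UNIV] dense by auto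
  obtain n2 t2 where R: "tagged b' b \<delta> (n2, t2, t2)"
    using fine_partition_in_dense_set[OF sub(2) \<delta>(1), of UNIV] dense by auto
  have "(\<Sum>k<n. \<bar>f (\<xi> k) - f (\<eta> k)\<bar> * (\<rho> (t (Suc k)) - \<rho> (t k))) < \<epsilon>"
    if p: "tagged a' b' \<delta> (n, t, \<xi>)" "tagged a' b' \<delta> (n, t, \<eta>)" for n t \<xi> \<eta>
  proof -
    define N where "N = n1 + n + n2"
    define T where "T k = (if k < n1 then t1 k else if k < n1 + n then t (k - n1) else t2 (k - n1 - n))" for k
    define X where "X \<xi> k = (if k < n1 then t1 k else if k < n1 + n then \<xi> (k - n1) else t2 (k - n1 - n))"
      for \<xi> :: "nat \<Rightarrow> real" and k
    have J: "juxtapose (juxtapose (n1, t1, t1) (n, t, \<zeta>)) (n2, t2, t2) = (N, T, X \<zeta>)" for \<zeta>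
      unfolding juxtapose_def N_def T_def X_def by (auto simp: fun_eq_iff)
    have tag: "tagged a b \<delta> (N, T, X \<xi>)" "tagged a b \<delta> (N, T, X \<eta>)"
      using tagged_juxtapose[OF tagged_juxtapose[OF L p(1)] R]
        tagged_juxtapose[OF tagged_juxtapose[OF L p(2)] R] unfolding J by blast+
    have pos: "0 \<le> \<rho> (T (Suc k)) - \<rho> (T k)" if "k < N" for k
      using monoD[OF mono less_imp_le[OF tagged_cell(1)[OF tag(1) that]]] by simp
    have tn: "T (n1 + k) = t k" if "k \<le> n" for k
    proof (cases "k = n")
      case True
      then show ?thesis using tagged_ends[OF p(1)] tagged_ends[OF R] by (simp add: T_def)
    qed (use that in \<open>simp add: T_def\<close>)
    have "(\<Sum>k<n. \<bar>f (\<xi> k) - f (\<eta> k)\<bar> * (\<rho> (t (Suc k)) - \<rho> (t k)))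
        = (\<Sum>k<n. \<bar>f (X \<xi> (n1 + k)) - f (X \<eta> (n1 + k))\<bar> * (\<rho> (T (Suc (n1 + k))) - \<rho> (T (n1 + k))))"
    proof (intro sum.cong refl)
      fix k assume "k \<in> {..<n}"
      then show "\<bar>f (\<xi> k) - f (\<eta> k)\<bar> * (\<rho> (t (Suc k)) - \<rho> (t k)) =
          \<bar>f (X \<xi> (n1 + k)) - f (X \<eta> (n1 + k))\<bar> * (\<rho> (T (Suc (n1 + k))) - \<rho> (T (n1 + k)))"
        using tn[of k] tn[of "Suc k"] by (simp add: X_def)
    qed
    also have "\<dots> = (\<Sum>k\<in>(+) n1 ` {..<n}. \<bar>f (X \<xi> k) - f (X \<eta> k)\<bar> * (\<rho> (T (Suc k)) - \<rho> (T k)))"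
      by (subst sum.reindex) auto
    also have "\<dots> \<le> (\<Sum>k<N. \<bar>f (X \<xi> k) - f (X \<eta> k)\<bar> * (\<rho> (T (Suc k)) - \<rho> (T k)))"
      using pos by (intro sum_mono2) (auto simp: N_def intro!: mult_nonneg_nonneg)
    also have "\<dots> < \<epsilon>" using \<delta>(2)[OF tag] .
    finally show ?thesis .
  qed
  then show "\<exists>\<delta>>0. \<forall>n t \<xi> \<eta>. tagged a' b' \<delta> (n, t, \<xi>) \<longrightarrow> tagged a' b' \<delta> (n, t, \<eta>) \<longrightarrow>
     (\<Sum>k<n. \<bar>f (\<xi> k) - f (\<eta> k)\<bar> * (\<rho> (t (Suc k)) - \<rho> (t k))) < \<epsilon>"
    using \<delta>(1) by blast
qed

lemma small_oscillation_continuous: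
  assumes f: "continuous_on {a..b} f" and mono: "mono \<rho>"
  shows "small_oscillation f \<rho> a b"
  unfolding small_oscillation_def
proof (intro allI impI)
  fix \<epsilon> :: real assume \<epsilon>: "\<epsilon> > 0"
  \<comment> \<open>The \<open>1\<close> avoids a division by zero when \<open>\<rho>\<close> is constant.\<close>
  define e where "e = \<epsilon> / (1 + \<bar>\<rho> b - \<rho> a\<bar>)"
  have e: "e > 0" using \<epsilon> by (simp add: e_def)
  have "uniformly_continuous_on {a..b} f" using f by (intro compact_uniformly_continuous) auto
  then obtain \<delta> where \<delta>: "\<delta> > 0"
      "\<And>x y. x \<in> {a..b} \<Longrightarrow> y \<in> {a..b} \<Longrightarrow> \<bar>y - x\<bar> < \<delta> \<Longrightarrow> \<bar>f y - f x\<bar> < e"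
    unfolding uniformly_continuous_on_def dist_real_def using e by metis
  have "(\<Sum>k<n. \<bar>f (\<xi> k) - f (\<eta> k)\<bar> * (\<rho> (t (Suc k)) - \<rho> (t k))) < \<epsilon>"
    if p: "tagged a b \<delta> (n, t, \<xi>)" "tagged a b \<delta> (n, t, \<eta>)" for n t \<xi> \<eta>
  proof -
    have "(\<Sum>k<n. \<bar>f (\<xi> k) - f (\<eta> k)\<bar> * (\<rho> (t (Suc k)) - \<rho> (t k)))
        \<le> (\<Sum>k<n. e * (\<rho> (t (Suc k)) - \<rho> (t k)))"
    proof (intro sum_mono mult_right_mono)
      fix k assume k: "k \<in> {..<n}"
      then have kn: "k < n" by simp
      have "\<bar>\<xi> k - \<eta> k\<bar> < \<delta>"
        using tagged_cell[OF p(1) kn] tagged_cell[OF p(2) kn] by linarith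
      then show "\<bar>f (\<xi> k) - f (\<eta> k)\<bar> \<le> e"
        using \<delta>(2)[of "\<eta> k" "\<xi> k"] tagged_tag_range[OF p(1) kn] tagged_tag_range[OF p(2) kn] by simp
      show "0 \<le> \<rho> (t (Suc k)) - \<rho> (t k)"
        using monoD[OF mono less_imp_le[OF tagged_cell(1)[OF p(1) kn]]] by simp
    qed
    also have "\<dots> = e * (\<rho> b - \<rho> a)"
      using sum_lessThan_telescope[of "\<lambda>k. \<rho> (t k)" n] tagged_ends[OF p(1)]
      by (simp add: sum_distrib_left[symmetric])
    also have "\<dots> < \<epsilon>"
    proof -
      have "e * (\<rho> b - \<rho> a) < e * (1 + \<bar>\<rho> b - \<rho> a\<bar>)" using e by (intro mult_strict_left_mono) auto
      also have "\<dots> = \<epsilon>"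
      proof -
        have "1 + \<bar>\<rho> b - \<rho> a\<bar> \<noteq> 0" using abs_ge_zero[of "\<rho> b - \<rho> a"] by linarith
        then show ?thesis by (simp add: e_def)
      qed
      finally show ?thesis .
    qed
    finally show ?thesis .
  qed
  then show "\<exists>\<delta>>0. \<forall>n t \<xi> \<eta>. tagged a b \<delta> (n, t, \<xi>) \<longrightarrow> tagged a b \<delta> (n, t, \<eta>) \<longrightarrow>
     (\<Sum>k<n. \<bar>f (\<xi> k) - f (\<eta> k)\<bar> * (\<rho> (t (Suc k)) - \<rho> (t k))) < \<epsilon>"
    using \<delta>(1) by blast
qed

section \<open>Integrals with respect to a spectral family\<close>

lemma norm_square_eq: "(norm (x::'a::complex_hilbert_space))\<^sup>2 = Re (cinner x x)"
  by (simp only: cinner_self Re_complex_of_real)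

lemma improper_filter_neq_bot: "at_bot \<times>\<^sub>F at_top \<noteq> (bot :: (real \<times> real) filter)"
  by (simp add: prod_filter_eq_bot)

lemma eventually_improper: "\<forall>\<^sub>F x in at_bot \<times>\<^sub>F at_top. fst x < (p::real) \<and> (q::real) < snd x"
  using eventually_prodI[OF eventually_gt_at_bot[of p] eventually_gt_at_top[of q]] .

lemma finite_arg_max:
  fixes h :: "'i \<Rightarrow> real"
  assumes "finite S" "S \<noteq> {}" shows "\<exists>\<alpha>\<in>S. \<forall>p\<in>S. h p \<le> h \<alpha>"
proof -
  have "Max (h ` S) \<in> h ` S" using assms by (intro Max_in) auto
  then obtain \<alpha> where \<alpha>: "\<alpha> \<in> S" "Max (h ` S) = h \<alpha>" by blast
  then have "\<forall>p\<in>S. h p \<le> h \<alpha>" using assms(1) Max_ge[of "h ` S"] by auto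
  then show ?thesis using \<alpha>(1) by blast
qed

lemma eventually_tagged_one: "eventually (tagged a b 1) (refining a b)"
  by (rule eventually_tagged) simp

locale spectral =
  fixes D :: "'a::complex_hilbert_space set" and A :: "'a \<Rightarrow> 'a" and E :: "real \<Rightarrow> 'a \<Rightarrow> 'a"
  assumes spectral_family: "spectral_family D A E"
begin

lemma E_add: "E t (x + y) = E t x + E t y"
  and E_scaleC: "E t (c *\<^sub>C x) = c *\<^sub>C E t x"
  and E_sym: "cinner (E t x) y = cinner x (E t y)"
  and E_E: "E s (E t x) = E (min s t) x"
  and E_at_right: "((\<lambda>s. E s x) \<longlongrightarrow> E t x) (at_right t)"
  and E_at_bot: "((\<lambda>t. E t x) \<longlongrightarrow> 0) at_bot"
  and E_at_top: "((\<lambda>t. E t x) \<longlongrightarrow> x) at_top"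
  and D_eq: "D = {x. \<exists>c. has_RS_integral_line (\<lambda>t. t\<^sup>2) (\<lambda>t. (norm (E t x))\<^sup>2) c}"
  and A_integral: "x \<in> D \<Longrightarrow> has_RS_integral_line (\<lambda>t. t) (\<lambda>t. E t x) (A x)"
proof -
  have 1: "\<forall>t x y. E t (x + y) = E t x + E t y"
    and 2: "\<forall>t c x. E t (c *\<^sub>C x) = c *\<^sub>C E t x"
    and 3: "\<forall>t x y. cinner (E t x) y = cinner x (E t y)"
    and 4: "\<forall>s t x. E s (E t x) = E (min s t) x"
    and 5: "\<forall>t x. ((\<lambda>s. E s x) \<longlongrightarrow> E t x) (at_right t)"
    and 6: "\<forall>x. ((\<lambda>t. E t x) \<longlongrightarrow> 0) at_bot"
    and 7: "\<forall>x. ((\<lambda>t. E t x) \<longlongrightarrow> x) at_top"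
    and 8: "D = {x. \<exists>c. has_RS_integral_line (\<lambda>t. t\<^sup>2) (\<lambda>t. (norm (E t x))\<^sup>2) c}"
    and 9: "\<forall>x\<in>D. has_RS_integral_line (\<lambda>t. t) (\<lambda>t. E t x) (A x)"
    using spectral_family unfolding spectral_family_def by - (elim conjE, assumption)+
  show "E t (x + y) = E t x + E t y" by (rule 1[rule_format])
  show "E t (c *\<^sub>C x) = c *\<^sub>C E t x" by (rule 2[rule_format])
  show "cinner (E t x) y = cinner x (E t y)" by (rule 3[rule_format])
  show "E s (E t x) = E (min s t) x" by (rule 4[rule_format])
  show "((\<lambda>s. E s x) \<longlongrightarrow> E t x) (at_right t)" by (rule 5[rule_format])
  show "((\<lambda>t. E t x) \<longlongrightarrow> 0) at_bot" by (rule 6[rule_format])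
  show "((\<lambda>t. E t x) \<longlongrightarrow> x) at_top" by (rule 7[rule_format])
  show "D = {x. \<exists>c. has_RS_integral_line (\<lambda>t. t\<^sup>2) (\<lambda>t. (norm (E t x))\<^sup>2) c}" by (rule 8)
  show "x \<in> D \<Longrightarrow> has_RS_integral_line (\<lambda>t. t) (\<lambda>t. E t x) (A x)" by (rule 9[rule_format])
qed


lemma E_scaleR: "E t (r *\<^sub>R x) = r *\<^sub>R E t x"
  by (simp add: scaleR_eq_scaleC E_scaleC)

lemma E_zero: "E t 0 = 0"
  using E_scaleR[of t 0 0] by simp

lemma E_minus: "E t (- x) = - E t x"
  using E_scaleR[of t "-1" x] by simp

lemma E_diff: "E t (x - y) = E t x - E t y"
  using E_add[of t x "- y"] by (simp add: E_minus)

text \<open>The spectral projection of the half-open interval \<open>(s, t]\<close>.\<close>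

definition band :: "real \<Rightarrow> real \<Rightarrow> 'a \<Rightarrow> 'a" where
  "band s t x = E t x - E s x"

lemma band_add: "band s t (x + y) = band s t x + band s t y"
  by (simp add: band_def E_add)

lemma band_diff: "band s t (x - y) = band s t x - band s t y"
  by (simp add: band_def E_diff)

lemma band_scaleR: "band s t (r *\<^sub>R x) = r *\<^sub>R band s t x"
  by (simp add: band_def E_scaleR scaleR_diff_right)

lemma band_zero: "band s t 0 = 0"
  by (simp add: band_def E_zero)

lemma band_sum: "band s t (\<Sum>i\<in>I. f i) = (\<Sum>i\<in>I. band s t (f i))"
  by (induction I rule: infinite_finite_induct) (auto simp: band_zero band_add)

lemma band_sym: "cinner (band s t x) y = cinner x (band s t y)"
  by (simp add: band_def cinner_diff_left cinner_diff_right E_sym)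

lemma band_commute: "band s t (band s' t' x) = band s' t' (band s t x)"
  by (simp add: band_def E_diff E_E min.commute)

lemma band_disjoint:
  assumes "s \<le> t" "t \<le> s'" "s' \<le> t'"
  shows "band s t (band s' t' x) = 0" "band s' t' (band s t x) = 0"
proof -
  show "band s t (band s' t' x) = 0"
    using assms by (simp add: band_def E_diff E_E min_absorb1)
  then show "band s' t' (band s t x) = 0" by (simp add: band_commute)
qed

lemma band_subset:
  assumes "s' \<le> s" "s \<le> t" "t \<le> t'"
  shows "band s t (band s' t' x) = band s t x"
  using assms by (simp add: band_def E_diff E_E min_absorb1 min_absorb2)

lemma cinner_E_E: "cinner (E t x) (E t y) = cinner x (E t y)"
  by (simp add: E_sym E_E)

lemma cinner_band_band: "s \<le> t \<Longrightarrow> cinner (band s t x) (band s t y) = cinner x (band s t y)"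
  by (simp add: band_sym band_subset)

lemma norm_band: "s \<le> t \<Longrightarrow> (norm (band s t x))\<^sup>2 = (norm (E t x))\<^sup>2 - (norm (E s x))\<^sup>2"
  by (simp only: norm_square_eq cinner_band_band cinner_E_E)
    (simp add: band_def cinner_diff_right)

lemma norm_E_complement: "(norm (x - E t x))\<^sup>2 = (norm x)\<^sup>2 - (norm (E t x))\<^sup>2"
proof -
  have "cinner (E t x) x = cinner x (E t x)" by (rule E_sym)
  then have "cinner (x - E t x) (x - E t x) = cinner x x - cinner (E t x) (E t x)"
    unfolding cinner_E_E by (simp add: cinner_diff_left cinner_diff_right cinner_E_E)
  then show ?thesis by (simp add: norm_square_eq)
qed

lemma norm_E_le: "norm (E t x) \<le> norm x"
proof -
  have "(norm (E t x))\<^sup>2 \<le> (norm x)\<^sup>2"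
    using norm_E_complement[of x t] zero_le_power2[of "norm (x - E t x)"] by linarith
  then show ?thesis by (rule power2_le_imp_le) simp
qed

text \<open>The distribution function of the spectral measure of \<open>x\<close>.\<close>

definition distr :: "'a \<Rightarrow> real \<Rightarrow> real" where
  "distr x t = (norm (E t x))\<^sup>2"

lemma distr_eq: "distr x = (\<lambda>t. (norm (E t x))\<^sup>2)"
  by (simp add: fun_eq_iff distr_def)

lemma mono_distr: "mono (distr x)"
proof (rule monoI)
  fix s t :: real assume "s \<le> t"
  then show "distr x s \<le> distr x t"
    using norm_band[of s t x] zero_le_power2[of "norm (band s t x)"] unfolding distr_def by linarith
qed

lemma norm_band_le: "s \<le> t \<Longrightarrow> norm (band s t x) \<le> norm x"
proof -
  assume st: "s \<le> t"
  have "(norm (band s t x))\<^sup>2 \<le> (norm (E t x))\<^sup>2" using norm_band[OF st, of x] by simp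
  then have "norm (band s t x) \<le> norm (E t x)" by (rule power2_le_imp_le) simp
  then show ?thesis using norm_E_le[of t x] by linarith
qed

lemma bounded_linear_band: "s \<le> t \<Longrightarrow> bounded_linear (band s t)"
  by (rule bounded_linear_intro[of _ 1]) (auto simp: band_add band_scaleR norm_band_le)

abbreviation E_sum :: "(real \<Rightarrow> real) \<Rightarrow> 'a \<Rightarrow> tagging \<Rightarrow> 'a" where
  "E_sum g x \<equiv> RS_sum g (\<lambda>t. E t x)"

lemma E_sum_eq: "E_sum g x (n, t, \<xi>) = (\<Sum>k<n. g (\<xi> k) *\<^sub>R band (t k) (t (Suc k)) x)"
  by (simp add: RS_sum_def band_def)

lemma sum_cells:
  assumes "tagged a b \<delta> (n, t, \<xi>)"
  shows "(\<Sum>k<n. band (t k) (t (Suc k)) x) = band a b x"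
  using sum_lessThan_telescope[of "\<lambda>k. E (t k) x" n] tagged_ends[OF assms] by (simp add: band_def)

lemma cells_disjoint:
  assumes "tagged a b \<delta> (n, t, \<xi>)" "k < n" "j < n" "k \<noteq> j"
  shows "band (t k) (t (Suc k)) (band (t j) (t (Suc j)) x) = 0"
proof (cases "k < j")
  case True
  then have "t (Suc k) \<le> t j" using tagged_le[OF assms(1), of "Suc k" j] assms by simp
  then show ?thesis
    using tagged_cell(1)[OF assms(1,2)] tagged_cell(1)[OF assms(1,3)] by (intro band_disjoint(1)) auto
next
  case False
  then have "t (Suc j) \<le> t k" using tagged_le[OF assms(1), of "Suc j" k] assms by simp
  then show ?thesis
    using tagged_cell(1)[OF assms(1,2)] tagged_cell(1)[OF assms(1,3)] by (intro band_disjoint(2)) auto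
qed

lemma cell_band:
  assumes "tagged a b \<delta> (n, t, \<xi>)" "k < n"
  shows "band (t k) (t (Suc k)) (band a b x) = band (t k) (t (Suc k)) x"
  using tagged_range[OF assms(1), of k] tagged_range[OF assms(1), of "Suc k"] tagged_cell(1)[OF assms] assms(2)
  by (intro band_subset) auto

text \<open>Different cells have orthogonal ranges, so the inner product of two sums over the same tagged
  partition is a sum for the product of the integrands.\<close>

lemma cinner_E_sum:
  assumes p: "tagged a b \<delta> p"
  shows "cinner (E_sum g x p) (E_sum h x p) = of_real (RS_sum (\<lambda>s. g s * h s) (distr x) p)"
proof -
  obtain n t \<xi> where p': "p = (n, t, \<xi>)" by (cases p)
  note P = p[unfolded p']
  let ?c = "\<lambda>k. band (t k) (t (Suc k)) x"
  have c: "cinner (?c k) (?c j) = (if k = j then of_real (distr x (t (Suc k)) - distr x (t k)) else 0)"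
    if "k < n" "j < n" for k j
  proof (cases "k = j")
    case True
    have "cinner (?c k) (?c k) = of_real (distr x (t (Suc k)) - distr x (t k))"
      unfolding cinner_self distr_def norm_band[OF less_imp_le[OF tagged_cell(1)[OF P that(1)]]] ..
    then show ?thesis using True by simp
  next
    case False
    then show ?thesis using cells_disjoint[OF P that] by (simp add: band_sym[of "t k"] cinner_zero_right)
  qed
  have "cinner (E_sum g x p) (E_sum h x p)
      = (\<Sum>j<n. \<Sum>k<n. of_real (h (\<xi> j)) * (of_real (g (\<xi> k)) * cinner (?c k) (?c j)))"
    unfolding p' E_sum_eq cinner_sum_left cinner_sum_right cinner_scaleR_left cinner_scaleR_right
    by (simp add: sum_distrib_left)
  also have "\<dots> = (\<Sum>j<n. \<Sum>k<n. if j = k then of_real (g (\<xi> k) * h (\<xi> j) * (distr x (t (Suc k)) - distr x (t k))) else 0)"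
    by (intro sum.cong refl) (simp add: c)
  also have "\<dots> = of_real (RS_sum (\<lambda>s. g s * h s) (distr x) p)"
    by (simp add: p' RS_sum_def)
  finally show ?thesis .
qed

lemma norm_E_sum:
  assumes "tagged a b \<delta> p"
  shows "(norm (E_sum g x p))\<^sup>2 = RS_sum (\<lambda>s. (g s)\<^sup>2) (distr x) p"
  using cinner_E_sum[OF assms, of g x g] unfolding cinner_self of_real_eq_iff power2_eq_square .

lemma norm_cell_refine:
  assumes p: "tagged a b \<delta> (n, t, \<xi>)" and q: "tagged a b \<delta> (m, s, \<eta>)" and k: "k < n"
  shows "distr x (t (Suc k)) - distr x (t k)
    = (\<Sum>j<m. (norm (band (t k) (t (Suc k)) (band (s j) (s (Suc j)) x)))\<^sup>2)"
proof -
  let ?y = "band (t k) (t (Suc k)) x"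
  have "?y = band a b ?y" using cell_band[OF p k, of x] by (simp add: band_commute)
  also have "\<dots> = (\<Sum>j<m. band (s j) (s (Suc j)) ?y)" by (simp add: sum_cells[OF q])
  finally have "(norm ?y)\<^sup>2 = (norm (\<Sum>j<m. band (s j) (s (Suc j)) ?y))\<^sup>2" by simp
  also have "\<dots> = (\<Sum>j<m. (norm (band (s j) (s (Suc j)) ?y))\<^sup>2)"
    by (intro norm_sum_orthogonal) (auto simp: band_sym cells_disjoint[OF q] cinner_zero_right)
  finally show ?thesis
    using norm_band[of "t k" "t (Suc k)" x] tagged_cell(1)[OF p k] by (simp add: distr_def band_commute)
qed

text \<open>Two tagged partitions are compared on the products of their cells. This replaces a common
  refinement: the product of two cells that do not meet is the zero projection.\<close>

lemma norm_E_sum_diff: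
  assumes p: "tagged a b \<delta> (n, t, \<xi>)" and q: "tagged a b \<delta> (m, s, \<eta>)"
  shows "(norm (E_sum g x (n, t, \<xi>) - E_sum g x (m, s, \<eta>)))\<^sup>2
    = (\<Sum>k<n. \<Sum>j<m. (g (\<xi> k) - g (\<eta> j))\<^sup>2 * (norm (band (t k) (t (Suc k)) (band (s j) (s (Suc j)) x)))\<^sup>2)"
proof -
  let ?c = "\<lambda>k j. band (t k) (t (Suc k)) (band (s j) (s (Suc j)) x)"
  have cp: "band (t k) (t (Suc k)) x = (\<Sum>j<m. ?c k j)" if "k < n" for k
    using cell_band[OF p that, of x] sum_cells[OF q, of x] by (simp flip: band_sum)
  have cq: "band (s j) (s (Suc j)) x = (\<Sum>k<n. ?c k j)" if "j < m" for j
    using cell_band[OF q that, of x] by (simp add: sum_cells[OF p] band_commute[of a b])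
  have "E_sum g x (n, t, \<xi>) = (\<Sum>k<n. \<Sum>j<m. g (\<xi> k) *\<^sub>R ?c k j)"
    unfolding E_sum_eq by (intro sum.cong refl) (simp add: cp scaleR_right.sum)
  moreover have "E_sum g x (m, s, \<eta>) = (\<Sum>j<m. \<Sum>k<n. g (\<eta> j) *\<^sub>R ?c k j)"
    unfolding E_sum_eq by (intro sum.cong refl) (simp add: cq scaleR_right.sum)
  then have "E_sum g x (m, s, \<eta>) = (\<Sum>k<n. \<Sum>j<m. g (\<eta> j) *\<^sub>R ?c k j)"
    using sum.swap[of "\<lambda>j k. g (\<eta> j) *\<^sub>R ?c k j" "{..<n}" "{..<m}"] by simp
  ultimately have "E_sum g x (n, t, \<xi>) - E_sum g x (m, s, \<eta>)
      = (\<Sum>k<n. \<Sum>j<m. (g (\<xi> k) - g (\<eta> j)) *\<^sub>R ?c k j)"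
    by (simp add: sum_subtractf scaleR_left_diff_distrib)
  also have "\<dots> = (\<Sum>i\<in>{..<n} \<times> {..<m}. (g (\<xi> (fst i)) - g (\<eta> (snd i))) *\<^sub>R ?c (fst i) (snd i))"
    by (simp add: sum.cartesian_product case_prod_beta)
  finally have e: "E_sum g x (n, t, \<xi>) - E_sum g x (m, s, \<eta>)
      = (\<Sum>i\<in>{..<n} \<times> {..<m}. (g (\<xi> (fst i)) - g (\<eta> (snd i))) *\<^sub>R ?c (fst i) (snd i))" .
  have orth: "cinner (?c k j) (?c k' j') = 0" if "k < n" "k' < n" "j < m" "j' < m" "k \<noteq> k' \<or> j \<noteq> j'" for k k' j j'
  proof (cases "k = k'")
    case False
    then show ?thesis using cells_disjoint[OF p that(1,2)] by (simp add: band_sym[of "t k"] cinner_zero_right)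
  next
    case True
    then have "j \<noteq> j'" using that by simp
    then show ?thesis using cells_disjoint[OF q that(3,4)]
      by (simp add: band_commute[of "t _"] band_sym[of "s j"] cinner_zero_right)
  qed
  have "(norm (E_sum g x (n, t, \<xi>) - E_sum g x (m, s, \<eta>)))\<^sup>2
      = (\<Sum>i\<in>{..<n} \<times> {..<m}. (norm ((g (\<xi> (fst i)) - g (\<eta> (snd i))) *\<^sub>R ?c (fst i) (snd i)))\<^sup>2)"
    unfolding e
  proof (intro norm_sum_orthogonal)
    fix i i' assume "i \<in> {..<n} \<times> {..<m}" "i' \<in> {..<n} \<times> {..<m}" "i \<noteq> i'"
    then show "cinner ((g (\<xi> (fst i)) - g (\<eta> (snd i))) *\<^sub>R ?c (fst i) (snd i))
        ((g (\<xi> (fst i')) - g (\<eta> (snd i'))) *\<^sub>R ?c (fst i') (snd i')) = 0"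
      using orth[of "fst i" "fst i'" "snd i" "snd i'"]
      by (simp add: cinner_scaleR_left cinner_scaleR_right prod_eq_iff mem_Times_iff)
  qed simp
  also have "\<dots> = (\<Sum>k<n. \<Sum>j<m. (g (\<xi> k) - g (\<eta> j))\<^sup>2 * (norm (?c k j))\<^sup>2)"
    by (simp add: sum.cartesian_product case_prod_beta power_mult_distrib)
  finally show ?thesis .
qed


text \<open>If \<open>(g y - g z)\<^sup>2\<close> is controlled by the oscillation of \<open>f\<close>, then the sums for \<open>g\<close> are a Cauchy net.
  For two cells that meet, the tags are compared through a common point; among the finitely many
  common points in a given cell the one with the largest deviation from the tag serves for all.\<close>

lemma vector_integral_exists:
  assumes ab: "a < b" and f: "small_oscillation f (distr x) a b" and C: "0 \<le> C"
    and g: "\<And>y z. y \<in> {a..b} \<Longrightarrow> z \<in> {a..b} \<Longrightarrow> (g y - g z)\<^sup>2 \<le> C * \<bar>f y - f z\<bar>"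
  shows "\<exists>I. has_RS_integral g (\<lambda>t. E t x) a b I"
proof (rule Cauchy_imp_has_RS_integral[OF ab])
  fix \<epsilon> :: real assume \<epsilon>: "\<epsilon> > 0"
  \<comment> \<open>Each of the two partitions contributes at most \<open>2 * C * e\<close>; the \<open>1\<close> makes the bound strict.\<close>
  define e where "e = \<epsilon>\<^sup>2 / (4 * C + 1)"
  have e: "e > 0" using \<epsilon> C by (simp add: e_def)
  obtain \<delta> where \<delta>: "\<delta> > 0"
    "\<And>n t \<xi> \<eta>. tagged a b \<delta> (n, t, \<xi>) \<Longrightarrow> tagged a b \<delta> (n, t, \<eta>) \<Longrightarrow>
       (\<Sum>k<n. \<bar>f (\<xi> k) - f (\<eta> k)\<bar> * (distr x (t (Suc k)) - distr x (t k))) < e"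
    using small_oscillationE[OF f e] by blast
  have half: "\<exists>\<alpha>. tagged a b \<delta> (n, t, \<alpha>) \<and>
      (\<forall>k<n. \<forall>j\<le>m. s j \<in> {t k..t (Suc k)} \<longrightarrow> \<bar>f (\<xi> k) - f (s j)\<bar> \<le> \<bar>f (\<xi> k) - f (\<alpha> k)\<bar>) \<and>
      (\<forall>k<n. \<bar>f (\<xi> k) - f (t k)\<bar> \<le> \<bar>f (\<xi> k) - f (\<alpha> k)\<bar>)"
    if p: "tagged a b \<delta> (n, t, \<xi>)" for n m :: nat and t s \<xi> :: "nat \<Rightarrow> real"
  proof -
    define S where "S k = insert (t k) (s ` {..m} \<inter> {t k..t (Suc k)})" for k
    have "\<exists>\<alpha>\<in>S k. \<forall>p\<in>S k. \<bar>f (\<xi> k) - f p\<bar> \<le> \<bar>f (\<xi> k) - f \<alpha>\<bar>" for k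
      by (rule finite_arg_max) (auto simp: S_def)
    then obtain \<alpha> where \<alpha>: "\<And>k. \<alpha> k \<in> S k" "\<And>k p. p \<in> S k \<Longrightarrow> \<bar>f (\<xi> k) - f p\<bar> \<le> \<bar>f (\<xi> k) - f (\<alpha> k)\<bar>"
      by metis
    have "S k \<subseteq> {t k..t (Suc k)}" if "k < n" for k
      using tagged_cell(1)[OF p that] by (auto simp: S_def)
    then have "tagged a b \<delta> (n, t, \<alpha>)"
      using tagged_retag[OF p, of \<alpha>] \<alpha>(1) by blast
    moreover have "s j \<in> S k" if "j \<le> m" "s j \<in> {t k..t (Suc k)}" for j k
      using that by (simp add: S_def)
    moreover have "t k \<in> S k" for k by (simp add: S_def)
    ultimately show ?thesis using \<alpha>(2) by blast
  qed
  have "norm (E_sum g x p - E_sum g x q) < \<epsilon>" if pq: "tagged a b \<delta> p" "tagged a b \<delta> q" for p q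
  proof -
    obtain n t \<xi> m s \<eta> where p': "p = (n, t, \<xi>)" "q = (m, s, \<eta>)" by (cases p, cases q)
    note P = pq(1)[unfolded p'] and Q = pq(2)[unfolded p']
    obtain \<alpha> where \<alpha>: "tagged a b \<delta> (n, t, \<alpha>)"
        "\<And>k j. k < n \<Longrightarrow> j \<le> m \<Longrightarrow> s j \<in> {t k..t (Suc k)} \<Longrightarrow> \<bar>f (\<xi> k) - f (s j)\<bar> \<le> \<bar>f (\<xi> k) - f (\<alpha> k)\<bar>"
        "\<And>k. k < n \<Longrightarrow> \<bar>f (\<xi> k) - f (t k)\<bar> \<le> \<bar>f (\<xi> k) - f (\<alpha> k)\<bar>"
      using half[OF P, of m s] by blast
    obtain \<beta> where \<beta>: "tagged a b \<delta> (m, s, \<beta>)"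
        "\<And>j k. j < m \<Longrightarrow> k \<le> n \<Longrightarrow> t k \<in> {s j..s (Suc j)} \<Longrightarrow> \<bar>f (\<eta> j) - f (t k)\<bar> \<le> \<bar>f (\<eta> j) - f (\<beta> j)\<bar>"
        "\<And>j. j < m \<Longrightarrow> \<bar>f (\<eta> j) - f (s j)\<bar> \<le> \<bar>f (\<eta> j) - f (\<beta> j)\<bar>"
      using half[OF Q, of n t] by blast
    define M where "M k j = (norm (band (t k) (t (Suc k)) (band (s j) (s (Suc j)) x)))\<^sup>2" for k j
    define F where "F k = 2 * C * \<bar>f (\<xi> k) - f (\<alpha> k)\<bar>" for k
    define G where "G j = 2 * C * \<bar>f (\<eta> j) - f (\<beta> j)\<bar>" for j
    have M: "(g (\<xi> k) - g (\<eta> j))\<^sup>2 * M k j \<le> F k * M k j + G j * M k j" if k: "k < n" and j: "j < m" for k j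
    proof (cases "t (Suc k) \<le> s j \<or> s (Suc j) \<le> t k")
      case True
      then have "M k j = 0"
        using band_disjoint[of "t k" "t (Suc k)" "s j" "s (Suc j)" x] band_disjoint[of "s j" "s (Suc j)" "t k" "t (Suc k)" x]
          tagged_cell(1)[OF P k] tagged_cell(1)[OF Q j] by (auto simp: M_def)
      then show ?thesis by simp
    next
      case False
      \<comment> \<open>The larger left end lies in both cells.\<close>
      define r where "r = max (t k) (s j)"
      have r: "r \<in> {t k..t (Suc k)}" "r \<in> {s j..s (Suc j)}"
        using False tagged_cell(1)[OF P k] tagged_cell(1)[OF Q j] by (auto simp: r_def)
      have "\<bar>f (\<xi> k) - f r\<bar> \<le> \<bar>f (\<xi> k) - f (\<alpha> k)\<bar>"
        using \<alpha>(2)[OF k, of j] \<alpha>(3)[OF k] j r(1) by (cases "t k \<le> s j") (simp_all add: r_def max_def)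
      moreover have "\<bar>f (\<eta> j) - f r\<bar> \<le> \<bar>f (\<eta> j) - f (\<beta> j)\<bar>"
        using \<beta>(2)[OF j, of k] \<beta>(3)[OF j] k r(2) by (cases "t k \<le> s j") (simp_all add: r_def max_def)
      ultimately have fg: "C * \<bar>f (\<xi> k) - f r\<bar> \<le> C * \<bar>f (\<xi> k) - f (\<alpha> k)\<bar>" "C * \<bar>f (\<eta> j) - f r\<bar> \<le> C * \<bar>f (\<eta> j) - f (\<beta> j)\<bar>"
        using C by (simp_all add: mult_left_mono)
      have rab: "r \<in> {a..b}" "\<xi> k \<in> {a..b}" "\<eta> j \<in> {a..b}"
        using r(1) tagged_range[OF P, of k] tagged_range[OF P, of "Suc k"] k
          tagged_tag_range[OF P k] tagged_tag_range[OF Q j] by auto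
      have "(g (\<xi> k) - g (\<eta> j))\<^sup>2 = ((g (\<xi> k) - g r) - (g (\<eta> j) - g r))\<^sup>2" by simp
      also have "\<dots> \<le> 2 * (g (\<xi> k) - g r)\<^sup>2 + 2 * (g (\<eta> j) - g r)\<^sup>2"
        using zero_le_power2[of "(g (\<xi> k) - g r) + (g (\<eta> j) - g r)"] by (simp add: power2_eq_square algebra_simps)
      also have "\<dots> \<le> F k + G j"
        using g[OF rab(2) rab(1)] g[OF rab(3) rab(1)] fg by (simp add: F_def G_def)
      finally show ?thesis
        unfolding distrib_right[symmetric] by (intro mult_right_mono) (simp_all add: M_def)
    qed
    have Fsum: "(\<Sum>k<n. \<Sum>j<m. F k * M k j) = 2 * C * (\<Sum>k<n. \<bar>f (\<xi> k) - f (\<alpha> k)\<bar> * (distr x (t (Suc k)) - distr x (t k)))"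
      unfolding sum_distrib_left[of "2 * C"]
    proof (intro sum.cong refl)
      fix k assume "k \<in> {..<n}"
      then have "distr x (t (Suc k)) - distr x (t k) = (\<Sum>j<m. M k j)"
        using norm_cell_refine[OF P Q, of k x] by (simp add: M_def)
      then show "(\<Sum>j<m. F k * M k j) = 2 * C * (\<bar>f (\<xi> k) - f (\<alpha> k)\<bar> * (distr x (t (Suc k)) - distr x (t k)))"
        by (simp add: F_def sum_distrib_left[symmetric] mult.assoc)
    qed
    have Gsum: "(\<Sum>j<m. \<Sum>k<n. G j * M k j) = 2 * C * (\<Sum>j<m. \<bar>f (\<eta> j) - f (\<beta> j)\<bar> * (distr x (s (Suc j)) - distr x (s j)))"
      unfolding sum_distrib_left[of "2 * C"]
    proof (intro sum.cong refl)
      fix j assume "j \<in> {..<m}"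
      then have "distr x (s (Suc j)) - distr x (s j) = (\<Sum>k<n. M k j)"
        using norm_cell_refine[OF Q P, of j x] by (simp add: M_def band_commute[of "s j"])
      then show "(\<Sum>k<n. G j * M k j) = 2 * C * (\<bar>f (\<eta> j) - f (\<beta> j)\<bar> * (distr x (s (Suc j)) - distr x (s j)))"
        by (simp add: G_def sum_distrib_left[symmetric] mult.assoc)
    qed
    have "(norm (E_sum g x p - E_sum g x q))\<^sup>2 = (\<Sum>k<n. \<Sum>j<m. (g (\<xi> k) - g (\<eta> j))\<^sup>2 * M k j)"
      unfolding p' norm_E_sum_diff[OF P Q] M_def ..
    also have "\<dots> \<le> (\<Sum>k<n. \<Sum>j<m. F k * M k j + G j * M k j)"
      by (intro sum_mono M) auto
    also have "\<dots> = (\<Sum>k<n. \<Sum>j<m. F k * M k j) + (\<Sum>j<m. \<Sum>k<n. G j * M k j)"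
      unfolding sum.distrib by (subst sum.swap[of "\<lambda>k j. G j * M k j"]) simp
    also have "\<dots> \<le> 2 * C * e + 2 * C * e"
      unfolding Fsum Gsum
      using \<delta>(2)[OF P \<alpha>(1)] \<delta>(2)[OF Q \<beta>(1)] C by (intro add_mono mult_left_mono) auto
    also have "\<dots> < (4 * C + 1) * e" using e by (simp add: algebra_simps)
    also have "\<dots> = \<epsilon>\<^sup>2" using C by (simp add: e_def)
    finally show ?thesis using \<epsilon> by (simp add: power_less_imp_less_base)
  qed
  then show "\<exists>P. eventually P (refining a b) \<and>
      (\<forall>p q. P p \<longrightarrow> P q \<longrightarrow> norm (E_sum g x p - E_sum g x q) < \<epsilon>)"
    using eventually_tagged[OF \<delta>(1)] by blast
qed

lemma vector_integral_continuous:
  assumes ab: "a < b" and g: "continuous_on {a..b} g"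
  shows "\<exists>I. has_RS_integral g (\<lambda>t. E t x) a b I"
proof -
  have "compact (g ` {a..b})" using g by (intro compact_continuous_image) auto
  then obtain B where B: "\<And>y. y \<in> {a..b} \<Longrightarrow> \<bar>g y\<bar> \<le> B"
    using compact_imp_bounded bounded_real by (metis imageI)
  have "\<bar>g a\<bar> \<le> B" using B[of a] ab by simp
  then have B0: "0 \<le> B" by linarith
  have "(g y - g z)\<^sup>2 \<le> 2 * B * \<bar>g y - g z\<bar>" if "y \<in> {a..b}" "z \<in> {a..b}" for y z
  proof -
    have "\<bar>g y - g z\<bar> \<le> 2 * B" using B[OF that(1)] B[OF that(2)] by linarith
    then have "\<bar>g y - g z\<bar> * \<bar>g y - g z\<bar> \<le> 2 * B * \<bar>g y - g z\<bar>" by (intro mult_right_mono) auto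
    then show ?thesis by (simp add: power2_eq_square abs_mult_self_eq)
  qed
  then show ?thesis
    using vector_integral_exists[OF ab small_oscillation_continuous[OF g mono_distr], of "2 * B" g x] B0 by simp
qed

text \<open>Both sums may use the same tagged partition, because both integrals exist as limits over all of
  them.\<close>

lemma scalar_integral_of_products:
  assumes "has_RS_integral g (\<lambda>t. E t x) a b I" "has_RS_integral h (\<lambda>t. E t x) a b J"
  shows "has_RS_integral (\<lambda>s. g s * h s) (distr x) a b (Re (cinner I J))"
  unfolding has_RS_integral_iff
proof (rule Lim_transform_eventually)
  show "((\<lambda>p. Re (cinner (E_sum g x p) (E_sum h x p))) \<longlongrightarrow> Re (cinner I J)) (refining a b)"
    using assms unfolding has_RS_integral_iff by (intro tendsto_Re tendsto_cinner)
  show "\<forall>\<^sub>F p in refining a b. Re (cinner (E_sum g x p) (E_sum h x p)) = RS_sum (\<lambda>s. g s * h s) (distr x) p"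
    using eventually_tagged_one[of a b] by eventually_elim (auto simp: cinner_E_sum)
qed

lemma cinner_integrals_real:
  assumes "has_RS_integral g (\<lambda>t. E t x) a b I" "has_RS_integral h (\<lambda>t. E t x) a b J" "a < b"
  shows "Im (cinner I J) = 0"
proof (rule tendsto_unique)
  show "refining a b \<noteq> bot" using refining_neq_bot[OF assms(3)] .
  show "((\<lambda>p. Im (cinner (E_sum g x p) (E_sum h x p))) \<longlongrightarrow> Im (cinner I J)) (refining a b)"
    using assms(1,2) unfolding has_RS_integral_iff by (intro tendsto_Im tendsto_cinner)
  have "\<forall>\<^sub>F p in refining a b. 0 = Im (cinner (E_sum g x p) (E_sum h x p))"
    using eventually_tagged_one[of a b] by eventually_elim (auto simp: cinner_E_sum)
  then show "((\<lambda>p. Im (cinner (E_sum g x p) (E_sum h x p))) \<longlongrightarrow> 0) (refining a b)"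
    by (rule Lim_transform_eventually[OF tendsto_const])
qed

lemma integral_commute_band:
  assumes "has_RS_integral g (\<lambda>t. E t x) a b I" "s \<le> t"
  shows "has_RS_integral g (\<lambda>r. E r (band s t x)) a b (band s t I)"
proof -
  have "((\<lambda>p. band s t (E_sum g x p)) \<longlongrightarrow> band s t I) (refining a b)"
    using assms unfolding has_RS_integral_iff by (intro bounded_linear.tendsto[OF bounded_linear_band])
  moreover have "band s t (E_sum g x p) = E_sum g (band s t x) p" for p
    by (cases p) (simp add: E_sum_eq band_sum band_scaleR band_commute[of s t])
  ultimately show ?thesis by (simp add: has_RS_integral_iff)
qed

text \<open>A vector in the range of \<open>band p q\<close> has bounded spectral support: nothing is integrated outside
  \<open>[p, q]\<close>, hence it lies in the domain, and there \<open>A\<close> acts as an integral over \<open>[p, q]\<close>.\<close>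

lemma integral_outside_support:
  assumes I: "has_RS_integral g (\<lambda>t. E t x) a b I" and x: "band p q x = x" and pq: "p \<le> q"
    and ab: "a < b" "b \<le> p \<or> q \<le> a"
  shows "I = 0"
proof (rule tendsto_unique)
  show "refining a b \<noteq> bot" using refining_neq_bot[OF ab(1)] .
  show "(E_sum g x \<longlongrightarrow> I) (refining a b)" using I by (simp add: has_RS_integral_iff)
  have "E_sum g x P = 0" if P: "tagged a b 1 P" for P
  proof -
    obtain n t \<xi> where P': "P = (n, t, \<xi>)" by (cases P)
    note T = P[unfolded P']
    have "band (t k) (t (Suc k)) (band p q x) = 0" if "k < n" for k
      using ab(2) tagged_range[OF T, of k] tagged_range[OF T, of "Suc k"] tagged_cell(1)[OF T that] that pq
        band_disjoint[of "t k" "t (Suc k)" p q x] band_disjoint[of p q "t k" "t (Suc k)" x] by auto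
    then show ?thesis unfolding P' E_sum_eq x by simp
  qed
  then have "\<forall>\<^sub>F P in refining a b. 0 = E_sum g x P"
    using eventually_mono[OF eventually_tagged_one[of a b]] by simp
  then show "(E_sum g x \<longlongrightarrow> 0) (refining a b)"
    by (rule Lim_transform_eventually[OF tendsto_const])
qed

lemma integral_beyond_support:
  assumes J: "\<And>a b. a < b \<Longrightarrow> has_RS_integral g (\<lambda>t. E t x) a b (J a b)"
    and x: "band p q x = x" and pq: "p < q" and ab: "a < p" "q < b"
  shows "J a b = J p q"
proof -
  have "J a b = J a p + J p b"
    using ab pq by (intro has_RS_integral_combine[OF J J J]) auto
  moreover have "J p b = J p q + J q b"
    using ab pq by (intro has_RS_integral_combine[OF J J J]) auto
  moreover have "J a p = 0" using ab pq by (intro integral_outside_support[OF J x]) auto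
  moreover have "J q b = 0" using ab pq by (intro integral_outside_support[OF J x]) auto
  ultimately show ?thesis by simp
qed

lemma band_in_domain:
  assumes x: "band p q x = x" and pq: "p < q"
  shows "x \<in> D"
proof -
  have "\<forall>a b. \<exists>I. a < b \<longrightarrow> has_RS_integral (\<lambda>t. t) (\<lambda>t. E t x) a b I"
    using vector_integral_continuous[of _ _ "\<lambda>t. t" x] continuous_on_id by blast
  then obtain I where I: "\<And>a b. a < b \<Longrightarrow> has_RS_integral (\<lambda>t. t) (\<lambda>t. E t x) a b (I a b)"
    by metis
  have "has_RS_integral (\<lambda>t. t\<^sup>2) (\<lambda>t. (norm (E t x))\<^sup>2) a b (Re (cinner (I a b) (I a b)))" if "a < b" for a b
    using scalar_integral_of_products[OF I[OF that] I[OF that]]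
    unfolding distr_eq power2_eq_square .
  moreover have "((\<lambda>(a, b). Re (cinner (I a b) (I a b))) \<longlongrightarrow> Re (cinner (I p q) (I p q))) (at_bot \<times>\<^sub>F at_top)"
  proof (rule Lim_transform_eventually[OF tendsto_const])
    show "\<forall>\<^sub>F z in at_bot \<times>\<^sub>F at_top. Re (cinner (I p q) (I p q)) = (case z of (a, b) \<Rightarrow> Re (cinner (I a b) (I a b)))"
      using eventually_improper[of p q]
    proof eventually_elim
      case (elim z)
      then show ?case using integral_beyond_support[OF I x pq, of "fst z" "snd z"] by (simp add: case_prod_beta)
    qed
  qed
  ultimately have "has_RS_integral_line (\<lambda>t. t\<^sup>2) (\<lambda>t. (norm (E t x))\<^sup>2) (Re (cinner (I p q) (I p q)))"
    unfolding has_RS_integral_line_def by (intro exI[of _ "\<lambda>a b. Re (cinner (I a b) (I a b))"]) simp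
  then show ?thesis by (subst D_eq) blast
qed

lemma A_band_integral:
  assumes x: "band p q x = x" and pq: "p < q"
  shows "has_RS_integral (\<lambda>t. t) (\<lambda>t. E t x) p q (A x)"
proof -
  obtain I where I: "\<And>a b. a < b \<Longrightarrow> has_RS_integral (\<lambda>t. t) (\<lambda>t. E t x) a b (I a b)"
      and lim: "((\<lambda>(a, b). I a b) \<longlongrightarrow> A x) (at_bot \<times>\<^sub>F at_top)"
    using A_integral[OF band_in_domain[OF x pq]] unfolding has_RS_integral_line_def by blast
  have "((\<lambda>(a, b). I a b) \<longlongrightarrow> I p q) (at_bot \<times>\<^sub>F at_top)"
  proof (rule Lim_transform_eventually[OF tendsto_const])
    show "\<forall>\<^sub>F z in at_bot \<times>\<^sub>F at_top. I p q = (case z of (a, b) \<Rightarrow> I a b)"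
      using eventually_improper[of p q]
    proof eventually_elim
      case (elim z)
      then show ?case using integral_beyond_support[OF I x pq, of "fst z" "snd z"] by (simp add: case_prod_beta)
    qed
  qed
  then have "I p q = A x" using lim improper_filter_neq_bot tendsto_unique by blast
  then show ?thesis using I[OF pq] by simp
qed

lemma band_A:
  assumes x: "band p q x = x" and pq: "p < q"
  shows "band p q (A x) = A x"
  using integral_commute_band[OF A_band_integral[OF x pq], of p q] A_band_integral[OF x pq] pq
    has_RS_integral_unique[of "\<lambda>t. t" "\<lambda>t. E t x" p q] by (simp add: x)

text \<open>All tags in a partition of \<open>[p, q]\<close> are within \<open>r\<close> of \<open>c\<close>, and the cells are orthogonal.\<close>

lemma norm_A_minus_centre_le:
  assumes x: "band p q x = x" and pq: "p < q" and c: "c - r \<le> p" "q \<le> c + r"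
  shows "norm (A x - c *\<^sub>R x) \<le> r * norm x"
proof (rule tendsto_upperbound)
  show "refining p q \<noteq> bot" using refining_neq_bot[OF pq] .
  show "((\<lambda>P. norm (E_sum (\<lambda>t. t) x P - c *\<^sub>R x)) \<longlongrightarrow> norm (A x - c *\<^sub>R x)) (refining p q)"
    using A_band_integral[OF x pq] unfolding has_RS_integral_iff by (intro tendsto_intros)
  have "norm (E_sum (\<lambda>t. t) x P - c *\<^sub>R x) \<le> r * norm x" if P: "tagged p q 1 P" for P
  proof -
    obtain n t \<xi> where P': "P = (n, t, \<xi>)" by (cases P)
    note T = P[unfolded P']
    have r: "0 \<le> r" using c pq by linarith
    have "c *\<^sub>R x = (\<Sum>k<n. c *\<^sub>R band (t k) (t (Suc k)) x)"
      using sum_cells[OF T, of x] x by (simp flip: scaleR_right.sum)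
    then have "E_sum (\<lambda>t. t) x P - c *\<^sub>R x = E_sum (\<lambda>t. t - c) x P"
      unfolding P' E_sum_eq by (simp add: scaleR_left_diff_distrib sum_subtractf)
    then have "(norm (E_sum (\<lambda>t. t) x P - c *\<^sub>R x))\<^sup>2 = RS_sum (\<lambda>t. (t - c)\<^sup>2) (distr x) P"
      using norm_E_sum[OF P, of "\<lambda>t. t - c" x] by simp
    also have "\<dots> \<le> (\<Sum>k<n. r\<^sup>2 * (distr x (t (Suc k)) - distr x (t k)))"
      unfolding P' RS_sum_def prod.case real_scaleR_def
    proof (intro sum_mono mult_right_mono)
      fix k assume "k \<in> {..<n}"
      then have k: "k < n" by simp
      have "\<bar>\<xi> k - c\<bar> \<le> r" using tagged_tag_range[OF T k] c by linarith
      then show "(\<xi> k - c)\<^sup>2 \<le> r\<^sup>2" using r by (simp add: abs_le_square_iff[symmetric])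
      show "0 \<le> distr x (t (Suc k)) - distr x (t k)"
        using monoD[OF mono_distr less_imp_le[OF tagged_cell(1)[OF T k]]] by simp
    qed
    also have "\<dots> = r\<^sup>2 * (distr x q - distr x p)"
      using sum_lessThan_telescope[of "\<lambda>k. distr x (t k)" n] tagged_ends[OF T]
      by (simp add: sum_distrib_left[symmetric])
    also have "distr x q - distr x p = (norm x)\<^sup>2"
      using norm_band[of p q x] pq x by (simp add: distr_def)
    finally have "(norm (E_sum (\<lambda>t. t) x P - c *\<^sub>R x))\<^sup>2 \<le> (r * norm x)\<^sup>2"
      by (simp add: power_mult_distrib)
    then show ?thesis by (rule power2_le_imp_le) (simp add: r)
  qed
  then show "\<forall>\<^sub>F P in refining p q. norm (E_sum (\<lambda>t. t) x P - c *\<^sub>R x) \<le> r * norm x"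
    using eventually_mono[OF eventually_tagged_one[of p q]] by simp
qed

lemma band_exhausts: "((\<lambda>R. band (- R) R x) \<longlongrightarrow> x) at_top"
proof -
  have "((\<lambda>R. E (- R) x) \<longlongrightarrow> 0) at_top"
    using filterlim_compose[OF E_at_bot filterlim_uminus_at_bot_at_top] .
  then have "((\<lambda>R. E R x - E (- R) x) \<longlongrightarrow> x - 0) at_top"
    by (intro tendsto_diff E_at_top)
  then show ?thesis by (simp add: band_def)
qed

end

section \<open>Convergence of the spectral weights of finite approximations\<close>

text \<open>The vectors \<open>w n j\<close> and numbers \<open>d n j\<close>, for \<open>j \<le> n\<close>, are the eigenvectors and eigenvalues of the
  \<open>n\<close>-th approximation. The approximation itself does not occur: all that matters is that, on a core
  \<open>C\<close> and for large \<open>n\<close>, it has the coefficients of \<open>A\<close> with respect to its own eigenvectors.\<close>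

locale spectral_approximation = spectral D A E
  for D :: "'a::complex_hilbert_space set" and A :: "'a \<Rightarrow> 'a" and E :: "real \<Rightarrow> 'a \<Rightarrow> 'a" +
  fixes C :: "'a set" and w :: "nat \<Rightarrow> nat \<Rightarrow> 'a" and d :: "nat \<Rightarrow> nat \<Rightarrow> real"
  assumes orthonormal: "corthonormal {..n} (w n)"
    and core: "x \<in> D \<Longrightarrow> \<epsilon> > 0 \<Longrightarrow> \<exists>y\<in>C. norm (x - y) < \<epsilon> \<and> norm (A x - A y) < \<epsilon>"
    and complete: "x \<in> C \<Longrightarrow>
      \<forall>\<^sub>F n in sequentially. (\<Sum>j\<le>n. (cmod (cinner (w n j) x))\<^sup>2) = (norm x)\<^sup>2"
    and eigen: "x \<in> C \<Longrightarrow>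
      \<forall>\<^sub>F n in sequentially. \<forall>j\<le>n. cinner (w n j) (A x) = of_real (d n j) * cinner (w n j) x"
begin

definition eig_index :: "nat \<Rightarrow> real set \<Rightarrow> nat set" where
  "eig_index n S = {j. j \<le> n \<and> d n j \<in> S}"

text \<open>The norm of the component of \<open>x\<close> in the eigenspaces of the \<open>n\<close>-th approximation with
  eigenvalues in \<open>S\<close>.\<close>

definition part :: "real set \<Rightarrow> nat \<Rightarrow> 'a \<Rightarrow> real" where
  "part S n x = L2_set (\<lambda>j. cmod (cinner (w n j) x)) (eig_index n S)"

text \<open>For \<open>S = UNIV\<close> this is the quadratic form of \<open>f\<close> of the \<open>n\<close>-th approximation; for \<open>f = 1\<close> and
  \<open>S = {..s}\<close> it is its distribution function.\<close>

definition weighted :: "(real \<Rightarrow> real) \<Rightarrow> real set \<Rightarrow> nat \<Rightarrow> 'a \<Rightarrow> real" where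
  "weighted f S n x = (\<Sum>j\<in>eig_index n S. f (d n j) * (cmod (cinner (w n j) x))\<^sup>2)"

lemma finite_eig_index: "finite (eig_index n S)"
  unfolding eig_index_def by simp

lemma part_nonneg: "0 \<le> part S n x"
  by (simp add: part_def)

lemma part_square: "(part S n x)\<^sup>2 = weighted (\<lambda>_. 1) S n x"
  by (simp add: part_def weighted_def L2_set_def sum_nonneg)

lemma weighted_union:
  assumes "S \<inter> T = {}"
  shows "weighted f (S \<union> T) n x = weighted f S n x + weighted f T n x"
proof -
  have "eig_index n (S \<union> T) = eig_index n S \<union> eig_index n T" "eig_index n S \<inter> eig_index n T = {}"
    using assms by (auto simp: eig_index_def)
  then show ?thesis by (simp add: weighted_def sum.union_disjoint finite_eig_index)
qed

lemma part_le: "part S n x \<le> norm x"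
proof -
  have "(part S n x)\<^sup>2 \<le> (\<Sum>j\<le>n. (cmod (cinner (w n j) x))\<^sup>2)"
    unfolding part_square weighted_def mult_1 by (rule sum_mono2) (auto simp: eig_index_def)
  also have "\<dots> \<le> (norm x)\<^sup>2" by (rule Bessel_inequality) (auto simp: orthonormal)
  finally show ?thesis by (rule power2_le_imp_le) simp
qed

lemma part_mono: "S \<subseteq> T \<Longrightarrow> part S n x \<le> part T n x"
proof -
  assume "S \<subseteq> T"
  then have "(part S n x)\<^sup>2 \<le> (part T n x)\<^sup>2"
    unfolding part_square weighted_def mult_1 by (intro sum_mono2 finite_eig_index) (auto simp: eig_index_def)
  then show ?thesis by (rule power2_le_imp_le) (rule part_nonneg)
qed

lemma part_triangle: "part S n (x + y) \<le> part S n x + part S n y"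
proof -
  have "part S n (x + y) \<le> L2_set (\<lambda>j. cmod (cinner (w n j) x) + cmod (cinner (w n j) y)) (eig_index n S)"
    unfolding part_def by (rule L2_set_mono) (auto simp: cinner_add_right norm_triangle_ineq)
  also have "\<dots> \<le> part S n x + part S n y" unfolding part_def by (rule L2_set_triangle_ineq)
  finally show ?thesis .
qed

lemma part_perturb: "part S n x \<le> part S n y + norm (x - y)"
  using part_triangle[of S n y "x - y"] part_le[of S n "x - y"] by simp

text \<open>On a vector of the core the approximation acts like \<open>A\<close>, up to the projection to its
  eigenvectors; eigenvalues at distance at least \<open>\<kappa>\<close> from \<open>c\<close> enlarge the components.\<close>

lemma part_core_step:
  assumes x: "x \<in> C" and S: "\<And>t. t \<in> S \<Longrightarrow> \<kappa> \<le> \<bar>t - c\<bar>" and \<kappa>: "0 \<le> \<kappa>"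
  shows "\<forall>\<^sub>F n in sequentially. \<kappa> * part S n x \<le> part S n (A x - c *\<^sub>R x)"
  using eigen[OF x]
proof eventually_elim
  case (elim n)
  have "\<kappa> * part S n x = L2_set (\<lambda>j. \<kappa> * cmod (cinner (w n j) x)) (eig_index n S)"
    unfolding part_def using \<kappa> by (rule L2_set_right_distrib)
  also have "\<dots> \<le> L2_set (\<lambda>j. cmod (cinner (w n j) (A x - c *\<^sub>R x))) (eig_index n S)"
  proof (rule L2_set_mono)
    fix j assume "j \<in> eig_index n S"
    then have j: "j \<le> n" "d n j \<in> S" by (auto simp: eig_index_def)
    have "cinner (w n j) (A x - c *\<^sub>R x) = of_real (d n j - c) * cinner (w n j) x"
      using elim j(1) by (simp add: cinner_diff_right cinner_scaleR_right algebra_simps)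
    then have "cmod (cinner (w n j) (A x - c *\<^sub>R x)) = \<bar>d n j - c\<bar> * cmod (cinner (w n j) x)"
      by (simp only: norm_mult norm_of_real)
    then show "\<kappa> * cmod (cinner (w n j) x) \<le> cmod (cinner (w n j) (A x - c *\<^sub>R x))"
      using S[OF j(2)] by (simp add: mult_right_mono)
  qed (use \<kappa> in simp)
  finally show ?case unfolding part_def .
qed

lemma part_step:
  assumes x: "x \<in> D" and S: "\<And>t. t \<in> S \<Longrightarrow> \<kappa> \<le> \<bar>t - c\<bar>" and \<kappa>: "0 \<le> \<kappa>" and \<epsilon>: "\<epsilon> > 0"
  shows "\<forall>\<^sub>F n in sequentially. \<kappa> * part S n x \<le> part S n (A x - c *\<^sub>R x) + \<epsilon>"
proof -
  \<comment> \<open>Replacing \<open>x\<close> by \<open>y\<close> costs \<open>\<kappa>\<close> on the left, and \<open>\<bar>c\<bar> + 1\<close> on the right.\<close>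
  define K where "K = \<kappa> + \<bar>c\<bar> + 1"
  have K: "0 < K" using \<kappa> by (simp add: K_def)
  obtain y where y: "y \<in> C" "norm (x - y) < \<epsilon> / K" "norm (A x - A y) < \<epsilon> / K"
    using core[OF x, of "\<epsilon> / K"] \<epsilon> K by auto
  have "\<forall>\<^sub>F n in sequentially. \<kappa> * part S n y \<le> part S n (A y - c *\<^sub>R y)"
    by (rule part_core_step[OF y(1) S \<kappa>])
  then show ?thesis
  proof eventually_elim
    case (elim n)
    have 1: "\<kappa> * part S n x \<le> \<kappa> * part S n y + \<kappa> * norm (x - y)"
      using mult_left_mono[OF part_perturb[of S n x y] \<kappa>] by (simp add: distrib_left)
    have 2: "part S n (A y - c *\<^sub>R y) \<le> part S n (A x - c *\<^sub>R x) + norm ((A y - c *\<^sub>R y) - (A x - c *\<^sub>R x))"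
      by (rule part_perturb)
    have eq: "(A y - c *\<^sub>R y) - (A x - c *\<^sub>R x) = c *\<^sub>R (x - y) - (A x - A y)"
      by (simp add: scaleR_diff_right)
    have 3: "norm ((A y - c *\<^sub>R y) - (A x - c *\<^sub>R x)) \<le> \<bar>c\<bar> * norm (x - y) + norm (A x - A y)"
      unfolding eq using norm_triangle_ineq4[of "c *\<^sub>R (x - y)" "A x - A y"] by simp
    have 4: "(\<kappa> + \<bar>c\<bar>) * norm (x - y) \<le> (\<kappa> + \<bar>c\<bar>) * (\<epsilon> / K)"
      using y(2) \<kappa> by (intro mult_left_mono) auto
    have "(\<kappa> + \<bar>c\<bar>) * (\<epsilon> / K) + \<epsilon> / K = (\<kappa> + \<bar>c\<bar> + 1) * (\<epsilon> / K)"
      by (simp only: distrib_right mult_1)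
    then have "(\<kappa> + \<bar>c\<bar>) * (\<epsilon> / K) + \<epsilon> / K = \<epsilon>"
      using K by (simp only: K_def[symmetric]) simp
    then show ?case using 1 2 3 4 elim y(3) by (simp add: distrib_right)
  qed
qed

text \<open>Let \<open>x\<close> have its spectral support within distance \<open>r\<close> from \<open>c\<close>. Then \<open>A - c\<close> shrinks it by the
  factor \<open>r\<close>, again and again, whereas the approximations enlarge the components beyond \<open>r + \<delta>\<close> by at
  least that factor. Hence these components are at most \<open>(r / (r + \<delta>))\<^sup>k * norm x\<close> in the limit, for
  every \<open>k\<close>.\<close>

lemma part_iterate:
  assumes pq: "p < q" and c: "c - r \<le> p" "q \<le> c + r" and S: "\<And>t. t \<in> S \<Longrightarrow> \<kappa> \<le> \<bar>t - c\<bar>"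
    and \<kappa>: "0 \<le> \<kappa>"
  shows "band p q x = x \<Longrightarrow> \<epsilon> > 0 \<Longrightarrow> \<forall>\<^sub>F n in sequentially. \<kappa> ^ k * part S n x \<le> r ^ k * norm x + \<epsilon>"
proof (induction k arbitrary: x \<epsilon>)
  case 0
  have "part S n x \<le> norm x + \<epsilon>" for n
    using part_le[of S n x] 0(2) by linarith
  then show ?case by simp
next
  case (Suc k)
  define y where "y = A x - c *\<^sub>R x"
  have y: "band p q y = y"
    unfolding y_def using band_A[OF Suc(2) pq] Suc(2) by (simp add: band_diff band_scaleR)
  have r: "0 \<le> r" using pq c by linarith
  define e where "e = \<epsilon> / (2 * (\<kappa> ^ k + 1))"
  have pk: "0 \<le> \<kappa> ^ k" using \<kappa> by simp
  then have e: "e > 0" "\<kappa> ^ k * e \<le> \<epsilon> / 2" using Suc(3) by (auto simp: e_def field_simps)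
  have "\<forall>\<^sub>F n in sequentially. \<kappa> * part S n x \<le> part S n y + e"
    unfolding y_def by (rule part_step[OF band_in_domain[OF Suc(2) pq] S \<kappa> e(1)])
  moreover have "\<forall>\<^sub>F n in sequentially. \<kappa> ^ k * part S n y \<le> r ^ k * norm y + \<epsilon> / 2"
    using Suc(1)[OF y, of "\<epsilon> / 2"] Suc(3) by simp
  ultimately show ?case
  proof eventually_elim
    case (elim n)
    have "\<kappa> ^ Suc k * part S n x = \<kappa> ^ k * (\<kappa> * part S n x)" by simp
    also have "\<dots> \<le> \<kappa> ^ k * (part S n y + e)" using elim(1) pk by (rule mult_left_mono)
    also have "\<dots> = \<kappa> ^ k * part S n y + \<kappa> ^ k * e" by (simp add: distrib_left)
    also have "\<dots> \<le> r ^ k * norm y + \<epsilon>" using elim(2) e(2) by linarith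
    also have "r ^ k * norm y \<le> r ^ k * (r * norm x)"
      using norm_A_minus_centre_le[OF Suc(2) pq c] r unfolding y_def by (intro mult_left_mono) auto
    finally show ?case by (simp add: mult.assoc mult.left_commute)
  qed
qed

lemma part_concentration:
  assumes pq: "p < q" and x: "band p q x = x" and \<delta>: "\<delta> > 0"
    and S: "\<And>t. t \<in> S \<Longrightarrow> t \<le> p - \<delta> \<or> q + \<delta> \<le> t"
  shows "(\<lambda>n. part S n x) \<longlonglongrightarrow> 0"
proof (rule LIMSEQ_I)
  fix \<epsilon> :: real assume \<epsilon>: "\<epsilon> > 0"
  define c where "c = (p + q) / 2"
  define r where "r = (q - p) / 2"
  have r: "0 < r" "c - r \<le> p" "q \<le> c + r" using pq by (simp_all add: r_def c_def field_simps)
  have S': "r + \<delta> \<le> \<bar>t - c\<bar>" if "t \<in> S" for t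
    using S[OF that] unfolding r_def c_def by argo
  have "(\<lambda>k. (r / (r + \<delta>)) ^ k * norm x) \<longlonglongrightarrow> 0 * norm x"
    using r \<delta> by (intro tendsto_mult tendsto_const LIMSEQ_realpow_zero) auto
  then have "\<forall>\<^sub>F k in sequentially. (r / (r + \<delta>)) ^ k * norm x < \<epsilon> / 2"
    by (rule order_tendstoD(2)) (simp add: \<epsilon>)
  then obtain k where k: "(r / (r + \<delta>)) ^ k * norm x < \<epsilon> / 2"
    using eventually_happens' sequentially_bot by blast
  define P where "P = (r + \<delta>) ^ k"
  have P: "P > 0" using r \<delta> by (simp add: P_def)
  have "r ^ k * norm x = P * ((r / (r + \<delta>)) ^ k * norm x)"
    using P r \<delta> by (simp add: P_def power_divide)
  also have "\<dots> < P * (\<epsilon> / 2)" using k P by (rule mult_strict_left_mono)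
  finally have rk: "r ^ k * norm x < P * (\<epsilon> / 2)" .
  have "\<forall>\<^sub>F n in sequentially. P * part S n x \<le> r ^ k * norm x + P * (\<epsilon> / 2)"
    unfolding P_def using r \<delta> \<epsilon> P
    by (intro part_iterate[OF pq r(2,3) S' _ x]) (auto simp: P_def)
  then have "\<forall>\<^sub>F n in sequentially. part S n x < \<epsilon>"
  proof eventually_elim
    case (elim n)
    have "P * part S n x < P * \<epsilon>" using elim rk by (simp add: field_simps)
    then show ?case using P by simp
  qed
  then obtain N where "\<forall>n\<ge>N. part S n x < \<epsilon>" unfolding eventually_sequentially by blast
  then show "\<exists>N. \<forall>n\<ge>N. norm (part S n x - 0) < \<epsilon>" using part_nonneg by (auto simp: abs_of_nonneg)
qed

lemma isCont_imp_small_band: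
  assumes s: "isCont (distr x) s" and \<epsilon>: "\<epsilon> > 0"
  shows "\<exists>\<delta>>0. norm (band (s - \<delta>) (s + \<delta>) x) < \<epsilon>"
proof -
  have "\<epsilon>\<^sup>2 / 2 > 0" using \<epsilon> by simp
  then obtain \<eta> where \<eta>: "\<eta> > 0" "\<And>t. \<bar>t - s\<bar> < \<eta> \<Longrightarrow> \<bar>distr x t - distr x s\<bar> < \<epsilon>\<^sup>2 / 2"
    using s unfolding isCont_def LIM_def dist_real_def by (metis abs_0 diff_self half_gt_zero_iff)
  have "(norm (band (s - \<eta> / 2) (s + \<eta> / 2) x))\<^sup>2 = distr x (s + \<eta> / 2) - distr x (s - \<eta> / 2)"
    using \<eta>(1) norm_band[of "s - \<eta> / 2" "s + \<eta> / 2" x] by (simp add: distr_def)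
  also have "\<dots> < \<epsilon>\<^sup>2"
  proof -
    have "\<bar>distr x (s + \<eta> / 2) - distr x s\<bar> < \<epsilon>\<^sup>2 / 2" "\<bar>distr x (s - \<eta> / 2) - distr x s\<bar> < \<epsilon>\<^sup>2 / 2"
      using \<eta> by simp_all
    then show ?thesis by linarith
  qed
  finally have "norm (band (s - \<eta> / 2) (s + \<eta> / 2) x) < \<epsilon>"
    using \<epsilon> power_less_imp_less_base by (metis less_imp_le)
  then show ?thesis using \<eta>(1) by (intro exI[of _ "\<eta> / 2"]) auto
qed

text \<open>Cut \<open>x\<close> into a piece below \<open>s\<close>, a piece above \<open>s\<close>, and a small rest.  The approximations see the
  lower piece only below \<open>s\<close> and the upper piece only above \<open>s\<close>. This bounds both parts of \<open>x\<close> from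
  above, and since their squares have the right sum, both converge.\<close>

lemma part_limit_bounds:
  assumes s: "isCont (distr x) s" and \<epsilon>: "\<epsilon> > 0"
  shows "\<forall>\<^sub>F n in sequentially. part {..s} n x \<le> norm (E s x) + \<epsilon> \<and> part {s<..} n x \<le> norm (x - E s x) + \<epsilon>"
proof -
  obtain \<delta> where \<delta>: "\<delta> > 0" "norm (band (s - \<delta>) (s + \<delta>) x) < \<epsilon> / 4"
    using isCont_imp_small_band[OF s, of "\<epsilon> / 4"] \<epsilon> by auto
  have "\<forall>\<^sub>F R in at_top. dist (band (- R) R x) x < \<epsilon> / 4"
    using tendstoD[OF band_exhausts[of x], of "\<epsilon> / 4"] \<epsilon> by simp
  moreover have "\<forall>\<^sub>F R in at_top. \<bar>s\<bar> + \<delta> < R" by (rule eventually_gt_at_top)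
  ultimately have "\<forall>\<^sub>F R in at_top. dist (band (- R) R x) x < \<epsilon> / 4 \<and> \<bar>s\<bar> + \<delta> < R"
    by (rule eventually_conj)
  then obtain R where R: "dist (band (- R) R x) x < \<epsilon> / 4" "\<bar>s\<bar> + \<delta> < R"
    using eventually_happens' trivial_limit_at_top_linorder by blast
  define y where "y = band (- R) (s - \<delta>) x"
  define z where "z = band (s + \<delta>) R x"
  have R': "- R < s - \<delta>" "s + \<delta> < R" "s - \<delta> < s + \<delta>" using R(2) \<delta>(1) by linarith+
  have yb: "band (- R) (s - \<delta>) y = y" and zb: "band (s + \<delta>) R z = z"
    unfolding y_def z_def using R' by (auto intro!: band_subset)
  have xyz: "x - (y + z) = (x - band (- R) R x) + band (s - \<delta>) (s + \<delta>) x"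
    by (simp add: y_def z_def band_def)
  have rest: "norm (x - (y + z)) < \<epsilon> / 2"
    unfolding xyz using norm_triangle_ineq[of "x - band (- R) R x" "band (s - \<delta>) (s + \<delta>) x"] R(1) \<delta>(2)
    by (simp add: dist_norm norm_minus_commute)
  have ny: "norm y \<le> norm (E s x)"
  proof -
    have "y = band (- R) (s - \<delta>) (E s x)"
      using R' \<delta>(1) by (simp add: y_def band_def E_E)
    then show ?thesis using norm_band_le[of "- R" "s - \<delta>" "E s x"] R'(1) by simp
  qed
  have nz: "norm z \<le> norm (x - E s x)"
  proof -
    have "z = band (s + \<delta>) R (x - E s x)"
      using R' \<delta>(1) by (simp add: z_def band_def E_E E_diff min_absorb2)
    then show ?thesis using norm_band_le[of "s + \<delta>" R "x - E s x"] R'(2) by simp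
  qed
  have "(\<lambda>n. part {s<..} n y) \<longlonglongrightarrow> 0"
    by (rule part_concentration[OF R'(1) yb \<delta>(1)]) auto
  then have "\<forall>\<^sub>F n in sequentially. part {s<..} n y < \<epsilon> / 4"
    by (rule order_tendstoD(2)) (simp add: \<epsilon>)
  moreover have "(\<lambda>n. part {..s} n z) \<longlonglongrightarrow> 0"
    by (rule part_concentration[OF R'(2) zb \<delta>(1)]) auto
  then have "\<forall>\<^sub>F n in sequentially. part {..s} n z < \<epsilon> / 4"
    by (rule order_tendstoD(2)) (simp add: \<epsilon>)
  ultimately show ?thesis
  proof eventually_elim
    case (elim n)
    have "part S n x \<le> part S n y + part S n z + norm (x - (y + z))" for S
      using part_perturb[of S n x "y + z"] part_triangle[of S n y z] by linarith
    note this[of "{..s}"] this[of "{s<..}"]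
    then show ?case
      using \<epsilon> elim rest ny nz part_le[of "{..s}" n y] part_le[of "{s<..}" n z]
      by (intro conjI) linarith+
  qed
qed

lemma distr_limit:
  assumes x: "x \<in> C" and s: "isCont (distr x) s"
  shows "(\<lambda>n. weighted (\<lambda>_. 1) {..s} n x) \<longlonglongrightarrow> distr x s"
proof -
  define \<alpha> where "\<alpha> = norm (E s x)"
  define \<beta> where "\<beta> = norm (x - E s x)"
  have ab: "(norm x)\<^sup>2 = \<alpha>\<^sup>2 + \<beta>\<^sup>2" using norm_E_complement[of x s] by (simp add: \<alpha>_def \<beta>_def)
  have "(\<lambda>n. (part {..s} n x)\<^sup>2) \<longlonglongrightarrow> \<alpha>\<^sup>2"
  proof (rule tendstoI)
    fix \<eta> :: real assume \<eta>: "\<eta> > 0"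
    have "((\<lambda>\<epsilon>. (\<alpha> + \<epsilon>)\<^sup>2) \<longlongrightarrow> (\<alpha> + 0)\<^sup>2) (at_right 0)" "((\<lambda>\<epsilon>. (\<beta> + \<epsilon>)\<^sup>2) \<longlongrightarrow> (\<beta> + 0)\<^sup>2) (at_right 0)"
      by (intro tendsto_intros)+
    then have "\<forall>\<^sub>F \<epsilon> in at_right 0. (\<alpha> + \<epsilon>)\<^sup>2 < \<alpha>\<^sup>2 + \<eta>" "\<forall>\<^sub>F \<epsilon> in at_right 0. (\<beta> + \<epsilon>)\<^sup>2 < \<beta>\<^sup>2 + \<eta>"
      using \<eta> by (auto intro: order_tendstoD(2))
    moreover have "\<forall>\<^sub>F \<epsilon>::real in at_right 0. 0 < \<epsilon>" by (rule eventually_at_right_less)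
    ultimately have "\<forall>\<^sub>F \<epsilon> in at_right 0. (\<alpha> + \<epsilon>)\<^sup>2 < \<alpha>\<^sup>2 + \<eta> \<and> (\<beta> + \<epsilon>)\<^sup>2 < \<beta>\<^sup>2 + \<eta> \<and> 0 < \<epsilon>"
      by eventually_elim auto
    then obtain \<epsilon> where \<epsilon>: "(\<alpha> + \<epsilon>)\<^sup>2 < \<alpha>\<^sup>2 + \<eta>" "(\<beta> + \<epsilon>)\<^sup>2 < \<beta>\<^sup>2 + \<eta>" "0 < \<epsilon>"
      using eventually_happens' trivial_limit_at_right_real by blast
    show "\<forall>\<^sub>F n in sequentially. dist ((part {..s} n x)\<^sup>2) (\<alpha>\<^sup>2) < \<eta>"
      using part_limit_bounds[OF s \<epsilon>(3)] complete[OF x]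
    proof eventually_elim
      case (elim n)
      have "(part {..s} n x)\<^sup>2 \<le> (\<alpha> + \<epsilon>)\<^sup>2" "(part {s<..} n x)\<^sup>2 \<le> (\<beta> + \<epsilon>)\<^sup>2"
        using elim(1) unfolding \<alpha>_def \<beta>_def by (auto intro!: power_mono part_nonneg)
      moreover have "(part {..s} n x)\<^sup>2 + (part {s<..} n x)\<^sup>2 = (norm x)\<^sup>2"
      proof -
        have "{..s} \<union> {s<..} = UNIV" by auto
        moreover have "weighted (\<lambda>_. 1) UNIV n x = (norm x)\<^sup>2"
          using elim(2) by (simp add: weighted_def eig_index_def atMost_def)
        ultimately show ?thesis
          unfolding part_square using weighted_union[of "{..s}" "{s<..}" "\<lambda>_. 1" n x] by (auto simp: disjoint_iff)
      qed
      ultimately show ?case using ab \<epsilon>(1,2) by (simp add: dist_real_def abs_less_iff)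
    qed
  qed
  then show ?thesis unfolding part_square distr_def \<alpha>_def .
qed

text \<open>The cut-off vector \<open>band (- R) R x\<close> is seen by the approximations only near \<open>[- R, R]\<close>.\<close>

lemma part_tail:
  assumes \<epsilon>: "\<epsilon> > 0"
  shows "\<exists>R. \<forall>\<^sub>F n in sequentially. part (- {- R..R}) n x < \<epsilon>"
proof -
  have "\<forall>\<^sub>F R in at_top. dist (band (- R) R x) x < \<epsilon> / 2"
    using tendstoD[OF band_exhausts[of x], of "\<epsilon> / 2"] \<epsilon> by simp
  moreover have "\<forall>\<^sub>F R in at_top. (0::real) < R" by (rule eventually_gt_at_top)
  ultimately have "\<forall>\<^sub>F R in at_top. dist (band (- R) R x) x < \<epsilon> / 2 \<and> 0 < R"
    by (rule eventually_conj)
  then obtain R where R: "dist (band (- R) R x) x < \<epsilon> / 2" "0 < R"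
    using eventually_happens' trivial_limit_at_top_linorder by blast
  define y where "y = band (- R) R x"
  have "(\<lambda>n. part (- {- (R + 1)..R + 1}) n y) \<longlonglongrightarrow> 0"
    by (rule part_concentration[of "- R" R _ 1]) (use R(2) in \<open>auto simp: y_def band_subset\<close>)
  then have "\<forall>\<^sub>F n in sequentially. part (- {- (R + 1)..R + 1}) n y < \<epsilon> / 2"
    by (rule order_tendstoD(2)) (simp add: \<epsilon>)
  then have "\<forall>\<^sub>F n in sequentially. part (- {- (R + 1)..R + 1}) n x < \<epsilon>"
  proof eventually_elim
    case (elim n)
    then show ?case
      using part_perturb[of "- {- (R + 1)..R + 1}" n x y] R(1) unfolding y_def
      by (simp add: dist_norm norm_minus_commute)
  qed
  then show ?thesis by blast
qed

text \<open>Weighted by the square of the eigenvalue, the components of \<open>x\<close> become those of \<open>A x\<close>. So the tail of a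
  quadratically bounded integrand is bounded by the far parts of the two fixed vectors \<open>x\<close> and \<open>A x\<close>.\<close>

lemma weighted_tail:
  assumes x: "x \<in> C" and \<epsilon>: "\<epsilon> > 0" and ab: "a > 0" "b > 0" and f: "\<And>t. \<bar>f t\<bar> \<le> a + b * t\<^sup>2"
  shows "\<exists>R. \<forall>S. S \<subseteq> - {- R..R} \<longrightarrow> (\<forall>\<^sub>F n in sequentially. \<bar>weighted f S n x\<bar> < \<epsilon>)"
proof -
  define K where "K = a + b"
  define e where "e = sqrt (\<epsilon> / (2 * K))"
  have K: "K > 0" using ab by (simp add: K_def)
  then have "0 < \<epsilon> / (2 * K)" using \<epsilon> by simp
  then have "e > 0" "e\<^sup>2 = \<epsilon> / (2 * K)" unfolding e_def by simp_all
  moreover have "\<epsilon> / (2 * K) * K = \<epsilon> / 2" using K by simp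
  ultimately have e: "e > 0" "e\<^sup>2 * (a + b) < \<epsilon>" using \<epsilon> by (simp_all add: K_def)
  obtain R1 where R1: "\<forall>\<^sub>F n in sequentially. part (- {- R1..R1}) n x < e" using part_tail[OF e(1)] by blast
  obtain R2 where R2: "\<forall>\<^sub>F n in sequentially. part (- {- R2..R2}) n (A x) < e" using part_tail[OF e(1)] by blast
  define R where "R = max R1 R2"
  have "\<forall>\<^sub>F n in sequentially. \<bar>weighted f S n x\<bar> < \<epsilon>" if S: "S \<subseteq> - {- R..R}" for S
    using R1 R2 eigen[OF x]
  proof eventually_elim
    case (elim n)
    have S12: "S \<subseteq> - {- R1..R1}" "S \<subseteq> - {- R2..R2}"
      using S by (rule order_trans; force simp: R_def)+
    have 1: "(part S n x)\<^sup>2 \<le> e\<^sup>2"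
      using part_mono[OF S12(1), of n x] elim(1) by (intro power_mono part_nonneg) auto
    have 2: "(part S n (A x))\<^sup>2 \<le> e\<^sup>2"
      using part_mono[OF S12(2), of n "A x"] elim(2) by (intro power_mono part_nonneg) auto
    have "\<bar>weighted f S n x\<bar> \<le> (\<Sum>j\<in>eig_index n S. \<bar>f (d n j)\<bar> * (cmod (cinner (w n j) x))\<^sup>2)"
      unfolding weighted_def using sum_abs[of "\<lambda>j. f (d n j) * (cmod (cinner (w n j) x))\<^sup>2" "eig_index n S"]
      by (simp add: abs_mult)
    also have "\<dots> \<le> (\<Sum>j\<in>eig_index n S. a * (cmod (cinner (w n j) x))\<^sup>2 + b * (cmod (cinner (w n j) (A x)))\<^sup>2)"
    proof (rule sum_mono)
      fix j assume "j \<in> eig_index n S"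
      then have "cinner (w n j) (A x) = of_real (d n j) * cinner (w n j) x"
        using elim(3) by (simp add: eig_index_def)
      then have "(cmod (cinner (w n j) (A x)))\<^sup>2 = (d n j)\<^sup>2 * (cmod (cinner (w n j) x))\<^sup>2"
        by (simp add: norm_mult power_mult_distrib)
      then show "\<bar>f (d n j)\<bar> * (cmod (cinner (w n j) x))\<^sup>2
          \<le> a * (cmod (cinner (w n j) x))\<^sup>2 + b * (cmod (cinner (w n j) (A x)))\<^sup>2"
        using mult_right_mono[OF f[of "d n j"], of "(cmod (cinner (w n j) x))\<^sup>2"] by (simp add: distrib_right)
    qed
    also have "\<dots> = a * (part S n x)\<^sup>2 + b * (part S n (A x))\<^sup>2"
      unfolding part_square weighted_def by (simp add: sum.distrib sum_distrib_left)
    also have "\<dots> \<le> a * e\<^sup>2 + b * e\<^sup>2" using 1 2 ab by (intro add_mono mult_left_mono) auto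
    also have "\<dots> < \<epsilon>" using e(2) by (simp add: algebra_simps)
    finally show ?case .
  qed
  then show ?thesis by blast
qed

lemma weighted_diff:
  assumes "s \<le> t" shows "weighted f {s<..t} n x = weighted f {..t} n x - weighted f {..s} n x"
proof -
  have "{..t} = {..s} \<union> {s<..t}" "{..s} \<inter> {s<..t} = {}" using assms by auto
  then show ?thesis using weighted_union[of "{..s}" "{s<..t}" f n x] by simp
qed

lemma weighted_cells:
  assumes "tagged a b \<delta> (m, t, \<xi>)"
  shows "weighted f {a<..b} n x = (\<Sum>k<m. weighted f {t k<..t (Suc k)} n x)"
proof -
  have "(\<Sum>k<m. weighted f {t k<..t (Suc k)} n x)
      = (\<Sum>k<m. weighted f {..t (Suc k)} n x - weighted f {..t k} n x)"
    using tagged_cell(1)[OF assms] by (intro sum.cong refl weighted_diff) (auto intro: less_imp_le)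
  also have "\<dots> = weighted f {..b} n x - weighted f {..a} n x"
    using sum_lessThan_telescope[of "\<lambda>k. weighted f {..t k} n x" m] tagged_ends[OF assms] by simp
  also have "\<dots> = weighted f {a<..b} n x"
    using tagged_range[OF assms, of 0] tagged_ends[OF assms] by (intro weighted_diff[symmetric]) auto
  finally show ?thesis by simp
qed

lemma continuity_points_dense:
  "p < q \<Longrightarrow> \<exists>r. isCont (distr x) r \<and> p < r \<and> r < q"
  using real_interval_avoid_countable_set[OF _ mono_ctble_discont[OF mono_distr[of x]], of p q] by auto


text \<open>On a partition by continuity points, the weight of each cell converges. Within a cell all values
  of \<open>f\<close>, at whatever eigenvalues, differ from the value at the left end by no more than the oscillation,
  whose weighted sum is small because \<open>f\<close> is integrable.\<close>

lemma weighted_limit_interval: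
  assumes x: "x \<in> C" and ab: "a < b" "isCont (distr x) a" "isCont (distr x) b"
    and osc: "small_oscillation f (distr x) a b" and int: "has_RS_integral f (distr x) a b L"
    and B: "\<And>t. t \<in> {a..b} \<Longrightarrow> \<bar>f t\<bar> \<le> B"
  shows "(\<lambda>n. weighted f {a<..b} n x) \<longlonglongrightarrow> L"
proof (rule tendstoI)
  fix \<epsilon> :: real assume \<epsilon>: "\<epsilon> > 0"
  have B0: "0 \<le> B" using B[of a] ab(1) by (auto intro: order_trans[OF abs_ge_zero])
  obtain \<delta>1 where \<delta>1: "\<delta>1 > 0" "\<And>n t \<xi> \<eta>. tagged a b \<delta>1 (n, t, \<xi>) \<Longrightarrow> tagged a b \<delta>1 (n, t, \<eta>) \<Longrightarrow>
       (\<Sum>k<n. \<bar>f (\<xi> k) - f (\<eta> k)\<bar> * (distr x (t (Suc k)) - distr x (t k))) < \<epsilon> / 4"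
    using small_oscillationE[OF osc, of "\<epsilon> / 4"] \<epsilon> by auto
  have "\<forall>\<^sub>F p in refining a b. dist (RS_sum f (distr x) p) L < \<epsilon> / 4"
    using int \<epsilon> unfolding has_RS_integral_iff by (intro tendstoD) auto
  then obtain \<delta>2 where \<delta>2: "\<delta>2 > 0" "\<And>p. tagged a b \<delta>2 p \<Longrightarrow> dist (RS_sum f (distr x) p) L < \<epsilon> / 4"
    unfolding eventually_refining by blast
  obtain m t where t: "tagged a b (min \<delta>1 \<delta>2) (m, t, t)" "\<And>k. k \<le> m \<Longrightarrow> isCont (distr x) (t k)"
    using fine_partition_in_dense_set[OF ab(1), of "min \<delta>1 \<delta>2" "{s. isCont (distr x) s}"]
      \<delta>1(1) \<delta>2(1) ab continuity_points_dense[of _ _ x] by auto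
  have t1: "tagged a b \<delta>1 (m, t, t)" and t2: "tagged a b \<delta>2 (m, t, t)"
    using t(1) by (auto simp: tagged_def)
  define \<Delta> where "\<Delta> k = distr x (t (Suc k)) - distr x (t k)" for k
  define W where "W k n = weighted (\<lambda>_. 1) {t k<..t (Suc k)} n x" for k n
  have W0: "0 \<le> W k n" for k n unfolding W_def part_square[symmetric] by simp
  have W: "(\<lambda>n. W k n) \<longlonglongrightarrow> \<Delta> k" if "k < m" for k
  proof -
    have "(\<lambda>n. weighted (\<lambda>_. 1) {..t (Suc k)} n x - weighted (\<lambda>_. 1) {..t k} n x) \<longlonglongrightarrow> \<Delta> k"
      unfolding \<Delta>_def using that by (intro tendsto_diff distr_limit[OF x] t(2)) auto
    then show ?thesis
      unfolding W_def using weighted_diff[OF less_imp_le[OF tagged_cell(1)[OF t1 that]]] by simp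
  qed
  have "(\<lambda>n. \<Sum>k<m. 3 * B * \<bar>W k n - \<Delta> k\<bar>) \<longlonglongrightarrow> (\<Sum>k<m. 3 * B * \<bar>\<Delta> k - \<Delta> k\<bar>)"
    using W by (intro tendsto_intros) auto
  then have "\<forall>\<^sub>F n in sequentially. (\<Sum>k<m. 3 * B * \<bar>W k n - \<Delta> k\<bar>) < \<epsilon> / 4"
    by (rule order_tendstoD(2)) (simp add: \<epsilon>)
  then show "\<forall>\<^sub>F n in sequentially. dist (weighted f {a<..b} n x) L < \<epsilon>"
  proof eventually_elim
    case (elim n)
    \<comment> \<open>In each cell, the eigenvalue where \<open>f\<close> deviates most from its value at the left end serves as a
      tag; it depends on \<open>n\<close>, which the oscillation bound tolerates.\<close>
    define S where "S k = insert (t k) (d n ` eig_index n {t k<..t (Suc k)})" for k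
    have "\<exists>\<alpha>\<in>S k. \<forall>p\<in>S k. \<bar>f p - f (t k)\<bar> \<le> \<bar>f \<alpha> - f (t k)\<bar>" for k
      by (rule finite_arg_max) (auto simp: S_def finite_eig_index)
    then obtain \<alpha> where \<alpha>: "\<And>k. \<alpha> k \<in> S k" "\<And>k p. p \<in> S k \<Longrightarrow> \<bar>f p - f (t k)\<bar> \<le> \<bar>f (\<alpha> k) - f (t k)\<bar>"
      by metis
    have "S k \<subseteq> {t k..t (Suc k)}" if "k < m" for k
      using tagged_cell(1)[OF t1 that] by (auto simp: S_def eig_index_def)
    then have tag: "tagged a b \<delta>1 (m, t, \<alpha>)"
      using tagged_retag[OF t1, of \<alpha>] \<alpha>(1) by blast
    have cell: "\<bar>weighted f {t k<..t (Suc k)} n x - f (t k) * W k n\<bar> \<le> \<bar>f (\<alpha> k) - f (t k)\<bar> * W k n" for k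
    proof -
      let ?c = "\<lambda>j. (cmod (cinner (w n j) x))\<^sup>2"
      have "weighted f {t k<..t (Suc k)} n x - f (t k) * W k n
          = (\<Sum>j\<in>eig_index n {t k<..t (Suc k)}. (f (d n j) - f (t k)) * ?c j)"
        by (simp add: W_def weighted_def sum_distrib_left sum_subtractf left_diff_distrib)
      also have "\<bar>\<dots>\<bar> \<le> (\<Sum>j\<in>eig_index n {t k<..t (Suc k)}. \<bar>f (\<alpha> k) - f (t k)\<bar> * ?c j)"
      proof (rule order_trans[OF sum_abs], rule sum_mono)
        fix j assume "j \<in> eig_index n {t k<..t (Suc k)}"
        then have "d n j \<in> S k" by (auto simp: S_def)
        then show "\<bar>(f (d n j) - f (t k)) * ?c j\<bar> \<le> \<bar>f (\<alpha> k) - f (t k)\<bar> * ?c j"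
          using \<alpha>(2) by (simp add: abs_mult mult_right_mono)
      qed
      also have "\<dots> = \<bar>f (\<alpha> k) - f (t k)\<bar> * W k n" by (simp add: W_def weighted_def sum_distrib_left)
      finally show ?thesis .
    qed
    have "\<bar>weighted f {a<..b} n x - (\<Sum>k<m. f (t k) * \<Delta> k)\<bar>
        = \<bar>\<Sum>k<m. weighted f {t k<..t (Suc k)} n x - f (t k) * \<Delta> k\<bar>"
      by (simp add: weighted_cells[OF t1] sum_subtractf)
    also have "\<dots> \<le> (\<Sum>k<m. \<bar>f (\<alpha> k) - f (t k)\<bar> * \<Delta> k + 3 * B * \<bar>W k n - \<Delta> k\<bar>)"
    proof (rule order_trans[OF sum_abs], rule sum_mono)
      fix k assume "k \<in> {..<m}"
      then have k: "k < m" by simp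
      have fb: "\<bar>f (\<alpha> k)\<bar> \<le> B" "\<bar>f (t k)\<bar> \<le> B"
        using tagged_tag_range[OF tag k] tagged_tag_range[OF t1 k] by (auto intro!: B)
      have "\<bar>weighted f {t k<..t (Suc k)} n x - f (t k) * \<Delta> k\<bar>
          \<le> \<bar>weighted f {t k<..t (Suc k)} n x - f (t k) * W k n\<bar> + \<bar>f (t k) * (W k n - \<Delta> k)\<bar>"
        by (simp add: right_diff_distrib)
      also have "\<dots> \<le> \<bar>f (\<alpha> k) - f (t k)\<bar> * W k n + B * \<bar>W k n - \<Delta> k\<bar>"
        using cell[of k] fb(2) by (intro add_mono) (auto simp: abs_mult intro: mult_right_mono)
      also have "\<bar>f (\<alpha> k) - f (t k)\<bar> * W k n
          = \<bar>f (\<alpha> k) - f (t k)\<bar> * \<Delta> k + \<bar>f (\<alpha> k) - f (t k)\<bar> * (W k n - \<Delta> k)"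
        by (simp add: right_diff_distrib)
      also have "\<bar>f (\<alpha> k) - f (t k)\<bar> * (W k n - \<Delta> k) \<le> (2 * B) * \<bar>W k n - \<Delta> k\<bar>"
        using fb by (intro order_trans[OF mult_left_mono[OF abs_ge_self] mult_right_mono]) auto
      finally show "\<bar>weighted f {t k<..t (Suc k)} n x - f (t k) * \<Delta> k\<bar>
          \<le> \<bar>f (\<alpha> k) - f (t k)\<bar> * \<Delta> k + 3 * B * \<bar>W k n - \<Delta> k\<bar>" by simp
    qed
    also have "\<dots> < \<epsilon> / 4 + \<epsilon> / 4"
      unfolding sum.distrib using \<delta>1(2)[OF tag t1] elim by (intro add_strict_mono) (auto simp: \<Delta>_def)
    finally have "\<bar>weighted f {a<..b} n x - (\<Sum>k<m. f (t k) * \<Delta> k)\<bar> < \<epsilon> / 2" by simp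
    moreover have "\<bar>(\<Sum>k<m. f (t k) * \<Delta> k) - L\<bar> < \<epsilon> / 4"
      using \<delta>2(2)[OF t2] by (simp add: RS_sum_def dist_real_def \<Delta>_def)
    ultimately show ?case using \<epsilon> unfolding dist_real_def by linarith
  qed
qed

text \<open>Cut the line at continuity points far enough out that both tails are small.\<close>

lemma weighted_limit:
  assumes x: "x \<in> C"
    and osc: "\<And>a b. a < b \<Longrightarrow> small_oscillation f (distr x) a b"
    and int: "\<And>a b. a < b \<Longrightarrow> has_RS_integral f (distr x) a b (L a b)"
    and lim: "((\<lambda>(a, b). L a b) \<longlongrightarrow> l) (at_bot \<times>\<^sub>F at_top)"
    and f: "\<alpha> > 0" "\<beta> > 0" "\<And>t. \<bar>f t\<bar> \<le> \<alpha> + \<beta> * t\<^sup>2"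
  shows "(\<lambda>n. weighted f UNIV n x) \<longlonglongrightarrow> l"
proof (rule tendstoI)
  fix \<epsilon> :: real assume \<epsilon>: "\<epsilon> > 0"
  obtain R where R: "\<And>S. S \<subseteq> - {- R..R} \<Longrightarrow> \<forall>\<^sub>F n in sequentially. \<bar>weighted f S n x\<bar> < \<epsilon> / 3"
    using weighted_tail[OF x _ f, of "\<epsilon> / 3"] \<epsilon> by auto
  have "\<forall>\<^sub>F z in at_bot \<times>\<^sub>F at_top. dist (case z of (a, b) \<Rightarrow> L a b) l < \<epsilon> / 3"
    using \<epsilon> by (intro tendstoD[OF lim]) auto
  then obtain P Q where P: "eventually P at_bot" and Q: "eventually Q at_top"
      and PQ: "\<And>a b. P a \<Longrightarrow> Q b \<Longrightarrow> dist (L a b) l < \<epsilon> / 3"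
    unfolding eventually_prod_filter by auto
  obtain K where K: "\<And>a. a \<le> K \<Longrightarrow> P a" using P unfolding eventually_at_bot_linorder by blast
  obtain K' where K': "\<And>b. K' \<le> b \<Longrightarrow> Q b" using Q unfolding eventually_at_top_linorder by blast
  define r where "r = 1 + \<bar>R\<bar> + \<bar>K\<bar> + \<bar>K'\<bar>"
  obtain a where a: "isCont (distr x) a" "- r - 1 < a" "a < - r"
    using continuity_points_dense[of "- r - 1" "- r" x] by auto
  obtain b where b: "isCont (distr x) b" "r < b" "b < r + 1"
    using continuity_points_dense[of r "r + 1" x] by auto
  have ab: "a < b" "a < - R" "R < b" "a \<le> K" "K' \<le> b" using a b unfolding r_def by linarith+
  have "\<bar>f t\<bar> \<le> \<alpha> + \<beta> * (r + 1)\<^sup>2" if "t \<in> {a..b}" for t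
  proof -
    have "\<bar>t\<bar> \<le> r + 1" using that a b by auto
    then have "t\<^sup>2 \<le> (r + 1)\<^sup>2" by (metis abs_ge_zero power2_abs power_mono)
    then have "\<beta> * t\<^sup>2 \<le> \<beta> * (r + 1)\<^sup>2" using f(2) by simp
    then show ?thesis using f(3)[of t] by linarith
  qed
  then have "(\<lambda>n. weighted f {a<..b} n x) \<longlonglongrightarrow> L a b"
    by (rule weighted_limit_interval[OF x ab(1) a(1) b(1) osc[OF ab(1)] int[OF ab(1)]])
  then have "\<forall>\<^sub>F n in sequentially. dist (weighted f {a<..b} n x) (L a b) < \<epsilon> / 3"
    using \<epsilon> by (intro tendstoD) auto
  moreover have "\<forall>\<^sub>F n in sequentially. \<bar>weighted f (- {a<..b}) n x\<bar> < \<epsilon> / 3"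
    using ab by (intro R) auto
  ultimately show "\<forall>\<^sub>F n in sequentially. dist (weighted f UNIV n x) l < \<epsilon>"
  proof eventually_elim
    case (elim n)
    have "weighted f UNIV n x = weighted f {a<..b} n x + weighted f (- {a<..b}) n x"
      using weighted_union[of "{a<..b}" "- {a<..b}" f n x] by simp
    then show ?case using elim PQ[OF K[OF ab(4)] K'[OF ab(5)]]
      unfolding dist_real_def by linarith
  qed
qed

end

section \<open>Functions of an operator and their form values\<close>

text \<open>By the first hypothesis \<open>\<kappa>\<close> is increasing, and it is bounded, so it is nearly constant far out; then
  so is \<open>h\<close>.\<close>

lemma controlled_limit_at_top:
  fixes h :: "real \<Rightarrow> 'b::{real_normed_vector,complete_space}"
  assumes ctrl: "\<And>b b'. 0 < b \<Longrightarrow> b < b' \<Longrightarrow> (norm (h b' - h b))\<^sup>2 \<le> \<kappa> b' - \<kappa> b"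
    and bdd: "\<And>b. 0 < b \<Longrightarrow> \<kappa> b \<le> B"
  shows "\<exists>y. (h \<longlongrightarrow> y) at_top"
proof -
  have bddK: "bdd_above (\<kappa> ` {0<..})" using bdd by (auto intro!: bdd_aboveI2[of _ _ B])
  define s where "s = Sup (\<kappa> ` {0<..})"
  have le_s: "\<kappa> b \<le> s" if "0 < b" for b
    unfolding s_def using that bddK by (intro cSup_upper) auto
  have "cauchy_filter (filtermap h at_top)"
    unfolding cauchy_filter_metric_filtermap
  proof (intro allI impI)
    fix e :: real assume e: "e > 0"
    then have "s - e\<^sup>2 < s" by simp
    then obtain b0 where b0: "0 < b0" "s - e\<^sup>2 < \<kappa> b0"
      unfolding s_def using less_cSupE[of "Sup (\<kappa> ` {0<..}) - e\<^sup>2" "\<kappa> ` {0<..}"] by auto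
    have *: "dist (h b) (h b') < e" if b: "b0 < b" "b < b'" for b b'
    proof -
      have "\<kappa> b0 \<le> \<kappa> b" using ctrl[of b0 b] b b0(1) zero_le_power2[of "norm (h b - h b0)"] by linarith
      then have "(norm (h b' - h b))\<^sup>2 < e\<^sup>2"
        using ctrl[of b b'] le_s[of b'] b b0 by linarith
      then have "norm (h b' - h b) < e" using e by (auto intro: power_less_imp_less_base less_imp_le)
      then show ?thesis by (simp add: dist_norm norm_minus_commute)
    qed
    have "dist (h b) (h b') < e" if b: "b0 < b" "b0 < b'" for b b'
      using *[of b b'] *[of b' b] b e by (cases b b' rule: linorder_cases) (auto simp: dist_commute)
    then show "\<exists>P. eventually P at_top \<and> (\<forall>x y. P x \<and> P y \<longrightarrow> dist (h x) (h y) < e)"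
      using eventually_gt_at_top[of b0] by (intro exI[of _ "\<lambda>b. b0 < b"]) auto
  qed
  then have "\<exists>y\<in>UNIV. filtermap h at_top \<le> nhds y"
    using complete_UNIV[where 'a = 'b] trivial_limit_at_top_linorder unfolding complete_uniform
    by (simp add: filtermap_bot_iff)
  then show ?thesis by (auto simp: filterlim_def)
qed

lemma has_RS_integral_line_unique:
  assumes "has_RS_integral_line f \<rho> y" "has_RS_integral_line f \<rho> z"
  shows "y = z"
proof -
  obtain I J where I: "\<And>a b. a < b \<Longrightarrow> has_RS_integral f \<rho> a b (I a b)"
      and Il: "((\<lambda>(a, b). I a b) \<longlongrightarrow> y) (at_bot \<times>\<^sub>F at_top)"
      and J: "\<And>a b. a < b \<Longrightarrow> has_RS_integral f \<rho> a b (J a b)"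
      and Jl: "((\<lambda>(a, b). J a b) \<longlongrightarrow> z) (at_bot \<times>\<^sub>F at_top)"
    using assms unfolding has_RS_integral_line_def by auto
  have "\<forall>\<^sub>F z in at_bot \<times>\<^sub>F at_top. (case z of (a, b) \<Rightarrow> I a b) = (case z of (a, b) \<Rightarrow> J a b)"
    using eventually_improper[of 0 0]
  proof eventually_elim
    case (elim z)
    then show ?case using has_RS_integral_unique[OF I J, of "fst z" "snd z"] by (simp add: case_prod_beta)
  qed
  then have "((\<lambda>(a, b). J a b) \<longlongrightarrow> y) (at_bot \<times>\<^sub>F at_top)"
    by (rule Lim_transform_eventually[OF Il])
  then show ?thesis using Jl improper_filter_neq_bot tendsto_unique by blast
qed

text \<open>As \<open>sqrt\<close> is an odd function, it is the signed root that occurs in the form value. For arguments of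
  the same sign the factor \<open>2\<close> could be \<open>1\<close>.\<close>

lemma sqrt_diff_square_le: "(sqrt u - sqrt v)\<^sup>2 \<le> 2 * \<bar>u - v\<bar>"
proof -
  have pos: "(sqrt a - sqrt b)\<^sup>2 \<le> \<bar>a - b\<bar>" if "0 \<le> a" "0 \<le> b" for a b
  proof -
    have "\<bar>sqrt a - sqrt b\<bar> \<le> \<bar>sqrt a + sqrt b\<bar>" using that by (simp add: abs_le_iff)
    then have "\<bar>sqrt a - sqrt b\<bar> * \<bar>sqrt a - sqrt b\<bar> \<le> \<bar>sqrt a - sqrt b\<bar> * \<bar>sqrt a + sqrt b\<bar>"
      by (intro mult_left_mono) auto
    also have "\<dots> = \<bar>(sqrt a - sqrt b) * (sqrt a + sqrt b)\<bar>" by (simp only: abs_mult)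
    also have "(sqrt a - sqrt b) * (sqrt a + sqrt b) = a - b" using that by (simp add: algebra_simps)
    finally show ?thesis by (simp add: power2_eq_square abs_mult_self_eq)
  qed
  have mixed: "(sqrt a + sqrt b)\<^sup>2 \<le> 2 * (a + b)" if "0 \<le> a" "0 \<le> b" for a b
    using zero_le_power2[of "sqrt a - sqrt b"] that by (simp add: power2_sum power2_diff)
  consider "0 \<le> u" "0 \<le> v" | "u \<le> 0" "v \<le> 0" | "0 \<le> u" "v \<le> 0" | "u \<le> 0" "0 \<le> v" by linarith
  then show ?thesis
  proof cases
    case 1
    then show ?thesis by (intro order_trans[OF pos[OF 1]]) simp
  next
    case 2
    then have "(sqrt u - sqrt v)\<^sup>2 \<le> \<bar>u - v\<bar>"
      using pos[of "- u" "- v"] by (simp add: real_sqrt_minus power2_commute abs_minus_commute)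
    then show ?thesis by (rule order_trans) simp
  next
    case 3
    then show ?thesis using mixed[of u "- v"] by (simp add: real_sqrt_minus)
  next
    case 4
    then have "(sqrt u - sqrt v)\<^sup>2 = (sqrt (- u) + sqrt v)\<^sup>2"
      by (simp add: real_sqrt_minus power2_commute)
    then show ?thesis using mixed[of "- u" v] 4 by simp
  qed
qed

lemma sgn_sqrt_abs: "sgn u * sqrt \<bar>u\<bar> = sqrt u"
  by (cases "u \<ge> 0") (auto simp: sgn_if real_sqrt_minus)

lemma sqrt_abs_diff_square_le: "(sqrt \<bar>u\<bar> - sqrt \<bar>v\<bar>)\<^sup>2 \<le> 2 * \<bar>u - v\<bar>"
  using sqrt_diff_square_le[of "\<bar>u\<bar>" "\<bar>v\<bar>"] abs_triangle_ineq3[of u v] by linarith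

context spectral
begin

lemma operator_function_eq:
  "has_RS_integral_line g (\<lambda>t. E t x) y \<Longrightarrow> operator_function g E x = y"
  unfolding operator_function_def using has_RS_integral_line_unique by blast

lemma norm_integral_le:
  assumes I: "has_RS_integral g (\<lambda>t. E t x) a b I" and J: "has_RS_integral (\<lambda>t. t\<^sup>2) (distr x) a b J"
    and ab: "a < b" and g: "\<And>t. (g t)\<^sup>2 \<le> \<alpha> + \<beta> * t\<^sup>2"
  shows "(norm I)\<^sup>2 \<le> \<alpha> * (distr x b - distr x a) + \<beta> * J"
proof (rule tendsto_le)
  show "refining a b \<noteq> bot" using refining_neq_bot[OF ab] .
  show "((\<lambda>p. (norm (E_sum g x p))\<^sup>2) \<longlongrightarrow> (norm I)\<^sup>2) (refining a b)"
    using I unfolding has_RS_integral_iff by (intro tendsto_intros)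
  show "((\<lambda>p. \<alpha> * (distr x b - distr x a) + \<beta> * RS_sum (\<lambda>t. t\<^sup>2) (distr x) p)
      \<longlongrightarrow> \<alpha> * (distr x b - distr x a) + \<beta> * J) (refining a b)"
    using J unfolding has_RS_integral_iff by (intro tendsto_intros)
  show "\<forall>\<^sub>F p in refining a b. (norm (E_sum g x p))\<^sup>2
      \<le> \<alpha> * (distr x b - distr x a) + \<beta> * RS_sum (\<lambda>t. t\<^sup>2) (distr x) p"
    using eventually_tagged_one[of a b]
  proof eventually_elim
    case (elim p)
    obtain n t \<xi> where p: "p = (n, t, \<xi>)" by (cases p)
    note T = elim[unfolded p]
    let ?\<Delta> = "\<lambda>k. distr x (t (Suc k)) - distr x (t k)"
    have "(norm (E_sum g x p))\<^sup>2 = (\<Sum>k<n. (g (\<xi> k))\<^sup>2 * ?\<Delta> k)"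
      unfolding norm_E_sum[OF elim] by (simp add: p RS_sum_def)
    also have "\<dots> \<le> (\<Sum>k<n. (\<alpha> + \<beta> * (\<xi> k)\<^sup>2) * ?\<Delta> k)"
      using monoD[OF mono_distr less_imp_le[OF tagged_cell(1)[OF T]]]
      by (intro sum_mono mult_right_mono g) auto
    also have "\<dots> = \<alpha> * (\<Sum>k<n. ?\<Delta> k) + \<beta> * (\<Sum>k<n. (\<xi> k)\<^sup>2 * ?\<Delta> k)"
      by (simp add: sum.distrib sum_distrib_left distrib_right mult.assoc)
    also have "(\<Sum>k<n. ?\<Delta> k) = distr x b - distr x a"
      using sum_lessThan_telescope[of "\<lambda>k. distr x (t k)" n] tagged_ends[OF T] by simp
    finally show ?case by (simp add: p RS_sum_def)
  qed
qed

lemma integral_nonneg: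
  assumes J: "has_RS_integral (\<lambda>t. t\<^sup>2) (distr x) a b J" and ab: "a < b"
  shows "0 \<le> J"
proof (rule tendsto_lowerbound)
  show "refining a b \<noteq> bot" using refining_neq_bot[OF ab] .
  show "(RS_sum (\<lambda>t. t\<^sup>2) (distr x) \<longlongrightarrow> J) (refining a b)"
    using J unfolding has_RS_integral_iff .
  show "\<forall>\<^sub>F p in refining a b. 0 \<le> RS_sum (\<lambda>t. t\<^sup>2) (distr x) p"
    using eventually_tagged_one[of a b]
  proof eventually_elim
    case (elim p)
    have "RS_sum (\<lambda>t. t\<^sup>2) (distr x) p = (norm (E_sum (\<lambda>t. t) x p))\<^sup>2"
      using norm_E_sum[OF elim, of "\<lambda>t. t" x] by simp
    then show ?case by simp
  qed
qed

lemma distr_bounds: "0 \<le> distr x t" "distr x t \<le> (norm x)\<^sup>2"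
  using norm_E_le[of t x] by (auto simp: distr_def intro: power_mono)

text \<open>The square norm of an integral over \<open>(b, b')\<close> is at most the increment of a monotone function
  which is bounded because \<open>x\<close> lies in the domain.\<close>

lemma improper_integral_exists:
  assumes x: "x \<in> D" and I: "\<And>a b. a < b \<Longrightarrow> \<exists>I. has_RS_integral g (\<lambda>t. E t x) a b I"
    and g: "\<And>t. (g t)\<^sup>2 \<le> \<alpha> + \<beta> * t\<^sup>2" and \<alpha>: "\<alpha> > 0" "\<beta> > 0"
  shows "\<exists>y. has_RS_integral_line g (\<lambda>t. E t x) y"
proof -
  have "\<forall>a b. \<exists>J. a < b \<longrightarrow> has_RS_integral g (\<lambda>t. E t x) a b J" using I by blast
  then obtain I where I: "\<And>a b. a < b \<Longrightarrow> has_RS_integral g (\<lambda>t. E t x) a b (I a b)" by metis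
  have "\<exists>c. has_RS_integral_line (\<lambda>t. t\<^sup>2) (distr x) c" using x D_eq unfolding distr_eq by blast
  then obtain J c where J: "\<And>a b. a < b \<Longrightarrow> has_RS_integral (\<lambda>t. t\<^sup>2) (distr x) a b (J a b)"
      and lim: "((\<lambda>(a, b). J a b) \<longlongrightarrow> c) (at_bot \<times>\<^sub>F at_top)"
    unfolding has_RS_integral_line_def by blast
  have Iadd: "I a b = I a m + I m b" if "a < m" "m < b" for a m b
    using that by (intro has_RS_integral_combine[OF I I I]) auto
  have Jadd: "J a b = J a m + J m b" if "a < m" "m < b" for a m b
    using that by (intro has_RS_integral_combine[OF J J J]) auto
  have J0: "0 \<le> J a b" if "a < b" for a b using integral_nonneg[OF J[OF that] that] .
  have bound: "(norm (I a b))\<^sup>2 \<le> \<alpha> * (distr x b - distr x a) + \<beta> * J a b" if "a < b" for a b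
    by (rule norm_integral_le[OF I[OF that] J[OF that] that g])
  have Jle: "J a b \<le> c + 1" if "a < b" for a b
  proof -
    have "\<forall>\<^sub>F z in at_bot \<times>\<^sub>F at_top. (case z of (a, b) \<Rightarrow> J a b) < c + 1"
      by (rule order_tendstoD(2)[OF lim]) simp
    then have "\<forall>\<^sub>F z in at_bot \<times>\<^sub>F at_top. J (fst z) (snd z) < c + 1 \<and> fst z < a \<and> b < snd z"
      using eventually_improper[of a b] by eventually_elim (simp add: case_prod_beta)
    then obtain z where z: "J (fst z) (snd z) < c + 1" "fst z < a" "b < snd z"
      using eventually_happens' improper_filter_neq_bot by blast
    have "J (fst z) (snd z) = J (fst z) a + (J a b + J b (snd z))"
      using z that Jadd[of "fst z" a "snd z"] Jadd[of a b "snd z"] by simp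
    then show ?thesis using z J0[of "fst z" a] J0[of b "snd z"] by linarith
  qed
  have "\<exists>y. ((\<lambda>b. I 0 b) \<longlongrightarrow> y) at_top"
  proof (rule controlled_limit_at_top)
    fix b b' :: real assume b: "0 < b" "b < b'"
    have "I 0 b' - I 0 b = I b b'" using Iadd[OF b] by simp
    then show "(norm (I 0 b' - I 0 b))\<^sup>2 \<le> (\<alpha> * distr x b' + \<beta> * J 0 b') - (\<alpha> * distr x b + \<beta> * J 0 b)"
      using bound[OF b(2)] Jadd[OF b] by (simp add: algebra_simps)
  next
    fix b :: real assume b: "0 < b"
    show "\<alpha> * distr x b + \<beta> * J 0 b \<le> \<alpha> * (norm x)\<^sup>2 + \<beta> * (c + 1)"
      using Jle[OF b] distr_bounds[of x b] \<alpha> by (intro add_mono mult_left_mono) auto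
  qed
  then obtain y1 where y1: "((\<lambda>b. I 0 b) \<longlongrightarrow> y1) at_top" by blast
  have "\<exists>y. ((\<lambda>a. I (- a) 0) \<longlongrightarrow> y) at_top"
  proof (rule controlled_limit_at_top)
    fix b b' :: real assume b: "0 < b" "b < b'"
    then have b': "- b' < - b" "- b < 0" by auto
    have "I (- b') 0 - I (- b) 0 = I (- b') (- b)" using Iadd[OF b'] by simp
    then show "(norm (I (- b') 0 - I (- b) 0))\<^sup>2
        \<le> (- \<alpha> * distr x (- b') + \<beta> * J (- b') 0) - (- \<alpha> * distr x (- b) + \<beta> * J (- b) 0)"
      using bound[OF b'(1)] Jadd[OF b'] by (simp add: algebra_simps)
  next
    fix b :: real assume b: "0 < b"
    then have "\<beta> * J (- b) 0 \<le> \<beta> * (c + 1)" using Jle[of "- b" 0] \<alpha> by (intro mult_left_mono) auto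
    moreover have "0 \<le> \<alpha> * distr x (- b)" using distr_bounds[of x "- b"] \<alpha> by simp
    ultimately show "- \<alpha> * distr x (- b) + \<beta> * J (- b) 0 \<le> \<beta> * (c + 1)" by simp
  qed
  then obtain y2 where y2: "((\<lambda>a. I (- a) 0) \<longlongrightarrow> y2) at_top" by blast
  have "((\<lambda>a. I (- (- a)) 0) \<longlongrightarrow> y2) at_bot"
    using filterlim_compose[OF y2 filterlim_uminus_at_top_at_bot] .
  then have y2': "((\<lambda>a. I a 0) \<longlongrightarrow> y2) at_bot" by simp
  have "((\<lambda>z. I (fst z) 0 + I 0 (snd z)) \<longlongrightarrow> y2 + y1) (at_bot \<times>\<^sub>F at_top)"
    by (rule tendsto_add[OF filterlim_compose[OF y2' filterlim_fst] filterlim_compose[OF y1 filterlim_snd]])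
  moreover have "\<forall>\<^sub>F z in at_bot \<times>\<^sub>F at_top. I (fst z) 0 + I 0 (snd z) = (case z of (a, b) \<Rightarrow> I a b)"
    using eventually_improper[of 0 0]
  proof eventually_elim
    case (elim z)
    then show ?case using Iadd[of "fst z" 0 "snd z"] by (simp add: case_prod_beta)
  qed
  ultimately have "((\<lambda>(a, b). I a b) \<longlongrightarrow> y2 + y1) (at_bot \<times>\<^sub>F at_top)"
    by (rule Lim_transform_eventually)
  then have "has_RS_integral_line g (\<lambda>t. E t x) (y2 + y1)"
    unfolding has_RS_integral_line_def using I by blast
  then show ?thesis by blast
qed

lemma line_integral_add:
  assumes "has_RS_integral_line g (\<lambda>t. E t x) y" "has_RS_integral_line g (\<lambda>t. E t x') y'"
  shows "has_RS_integral_line g (\<lambda>t. E t (x + x')) (y + y')"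
proof -
  obtain I J where I: "\<And>a b. a < b \<Longrightarrow> has_RS_integral g (\<lambda>t. E t x) a b (I a b)"
      and Il: "((\<lambda>(a, b). I a b) \<longlongrightarrow> y) (at_bot \<times>\<^sub>F at_top)"
      and J: "\<And>a b. a < b \<Longrightarrow> has_RS_integral g (\<lambda>t. E t x') a b (J a b)"
      and Jl: "((\<lambda>(a, b). J a b) \<longlongrightarrow> y') (at_bot \<times>\<^sub>F at_top)"
    using assms unfolding has_RS_integral_line_def by auto
  have s: "E_sum g (x + x') = (\<lambda>p. E_sum g x p + E_sum g x' p)"
    by (auto simp: fun_eq_iff E_sum_eq band_add scaleR_add_right sum.distrib)
  have "has_RS_integral g (\<lambda>t. E t (x + x')) a b (I a b + J a b)" if "a < b" for a b
    using tendsto_add[OF I[OF that, unfolded has_RS_integral_iff] J[OF that, unfolded has_RS_integral_iff]]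
    unfolding has_RS_integral_iff s .
  moreover have "((\<lambda>(a, b). I a b + J a b) \<longlongrightarrow> y + y') (at_bot \<times>\<^sub>F at_top)"
    using tendsto_add[OF Il Jl] by (simp add: split_def)
  ultimately show ?thesis
    unfolding has_RS_integral_line_def by (intro exI[of _ "\<lambda>a b. I a b + J a b"]) simp
qed

lemma line_integral_scaleC:
  assumes "has_RS_integral_line g (\<lambda>t. E t x) y"
  shows "has_RS_integral_line g (\<lambda>t. E t (c *\<^sub>C x)) (c *\<^sub>C y)"
proof -
  obtain I where I: "\<And>a b. a < b \<Longrightarrow> has_RS_integral g (\<lambda>t. E t x) a b (I a b)"
      and Il: "((\<lambda>(a, b). I a b) \<longlongrightarrow> y) (at_bot \<times>\<^sub>F at_top)"
    using assms unfolding has_RS_integral_line_def by auto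
  note lin = bounded_linear.tendsto[OF bounded_linear_scaleC]
  have s: "E_sum g (c *\<^sub>C x) = (\<lambda>p. c *\<^sub>C E_sum g x p)"
    by (auto simp: fun_eq_iff RS_sum_def E_scaleC scaleC_sum_right scaleC_diff_right
        scaleR_eq_scaleC scaleC_scaleC mult.commute)
  have "has_RS_integral g (\<lambda>t. E t (c *\<^sub>C x)) a b (c *\<^sub>C I a b)" if "a < b" for a b
    using lin[OF I[OF that, unfolded has_RS_integral_iff]] unfolding has_RS_integral_iff s .
  moreover have "((\<lambda>(a, b). c *\<^sub>C I a b) \<longlongrightarrow> c *\<^sub>C y) (at_bot \<times>\<^sub>F at_top)"
    using lin[OF Il] by (simp add: split_def)
  ultimately show ?thesis
    unfolding has_RS_integral_line_def by (intro exI[of _ "\<lambda>a b. c *\<^sub>C I a b"]) simp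
qed

definition form_domain :: "(real \<Rightarrow> real) \<Rightarrow> 'a set" where
  "form_domain f = {x. (\<exists>y. has_RS_integral_line (\<lambda>t. sgn (f t) * sqrt \<bar>f t\<bar>) (\<lambda>t. E t x) y) \<and>
     (\<exists>y. has_RS_integral_line (\<lambda>t. sqrt \<bar>f t\<bar>) (\<lambda>t. E t x) y)}"

lemma form_value_sesquilinear:
  assumes "x \<in> form_domain f" "y \<in> form_domain f" "z \<in> form_domain f"
  shows "form_value f E (x + y) z = form_value f E x z + form_value f E y z"
    "form_value f E z (x + y) = form_value f E z x + form_value f E z y"
    "form_value f E (c *\<^sub>C x) z = cnj c * form_value f E x z"
    "form_value f E z (c *\<^sub>C x) = c * form_value f E z x"
proof -
  let ?g = "\<lambda>t. sgn (f t) * sqrt \<bar>f t\<bar>" and ?h = "\<lambda>t. sqrt \<bar>f t\<bar>"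
  obtain x1 x2 y1 y2 z1 z2 where i:
      "has_RS_integral_line ?g (\<lambda>t. E t x) x1" "has_RS_integral_line ?h (\<lambda>t. E t x) x2"
      "has_RS_integral_line ?g (\<lambda>t. E t y) y1" "has_RS_integral_line ?h (\<lambda>t. E t y) y2"
      "has_RS_integral_line ?g (\<lambda>t. E t z) z1" "has_RS_integral_line ?h (\<lambda>t. E t z) z2"
    using assms unfolding form_domain_def by blast
  note o = i[THEN operator_function_eq]
    line_integral_add[OF i(1) i(3), THEN operator_function_eq]
    line_integral_add[OF i(2) i(4), THEN operator_function_eq]
    line_integral_scaleC[OF i(1), THEN operator_function_eq]
    line_integral_scaleC[OF i(2), THEN operator_function_eq]
  show "form_value f E (x + y) z = form_value f E x z + form_value f E y z"
    "form_value f E z (x + y) = form_value f E z x + form_value f E z y"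
    "form_value f E (c *\<^sub>C x) z = cnj c * form_value f E x z"
    "form_value f E z (c *\<^sub>C x) = c * form_value f E z x"
    unfolding form_value_def o
    by (rule cinner_add_left cinner_add_right cinner_scaleC_left cinner_scaleC_right)+
qed

text \<open>The two factors are integrals of the roots of \<open>f\<close>. The roots oscillate, in the mean square, no more
  than \<open>f\<close> does, and they are linearly bounded; so both integrals exist, and their inner product is the
  integral of the product of the roots, which is \<open>f\<close>.\<close>

lemma form_value_integral:
  assumes x: "x \<in> D" and osc: "\<And>a b. a < b \<Longrightarrow> small_oscillation f (distr x) a b"
    and f: "\<alpha> > 0" "\<beta> > 0" "\<And>t. \<bar>f t\<bar> \<le> \<alpha> + \<beta> * t\<^sup>2"
  shows "x \<in> form_domain f"
    and "\<exists>L. (\<forall>a b. a < b \<longrightarrow> has_RS_integral f (distr x) a b (L a b)) \<and>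
        ((\<lambda>(a, b). L a b) \<longlongrightarrow> Re (form_value f E x x)) (at_bot \<times>\<^sub>F at_top)"
    and "Im (form_value f E x x) = 0"
proof -
  let ?g = "\<lambda>t. sgn (f t) * sqrt \<bar>f t\<bar>" and ?h = "\<lambda>t. sqrt \<bar>f t\<bar>"
  have g: "(?g y - ?g z)\<^sup>2 \<le> 2 * \<bar>f y - f z\<bar>" and h: "(?h y - ?h z)\<^sup>2 \<le> 2 * \<bar>f y - f z\<bar>" for y z
    unfolding sgn_sqrt_abs by (rule sqrt_diff_square_le sqrt_abs_diff_square_le)+
  have "\<exists>I. has_RS_integral ?g (\<lambda>t. E t x) a b I" "\<exists>I. has_RS_integral ?h (\<lambda>t. E t x) a b I"
    if "a < b" for a b
    by (rule vector_integral_exists[OF that osc[OF that], of 2], simp, rule g)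
      (rule vector_integral_exists[OF that osc[OF that], of 2], simp, rule h)
  note ex = this
  have g2: "(?g t)\<^sup>2 \<le> \<alpha> + \<beta> * t\<^sup>2" and h2: "(?h t)\<^sup>2 \<le> \<alpha> + \<beta> * t\<^sup>2" for t
    using f(3)[of t] f(1,2) by (auto simp: power_mult_distrib sgn_if)
  obtain y1 where y1: "has_RS_integral_line ?g (\<lambda>t. E t x) y1"
    using improper_integral_exists[OF x ex(1) g2 f(1,2)] by blast
  obtain y2 where y2: "has_RS_integral_line ?h (\<lambda>t. E t x) y2"
    using improper_integral_exists[OF x ex(2) h2 f(1,2)] by blast
  show "x \<in> form_domain f" unfolding form_domain_def using y1 y2 by blast
  have v: "form_value f E x x = cinner y1 y2"
    unfolding form_value_def operator_function_eq[OF y1] operator_function_eq[OF y2] ..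
  obtain I J where I: "\<And>a b. a < b \<Longrightarrow> has_RS_integral ?g (\<lambda>t. E t x) a b (I a b)"
      and Il: "((\<lambda>(a, b). I a b) \<longlongrightarrow> y1) (at_bot \<times>\<^sub>F at_top)"
      and J: "\<And>a b. a < b \<Longrightarrow> has_RS_integral ?h (\<lambda>t. E t x) a b (J a b)"
      and Jl: "((\<lambda>(a, b). J a b) \<longlongrightarrow> y2) (at_bot \<times>\<^sub>F at_top)"
    using y1 y2 unfolding has_RS_integral_line_def by auto
  have gh: "(\<lambda>t. ?g t * ?h t) = f" by (auto simp: fun_eq_iff sgn_mult_abs mult.assoc)
  have "has_RS_integral f (distr x) a b (Re (cinner (I a b) (J a b)))" if "a < b" for a b
    using scalar_integral_of_products[OF I[OF that] J[OF that]] unfolding gh .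
  moreover have lim: "((\<lambda>(a, b). cinner (I a b) (J a b)) \<longlongrightarrow> cinner y1 y2) (at_bot \<times>\<^sub>F at_top)"
    using tendsto_cinner[OF Il Jl] by (simp add: split_def)
  then have "((\<lambda>(a, b). Re (cinner (I a b) (J a b))) \<longlongrightarrow> Re (cinner y1 y2)) (at_bot \<times>\<^sub>F at_top)"
    using tendsto_Re[OF lim] by (simp add: split_def)
  ultimately show "\<exists>L. (\<forall>a b. a < b \<longrightarrow> has_RS_integral f (distr x) a b (L a b)) \<and>
      ((\<lambda>(a, b). L a b) \<longlongrightarrow> Re (form_value f E x x)) (at_bot \<times>\<^sub>F at_top)"
    unfolding v by (intro exI[of _ "\<lambda>a b. Re (cinner (I a b) (J a b))"]) simp
  have "\<forall>\<^sub>F z in at_bot \<times>\<^sub>F at_top. 0 = Im (case z of (a, b) \<Rightarrow> cinner (I a b) (J a b))"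
    using eventually_improper[of 0 0]
  proof eventually_elim
    case (elim z)
    then show ?case using cinner_integrals_real[OF I J, of "fst z" "snd z"] by (simp add: case_prod_beta)
  qed
  then have "((\<lambda>z. Im (case z of (a, b) \<Rightarrow> cinner (I a b) (J a b))) \<longlongrightarrow> 0) (at_bot \<times>\<^sub>F at_top)"
    by (rule Lim_transform_eventually[OF tendsto_const])
  then show "Im (form_value f E x x) = 0"
    unfolding v using tendsto_unique[OF improper_filter_neq_bot _ tendsto_Im[OF lim]] by metis
qed

end

definition sesquilinear_on :: "'a::complex_hilbert_space set \<Rightarrow> ('a \<Rightarrow> 'a \<Rightarrow> complex) \<Rightarrow> bool" where
  "sesquilinear_on V B \<longleftrightarrow> (\<forall>x\<in>V. \<forall>y\<in>V. \<forall>z\<in>V. \<forall>c.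
     B (x + y) z = B x z + B y z \<and> B z (x + y) = B z x + B z y \<and>
     B (c *\<^sub>C x) z = cnj c * B x z \<and> B z (c *\<^sub>C x) = c * B z x)"

text \<open>Since \<open>Q c = B u u + c * B u v + cnj c * B v u + cnj c * c * B v v\<close>, four unit scalars isolate
  \<open>B u v\<close>.\<close>

lemma polarization:
  assumes B: "sesquilinear_on V B" and V: "\<And>c x. x \<in> V \<Longrightarrow> c *\<^sub>C x \<in> V" "\<And>x y. x \<in> V \<Longrightarrow> y \<in> V \<Longrightarrow> x + y \<in> V"
    and uv: "u \<in> V" "v \<in> V"
  defines "Q \<equiv> \<lambda>c. B (u + c *\<^sub>C v) (u + c *\<^sub>C v)"
  shows "4 * B u v = Q 1 - Q (-1) - \<i> * Q \<i> + \<i> * Q (-\<i>)"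
proof -
  have e: "Q c = B u u + c * B u v + cnj c * B v u + cnj c * c * B v v" for c
  proof -
    have cv: "c *\<^sub>C v \<in> V" "u + c *\<^sub>C v \<in> V" using V uv by auto
    have "Q c = B u (u + c *\<^sub>C v) + cnj c * B v (u + c *\<^sub>C v)"
      using B cv uv unfolding Q_def sesquilinear_on_def by (simp add: algebra_simps)
    moreover have "B z (u + c *\<^sub>C v) = B z u + c * B z v" if "z \<in> V" for z
      using B cv uv that unfolding sesquilinear_on_def by simp
    ultimately show ?thesis using uv by (simp add: algebra_simps)
  qed
  show ?thesis unfolding e by (simp add: algebra_simps)
qed

lemma polarization_limit:
  assumes Bn: "\<And>n. sesquilinear_on V (B n)" and B: "sesquilinear_on V L"
    and V: "\<And>c x. x \<in> V \<Longrightarrow> c *\<^sub>C x \<in> V" "\<And>x y. x \<in> V \<Longrightarrow> y \<in> V \<Longrightarrow> x + y \<in> V"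
    and lim: "\<And>x. x \<in> V \<Longrightarrow> (\<lambda>n. B n x x) \<longlonglongrightarrow> L x x" and uv: "u \<in> V" "v \<in> V"
  shows "(\<lambda>n. B n u v) \<longlonglongrightarrow> L u v"
proof -
  define Q where "Q n c = B n (u + c *\<^sub>C v) (u + c *\<^sub>C v)" for n c
  define R where "R c = L (u + c *\<^sub>C v) (u + c *\<^sub>C v)" for c
  have q: "(\<lambda>n. Q n c) \<longlonglongrightarrow> R c" for c
    unfolding Q_def R_def using V uv by (intro lim) auto
  have "4 * B n u v = Q n 1 - Q n (-1) - \<i> * Q n \<i> + \<i> * Q n (-\<i>)" for n
    unfolding Q_def by (rule polarization[OF Bn V uv])
  moreover have "4 * L u v = R 1 - R (-1) - \<i> * R \<i> + \<i> * R (-\<i>)"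
    unfolding R_def by (rule polarization[OF B V uv])
  moreover have "(\<lambda>n. Q n 1 - Q n (-1) - \<i> * Q n \<i> + \<i> * Q n (-\<i>))
      \<longlonglongrightarrow> R 1 - R (-1) - \<i> * R \<i> + \<i> * R (-\<i>)"
    by (intro tendsto_intros q)
  ultimately have "(\<lambda>n. 4 * B n u v) \<longlonglongrightarrow> 4 * L u v" by simp
  then have l: "(\<lambda>n. (1/4) * (4 * B n u v)) \<longlonglongrightarrow> (1/4) * (4 * L u v)"
    by (rule tendsto_mult[OF tendsto_const])
  have "(1/4) * (4 * z) = z" for z :: complex by simp
  then show ?thesis using l by (simp only:)
qed

section \<open>Square-summable sequences and infinite matrices\<close>

lemma norm_eq_one_if_cinner: "cinner x x = 1 \<Longrightarrow> norm (x :: 'a::complex_hilbert_space) = 1"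
proof -
  assume "cinner x x = 1"
  then have "(norm x)\<^sup>2 = 1\<^sup>2" by (simp add: norm_square_eq)
  then show ?thesis by (rule power2_eq_imp_eq) simp_all
qed

lemma ell2_nth_unit: "ell2_nth (ell2_unit i) k = (if k = i then 1 else 0)"
proof -
  have "summable (\<lambda>k. (cmod (if k = i then 1 else 0))\<^sup>2)"
    by (rule summable_finite[of "{i}"]) auto
  then show ?thesis by (simp add: ell2_unit_def ell2_nth_Abs)
qed

lemma ell2_nth_sum: "ell2_nth (\<Sum>i\<in>I. f i) k = (\<Sum>i\<in>I. ell2_nth (f i) k)"
  by (induction I rule: infinite_finite_induct) (auto simp: ell2_nth_zero ell2_nth_add)

lemma cinner_ell2_finite:
  assumes "\<And>k. k > n \<Longrightarrow> ell2_nth x k = 0 \<or> ell2_nth y k = 0"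
  shows "cinner x y = (\<Sum>k\<le>n. cnj (ell2_nth x k) * ell2_nth y k)"
  unfolding cinner_ell2_def
  by (rule suminf_finite) (use assms in \<open>auto simp: not_le\<close>)

lemma cinner_ell2_unit: "cinner (ell2_unit i) x = ell2_nth x i"
proof -
  have "cinner (ell2_unit i) x = (\<Sum>k\<in>{i}. cnj (ell2_nth (ell2_unit i) k) * ell2_nth x k)"
    unfolding cinner_ell2_def by (rule suminf_finite) (auto simp: ell2_nth_unit)
  then show ?thesis by (simp add: ell2_nth_unit)
qed

lemma cinner_ell2_sums: "(\<lambda>i. cnj (ell2_nth x i) * ell2_nth y i) sums cinner x y"
  unfolding cinner_ell2_def using summable_ell2_prod by (rule summable_sums)

lemma ell2_supported_eq:
  assumes "\<And>k. k \<ge> n \<Longrightarrow> ell2_nth v k = 0"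
  shows "v = (\<Sum>i<n. ell2_nth v i *\<^sub>C ell2_unit i)"
proof (rule ell2_eqI)
  fix k
  have "ell2_nth (\<Sum>i<n. ell2_nth v i *\<^sub>C ell2_unit i) k = (\<Sum>i<n. if i = k then ell2_nth v i else 0)"
    unfolding ell2_nth_sum by (intro sum.cong refl) (auto simp: ell2_nth_scaleC ell2_nth_unit)
  also have "\<dots> = ell2_nth v k" using assms[of k] by (auto simp: not_less)
  finally show "ell2_nth v k = ell2_nth (\<Sum>i<n. ell2_nth v i *\<^sub>C ell2_unit i) k" ..
qed

lemma ell2_fin_iff: "v \<in> ell2_fin \<longleftrightarrow> (\<exists>n. \<forall>k\<ge>n. ell2_nth v k = 0)"
proof
  assume "v \<in> ell2_fin"
  then obtain n c where v: "v = (\<Sum>i<n. c i *\<^sub>C ell2_unit i)" unfolding ell2_fin_def by blast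
  have "ell2_nth v k = 0" if "k \<ge> n" for k
    unfolding v ell2_nth_sum by (rule sum.neutral) (use that in \<open>auto simp: ell2_nth_scaleC ell2_nth_unit\<close>)
  then show "\<exists>n. \<forall>k\<ge>n. ell2_nth v k = 0" by blast
next
  assume "\<exists>n. \<forall>k\<ge>n. ell2_nth v k = 0"
  then obtain n where "\<And>k. k \<ge> n \<Longrightarrow> ell2_nth v k = 0" by blast
  from ell2_supported_eq[of n v, OF this] show "v \<in> ell2_fin" unfolding ell2_fin_def by blast
qed

lemma ell2_fin_scaleC: "v \<in> ell2_fin \<Longrightarrow> c *\<^sub>C v \<in> ell2_fin"
  unfolding ell2_fin_iff by (auto simp: ell2_nth_scaleC)

lemma ell2_fin_add: "v \<in> ell2_fin \<Longrightarrow> w \<in> ell2_fin \<Longrightarrow> v + w \<in> ell2_fin"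
proof -
  assume "v \<in> ell2_fin" "w \<in> ell2_fin"
  then obtain n m where "\<forall>k\<ge>n. ell2_nth v k = 0" "\<forall>k\<ge>m. ell2_nth w k = 0" unfolding ell2_fin_iff by blast
  then have "\<forall>k\<ge>max n m. ell2_nth (v + w) k = 0" by (auto simp: ell2_nth_add)
  then show ?thesis unfolding ell2_fin_iff by blast
qed

lemma ell2_fin_unit: "ell2_unit i \<in> ell2_fin"
  unfolding ell2_fin_iff by (rule exI[of _ "Suc i"]) (auto simp: ell2_nth_unit)

context
  fixes \<phi> :: "nat \<Rightarrow> 'a::complex_hilbert_space"
  assumes \<phi>: "orthonormal_basis \<phi>"
begin

lemma basis_corthonormal: "corthonormal I \<phi>"
  using \<phi> by (auto simp: orthonormal_basis_def corthonormal_def)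

lemma norm_basis: "norm (\<phi> i) = 1"
  using \<phi> by (intro norm_eq_one_if_cinner) (simp add: orthonormal_basis_def)

text \<open>Orthonormality makes the partial sums as Cauchy as those of the series of squares.\<close>

lemma basis_iso_sums: "(\<lambda>i. ell2_nth v i *\<^sub>C \<phi> i) sums basis_iso \<phi> v"
proof -
  let ?S = "\<lambda>n. \<Sum>i<n. ell2_nth v i *\<^sub>C \<phi> i"
  have diff: "(norm (?S m - ?S n))\<^sup>2 = (\<Sum>i\<in>{n..<m}. (cmod (ell2_nth v i))\<^sup>2)" if "n \<le> m" for n m
  proof -
    have "?S m - ?S n = (\<Sum>i\<in>{n..<m}. ell2_nth v i *\<^sub>C \<phi> i)"
      using that by (simp add: lessThan_atLeast0 sum_diff_nat_ivl)
    also have "(norm \<dots>)\<^sup>2 = (\<Sum>i\<in>{n..<m}. (norm (ell2_nth v i *\<^sub>C \<phi> i))\<^sup>2)"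
      using basis_corthonormal[of UNIV]
      by (intro norm_sum_orthogonal) (auto simp: cinner_scaleC_left cinner_scaleC_right corthonormal_def)
    finally show ?thesis by (simp add: norm_scaleC norm_basis)
  qed
  have "Cauchy ?S"
  proof (rule CauchyI)
    fix e :: real assume e: "e > 0"
    have "convergent (\<lambda>n. \<Sum>i<n. (cmod (ell2_nth v i))\<^sup>2)"
      using summable_ell2[of v] by (simp add: summable_iff_convergent)
    then have "Cauchy (\<lambda>n. \<Sum>i<n. (cmod (ell2_nth v i))\<^sup>2)" by (rule convergent_Cauchy)
    then obtain N where N: "\<And>m n. m \<ge> N \<Longrightarrow> n \<ge> N \<Longrightarrow>
        norm ((\<Sum>i<m. (cmod (ell2_nth v i))\<^sup>2) - (\<Sum>i<n. (cmod (ell2_nth v i))\<^sup>2)) < e\<^sup>2"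
      using CauchyD[of "\<lambda>n. \<Sum>i<n. (cmod (ell2_nth v i))\<^sup>2" "e\<^sup>2"] e by auto
    have *: "norm (?S m - ?S n) < e" if "n \<ge> N" "n \<le> m" for m n
    proof -
      have "(\<Sum>i<m. (cmod (ell2_nth v i))\<^sup>2) - (\<Sum>i<n. (cmod (ell2_nth v i))\<^sup>2)
          = (\<Sum>i\<in>{n..<m}. (cmod (ell2_nth v i))\<^sup>2)"
        using that by (simp add: lessThan_atLeast0 sum_diff_nat_ivl)
      then have "(norm (?S m - ?S n))\<^sup>2 < e\<^sup>2"
        using N[of m n] that diff[OF that(2)] by (simp add: abs_less_iff)
      then show ?thesis using e by (auto intro: power_less_imp_less_base less_imp_le)
    qed
    have "norm (?S m - ?S n) < e" if "n \<ge> N" "m \<ge> N" for m n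
      using *[of n m] *[of m n] that by (cases "n \<le> m") (auto simp: norm_minus_commute)
    then show "\<exists>N. \<forall>m\<ge>N. \<forall>n\<ge>N. norm (?S m - ?S n) < e" by blast
  qed
  then obtain l where "?S \<longlonglongrightarrow> l" using Cauchy_convergent convergent_def by blast
  then have "(\<lambda>i. ell2_nth v i *\<^sub>C \<phi> i) sums l" by (simp add: sums_def)
  then show ?thesis unfolding basis_iso_def by (rule sums_unique[THEN subst]) fact
qed

lemma cinner_basis_iso: "cinner (\<phi> i) (basis_iso \<phi> v) = ell2_nth v i"
proof -
  have "(\<lambda>j. cinner (\<phi> i) (ell2_nth v j *\<^sub>C \<phi> j)) sums cinner (\<phi> i) (basis_iso \<phi> v)"
    by (rule bounded_linear.sums[OF bounded_bilinear.bounded_linear_right[OF bounded_bilinear_cinner]])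
      (rule basis_iso_sums)
  moreover have "(\<lambda>j. cinner (\<phi> i) (ell2_nth v j *\<^sub>C \<phi> j)) = (\<lambda>j. if j = i then ell2_nth v j else 0)"
    using basis_corthonormal[of UNIV] by (auto simp: cinner_scaleC_right corthonormal_def)
  ultimately show ?thesis using sums_unique2[OF sums_single[of i "ell2_nth v"]] by simp
qed

lemma cinner_iso: "cinner (basis_iso \<phi> v) (basis_iso \<phi> w) = cinner v w"
proof -
  have "(\<lambda>j. cinner (ell2_nth v j *\<^sub>C \<phi> j) (basis_iso \<phi> w)) sums cinner (basis_iso \<phi> v) (basis_iso \<phi> w)"
    by (rule bounded_linear.sums[OF bounded_bilinear.bounded_linear_left[OF bounded_bilinear_cinner]])
      (rule basis_iso_sums)
  then have "(\<lambda>j. cnj (ell2_nth v j) * ell2_nth w j) sums cinner (basis_iso \<phi> v) (basis_iso \<phi> w)"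
    by (simp add: cinner_scaleC_left cinner_basis_iso)
  then show ?thesis using cinner_ell2_sums sums_unique2 by blast
qed

lemma norm_iso: "norm (basis_iso \<phi> v) = norm v"
proof -
  have "complex_of_real ((norm (basis_iso \<phi> v))\<^sup>2) = of_real ((norm v)\<^sup>2)"
    using cinner_iso[of v v] unfolding cinner_self .
  then have "(norm (basis_iso \<phi> v))\<^sup>2 = (norm v)\<^sup>2" using of_real_eq_iff by blast
  then show ?thesis by simp
qed

lemma basis_iso_diff: "basis_iso \<phi> (v - w) = basis_iso \<phi> v - basis_iso \<phi> w"
proof -
  have "(\<lambda>i. ell2_nth v i *\<^sub>C \<phi> i - ell2_nth w i *\<^sub>C \<phi> i) sums (basis_iso \<phi> v - basis_iso \<phi> w)"
    by (intro sums_diff basis_iso_sums)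
  moreover have "a *\<^sub>C x - b *\<^sub>C x = (a - b) *\<^sub>C x" for a b and x :: 'a
    using scaleC_add_left[of "a - b" b x] by simp
  ultimately show ?thesis using basis_iso_sums[of "v - w"] sums_unique2 by (simp add: ell2_nth_minus)
qed

end

lemma self_adjoint_operatorD:
  assumes "self_adjoint_operator D A"
  shows "0 \<in> D" and "x \<in> D \<Longrightarrow> y \<in> D \<Longrightarrow> x + y \<in> D" and "x \<in> D \<Longrightarrow> c *\<^sub>C x \<in> D"
    and "x \<in> D \<Longrightarrow> y \<in> D \<Longrightarrow> A (x + y) = A x + A y" and "x \<in> D \<Longrightarrow> A (c *\<^sub>C x) = c *\<^sub>C A x"
    and "x \<in> D \<Longrightarrow> y \<in> D \<Longrightarrow> cinner x (A y) = cinner (A x) y"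
proof -
  have 1: "\<forall>x\<in>D. \<forall>y\<in>D. A (x + y) = A x + A y" and 2: "\<forall>c. \<forall>x\<in>D. A (c *\<^sub>C x) = c *\<^sub>C A x"
    and 3: "\<forall>x\<in>D. \<forall>y\<in>D. x + y \<in> D" and 4: "\<forall>c. \<forall>x\<in>D. c *\<^sub>C x \<in> D" and 5: "0 \<in> D"
    and 6: "\<forall>x\<in>D. \<forall>y\<in>D. cinner x (A y) = cinner (A x) y"
    using assms unfolding self_adjoint_operator_def by - (elim conjE, assumption)+
  show "0 \<in> D" by (rule 5)
  show "x \<in> D \<Longrightarrow> y \<in> D \<Longrightarrow> x + y \<in> D" by (rule 3[rule_format])
  show "x \<in> D \<Longrightarrow> c *\<^sub>C x \<in> D" by (rule 4[rule_format])
  show "x \<in> D \<Longrightarrow> y \<in> D \<Longrightarrow> A (x + y) = A x + A y" by (rule 1[rule_format])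
  show "x \<in> D \<Longrightarrow> A (c *\<^sub>C x) = c *\<^sub>C A x" by (rule 2[rule_format])
  show "x \<in> D \<Longrightarrow> y \<in> D \<Longrightarrow> cinner x (A y) = cinner (A x) y" by (rule 6[rule_format])
qed

text \<open>For each basis vector and each \<open>k\<close>, Bessel's inequality allows at most \<open>k\<close> normalised eigenvectors
  of different eigenvalues whose coefficient at that basis vector has square above \<open>1 / k\<close>.\<close>

lemma countable_eigenvalues:
  fixes D :: "'a::complex_hilbert_space set" and \<phi> :: "nat \<Rightarrow> 'a"
  assumes A: "self_adjoint_operator D A" and \<phi>: "orthonormal_basis \<phi>"
  shows "countable {t. eigenvalue_of D A t}"
proof -
  note sym = self_adjoint_operatorD(6)[OF A] and sc = self_adjoint_operatorD(3,5)[OF A]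
  have "\<forall>t. \<exists>x. eigenvalue_of D A t \<longrightarrow> x \<in> D \<and> norm x = 1 \<and> A x = t *\<^sub>R x"
  proof (intro allI, rule classical)
    fix t assume n: "\<nexists>x. eigenvalue_of D A t \<longrightarrow> x \<in> D \<and> norm x = 1 \<and> A x = t *\<^sub>R x"
    then have "eigenvalue_of D A t" by blast
    then obtain x where x: "x \<in> D" "x \<noteq> 0" "A x = t *\<^sub>R x" unfolding eigenvalue_of_def by blast
    define y where "y = complex_of_real (inverse (norm x)) *\<^sub>C x"
    have "y \<in> D" "A y = t *\<^sub>R y" unfolding y_def using sc[OF x(1)] x(3)
      by (auto simp: scaleR_eq_scaleC scaleC_scaleC mult.commute)
    moreover have "norm y = 1" using x(2) by (simp add: y_def norm_scaleC norm_inverse)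
    ultimately show "\<exists>x. eigenvalue_of D A t \<longrightarrow> x \<in> D \<and> norm x = 1 \<and> A x = t *\<^sub>R x" by blast
  qed
  then obtain e where e: "\<And>t. eigenvalue_of D A t \<Longrightarrow> e t \<in> D \<and> norm (e t) = 1 \<and> A (e t) = t *\<^sub>R e t"
    by metis
  have orth: "corthonormal {t. eigenvalue_of D A t} e"
    unfolding corthonormal_def
  proof (intro ballI)
    fix s t assume st: "s \<in> {t. eigenvalue_of D A t}" "t \<in> {t. eigenvalue_of D A t}"
    show "cinner (e s) (e t) = (if s = t then 1 else 0)"
    proof (cases "s = t")
      case True
      then show ?thesis using st e by (simp add: cinner_self)
    next
      case False
      have "of_real t * cinner (e s) (e t) = of_real s * cinner (e s) (e t)"
        using sym[of "e s" "e t"] e st by (simp add: cinner_scaleR_left cinner_scaleR_right)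
      then show ?thesis using False by simp
    qed
  qed
  define B where "B i k = {t. eigenvalue_of D A t \<and> 1 / real (Suc k) < (cmod (cinner (e t) (\<phi> i)))\<^sup>2}" for i k
  have "finite (B i k)" for i k
  proof (rule finite_if_finite_subsets_card_bdd[of _ "Suc k", THEN conjunct1])
    fix F assume F: "F \<subseteq> B i k" "finite F"
    have n: "norm (\<phi> i) = 1" by (rule norm_basis[OF \<phi>])
    have "real (card F) * (1 / real (Suc k)) = (\<Sum>t\<in>F. 1 / real (Suc k))" by simp
    also have "\<dots> \<le> (\<Sum>t\<in>F. (cmod (cinner (e t) (\<phi> i)))\<^sup>2)"
      using F(1) by (intro sum_mono) (auto simp: B_def less_imp_le)
    also have "\<dots> \<le> (norm (\<phi> i))\<^sup>2"
    proof (rule Bessel_inequality[OF F(2)])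
      show "corthonormal F e" using orth F(1) unfolding corthonormal_def B_def by blast
    qed
    finally have "real (card F) \<le> real (Suc k)" using n by (simp add: field_simps)
    then show "card F \<le> Suc k" by simp
  qed
  moreover have "{t. eigenvalue_of D A t} \<subseteq> (\<Union>i. \<Union>k. B i k)"
  proof
    fix t assume t: "t \<in> {t. eigenvalue_of D A t}"
    have "\<exists>i. cinner (\<phi> i) (e t) \<noteq> 0"
    proof (rule ccontr)
      assume "\<not> ?thesis"
      moreover have "(\<lambda>i. cinner (\<phi> i) (e t) *\<^sub>C \<phi> i) sums e t"
        using \<phi> unfolding orthonormal_basis_def by blast
      ultimately have "(\<lambda>i. 0) sums e t" by (simp add: scaleC_zero_left)
      then have "e t = 0" using sums_unique2 sums_zero by blast
      then show False using e[of t] t by simp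
    qed
    then obtain i where "cinner (e t) (\<phi> i) \<noteq> 0" using cinner_commute by (metis complex_cnj_zero_iff)
    then have "0 < (cmod (cinner (e t) (\<phi> i)))\<^sup>2" by simp
    then obtain k where "inverse (real (Suc k)) < (cmod (cinner (e t) (\<phi> i)))\<^sup>2"
      using reals_Archimedean by blast
    then have "t \<in> B i k" using t by (simp add: B_def inverse_eq_divide)
    then show "t \<in> (\<Union>i. \<Union>k. B i k)" by blast
  qed
  moreover have "countable (\<Union>i. \<Union>k. B i k)"
    using \<open>\<And>i k. finite (B i k)\<close> by (intro countable_UN countable_finite countableI_type)
  ultimately show ?thesis using countable_subset by blast
qed

locale matrix_representation =
  fixes D :: "'a::complex_hilbert_space set" and A :: "'a \<Rightarrow> 'a" and \<phi> :: "nat \<Rightarrow> 'a"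
    and M :: "nat \<Rightarrow> nat \<Rightarrow> complex"
  assumes self_adjoint: "self_adjoint_operator D A"
    and representation: "has_matrix_representation D A \<phi> M"
begin

abbreviation "U \<equiv> basis_iso \<phi>"
abbreviation "DM \<equiv> matrix_domain M"
abbreviation "T \<equiv> matrix_operator M"

lemma
  shows basis: "orthonormal_basis \<phi>" and basis_domain: "\<phi> i \<in> D"
    and entry: "M i j = cinner (\<phi> i) (A (\<phi> j))"
    and matrix_self_adjoint: "self_adjoint_operator DM T"
    and domain_image: "U ` DM = D" and intertwine: "v \<in> DM \<Longrightarrow> U (T v) = A (U v)"
proof -
  have 1: "\<forall>i. \<phi> i \<in> D" and 2: "\<forall>i j. M i j = cinner (\<phi> i) (A (\<phi> j))"
    and 3: "\<forall>v\<in>DM. U (T v) = A (U v)"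
    and 4: "orthonormal_basis \<phi>" and 5: "self_adjoint_operator DM T" and 6: "U ` DM = D"
    using representation unfolding has_matrix_representation_def by - (elim conjE, assumption)+
  show "\<phi> i \<in> D" "M i j = cinner (\<phi> i) (A (\<phi> j))" by (rule 1[rule_format] 2[rule_format])+
  show "orthonormal_basis \<phi>" "self_adjoint_operator DM T" "U ` DM = D" by (rule 4 5 6)+
  show "v \<in> DM \<Longrightarrow> U (T v) = A (U v)" by (rule 3[rule_format])
qed

lemma hermitian: "M i j = cnj (M j i)"
proof -
  have "M i j = cinner (A (\<phi> i)) (\<phi> j)"
    unfolding entry by (intro self_adjoint_operatorD(6)[OF self_adjoint] basis_domain)
  then show ?thesis unfolding entry using cinner_commute by metis
qed

lemma T_nth: "v \<in> DM \<Longrightarrow> ell2_nth (T v) i = (\<Sum>j. M i j * ell2_nth v j)"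
  unfolding matrix_operator_def matrix_domain_def by (subst ell2_nth_Abs) auto

lemmas DM_zero = self_adjoint_operatorD(1)[OF matrix_self_adjoint]
  and DM_add = self_adjoint_operatorD(2)[OF matrix_self_adjoint]
  and DM_scaleC = self_adjoint_operatorD(3)[OF matrix_self_adjoint]
  and T_add = self_adjoint_operatorD(4)[OF matrix_self_adjoint]
  and T_scaleC = self_adjoint_operatorD(5)[OF matrix_self_adjoint]
  and T_sym = self_adjoint_operatorD(6)[OF matrix_self_adjoint]

lemma unit_in_DM: "ell2_unit i \<in> DM"
proof -
  obtain v where v: "v \<in> DM" "\<phi> i = U v" using domain_image basis_domain by blast
  have "v = ell2_unit i"
  proof (rule ell2_eqI)
    fix k
    have "ell2_nth v k = cinner (\<phi> k) (\<phi> i)" unfolding v(2) by (simp add: cinner_basis_iso[OF basis])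
    then show "ell2_nth v k = ell2_nth (ell2_unit i) k"
      using basis by (simp add: orthonormal_basis_def ell2_nth_unit)
  qed
  then show ?thesis using v by simp
qed

lemma T_unit: "ell2_nth (T (ell2_unit j)) i = M i j"
proof -
  have "(\<Sum>k. M i k * ell2_nth (ell2_unit j) k) = (\<Sum>k\<in>{j}. M i k * ell2_nth (ell2_unit j) k)"
    by (rule suminf_finite) (auto simp: ell2_nth_unit)
  then show ?thesis by (simp add: T_nth[OF unit_in_DM] ell2_nth_unit)
qed

lemma DM_sum: "(\<And>i. i \<in> I \<Longrightarrow> f i \<in> DM) \<Longrightarrow> (\<Sum>i\<in>I. f i) \<in> DM"
  by (induction I rule: infinite_finite_induct) (auto intro: DM_zero DM_add)

lemma fin_subset_DM: "ell2_fin \<subseteq> DM"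
  unfolding ell2_fin_def by (auto intro!: DM_sum DM_scaleC unit_in_DM)

text \<open>Testing against the basis vectors determines the adjoint: the matrix operator on its maximal
  domain is the adjoint of its restriction to finite sequences.\<close>

lemma adjoint_on_units:
  assumes "\<And>j. cinner a (ell2_unit j) = cinner b (T (ell2_unit j))"
  shows "b \<in> DM" "T b = a"
proof -
  have s: "(\<lambda>i. M j i * ell2_nth b i) sums ell2_nth a j" for j
  proof -
    have "(\<lambda>i. cnj (ell2_nth b i) * M i j) sums cinner b (T (ell2_unit j))"
      using cinner_ell2_sums[of b "T (ell2_unit j)"] by (simp add: T_unit)
    moreover have "cinner b (T (ell2_unit j)) = cnj (ell2_nth a j)"
      unfolding assms[symmetric] by (metis cinner_commute cinner_ell2_unit)
    ultimately have "(\<lambda>i. cnj (cnj (ell2_nth b i) * M i j)) sums cnj (cnj (ell2_nth a j))"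
      unfolding sums_cnj by simp
    then show ?thesis by (simp add: hermitian[of j] mult.commute)
  qed
  then have "(\<Sum>i. M j i * ell2_nth b i) = ell2_nth a j" for j using sums_unique[OF s[of j]] by simp
  then show b: "b \<in> DM" unfolding matrix_domain_def using s summable_ell2[of a] by (auto intro: sums_summable)
  show "T b = a" by (rule ell2_eqI) (simp add: T_nth[OF b] \<open>\<And>j. (\<Sum>i. M j i * ell2_nth b i) = ell2_nth a j\<close>)
qed

text \<open>Adjoints have closed graphs: the products with the images of the basis vectors pass to the limit.\<close>

lemma T_graph_closed:
  assumes "\<And>n. x n \<in> DM" "x \<longlonglongrightarrow> y" "(\<lambda>n. T (x n)) \<longlonglongrightarrow> z"
  shows "y \<in> DM" "T y = z"
proof -
  have "cinner z (ell2_unit j) = cinner y (T (ell2_unit j))" for j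
  proof (rule LIMSEQ_unique)
    show "(\<lambda>n. cinner (T (x n)) (ell2_unit j)) \<longlonglongrightarrow> cinner z (ell2_unit j)"
      by (intro tendsto_cinner assms tendsto_const)
    have "(\<lambda>n. cinner (x n) (T (ell2_unit j))) \<longlonglongrightarrow> cinner y (T (ell2_unit j))"
      by (intro tendsto_cinner assms tendsto_const)
    then show "(\<lambda>n. cinner (T (x n)) (ell2_unit j)) \<longlonglongrightarrow> cinner y (T (ell2_unit j))"
      by (simp add: T_sym assms(1) unit_in_DM)
  qed
  then show "y \<in> DM" "T y = z" using adjoint_on_units by blast+
qed

text \<open>Split \<open>(x, T x)\<close> into its projection \<open>q\<close> to the closure of the graph over the finite sequences and an
  orthogonal rest. The rest lies in the graph of \<open>T\<close> as well, so it is \<open>(b, T b)\<close>, and orthogonality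
  says \<open>T (T b) = - b\<close>. This is impossible for a symmetric operator unless \<open>b = 0\<close>. Hence the finite
  sequences are a core.\<close>

lemma finite_sequences_core:
  assumes x: "x \<in> DM" and \<epsilon>: "\<epsilon> > 0"
  shows "\<exists>y\<in>ell2_fin. norm (x - y) < \<epsilon> \<and> norm (T x - T y) < \<epsilon>"
proof -
  define S0 where "S0 = (\<lambda>y. (y, T y)) ` ell2_fin"
  define S where "S = closure S0"
  have seq: "p \<in> S \<longleftrightarrow> (\<exists>y. (\<forall>n. y n \<in> ell2_fin) \<and> y \<longlonglongrightarrow> fst p \<and> (\<lambda>n. T (y n)) \<longlonglongrightarrow> snd p)" for p
  proof
    assume "p \<in> S"
    then obtain q where q: "\<And>n. q n \<in> S0" "q \<longlonglongrightarrow> p" unfolding S_def closure_sequential by blast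
    have 1: "(\<lambda>n. fst (q n)) \<longlonglongrightarrow> fst p" "(\<lambda>n. snd (q n)) \<longlonglongrightarrow> snd p"
      using q(2) by (auto intro: tendsto_fst tendsto_snd)
    have "fst (q n) \<in> ell2_fin" "T (fst (q n)) = snd (q n)" for n using q(1)[of n] by (auto simp: S0_def)
    then show "\<exists>y. (\<forall>n. y n \<in> ell2_fin) \<and> y \<longlonglongrightarrow> fst p \<and> (\<lambda>n. T (y n)) \<longlonglongrightarrow> snd p"
      using 1 by (intro exI[of _ "\<lambda>n. fst (q n)"]) simp
  next
    assume "\<exists>y. (\<forall>n. y n \<in> ell2_fin) \<and> y \<longlonglongrightarrow> fst p \<and> (\<lambda>n. T (y n)) \<longlonglongrightarrow> snd p"
    then obtain y where y: "\<And>n. y n \<in> ell2_fin" "y \<longlonglongrightarrow> fst p" "(\<lambda>n. T (y n)) \<longlonglongrightarrow> snd p" by blast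
    have "(\<lambda>n. (y n, T (y n))) \<longlonglongrightarrow> (fst p, snd p)" using y by (intro tendsto_Pair)
    then show "p \<in> S" unfolding S_def closure_sequential
      using y(1) by (intro exI[of _ "\<lambda>n. (y n, T (y n))"]) (auto simp: S0_def)
  qed
  have "\<exists>q\<in>S. \<forall>s\<in>S. inner ((x, T x) - q) s = 0"
  proof (rule orthogonal_projection_exists)
    show "closed S" by (simp add: S_def)
    have T0: "T 0 = 0" using T_scaleC[OF DM_zero, of 0] by (simp add: scaleC_zero_left)
    have "0 \<in> ell2_fin" unfolding ell2_fin_iff by (simp add: ell2_nth_zero)
    then have "0 \<in> S0" unfolding S0_def by (rule rev_image_eqI) (simp add: T0 zero_prod_def)
    then show "0 \<in> S" unfolding S_def using closure_subset by blast
    show "p + q \<in> S" if p: "p \<in> S" and q: "q \<in> S" for p q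
    proof -
      obtain y where y: "\<And>n. y n \<in> ell2_fin" "y \<longlonglongrightarrow> fst p" "(\<lambda>n. T (y n)) \<longlonglongrightarrow> snd p"
        using p unfolding seq by blast
      obtain z where z: "\<And>n. z n \<in> ell2_fin" "z \<longlonglongrightarrow> fst q" "(\<lambda>n. T (z n)) \<longlonglongrightarrow> snd q"
        using q unfolding seq by blast
      have "T (y n + z n) = T (y n) + T (z n)" for n
        using y(1) z(1) fin_subset_DM by (intro T_add) auto
      then show ?thesis unfolding seq
        using y z by (intro exI[of _ "\<lambda>n. y n + z n"]) (auto intro: tendsto_add ell2_fin_add)
    qed
    show "r *\<^sub>R p \<in> S" if p: "p \<in> S" for r p
    proof -
      obtain y where y: "\<And>n. y n \<in> ell2_fin" "y \<longlonglongrightarrow> fst p" "(\<lambda>n. T (y n)) \<longlonglongrightarrow> snd p"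
        using p unfolding seq by blast
      have fin: "r *\<^sub>R y n \<in> ell2_fin" for n unfolding scaleR_eq_scaleC by (intro ell2_fin_scaleC y(1))
      have "T (r *\<^sub>R y n) = r *\<^sub>R T (y n)" for n
        using y(1) fin_subset_DM unfolding scaleR_eq_scaleC by (intro T_scaleC) auto
      then show ?thesis unfolding seq
        using y by (intro exI[of _ "\<lambda>n. r *\<^sub>R y n"])
          (auto intro: tendsto_scaleR simp: fin)
    qed
  qed
  then obtain q where q: "q \<in> S" "\<And>s. s \<in> S \<Longrightarrow> inner ((x, T x) - q) s = 0" by blast
  obtain y where y: "\<And>n. y n \<in> ell2_fin" "y \<longlonglongrightarrow> fst q" "(\<lambda>n. T (y n)) \<longlonglongrightarrow> snd q"
    using q(1) unfolding seq by blast
  have qD: "fst q \<in> DM" "T (fst q) = snd q"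
    using T_graph_closed[OF _ y(2,3)] y(1) fin_subset_DM by blast+
  define b where "b = x - fst q"
  have nq: "- fst q \<in> DM" "T (- fst q) = - snd q"
    using DM_scaleC[OF qD(1), of "-1"] T_scaleC[OF qD(1), of "-1"] qD(2) by (simp_all add: scaleC_minus_one)
  have b: "b \<in> DM" "T b = T x - snd q"
    using DM_add[OF x nq(1)] T_add[OF x nq(1)] nq(2) by (simp_all add: b_def)
  have Re0: "Re (cinner b s + cinner (T b) (T s)) = 0" if "s \<in> ell2_fin" for s
  proof -
    have "(s, T s) \<in> S0" unfolding S0_def using that by blast
    then have "(s, T s) \<in> S" unfolding S_def using closure_subset by blast
    moreover have "(x, T x) - q = (b, T b)" unfolding b(2) by (simp add: b_def minus_prod_def)
    ultimately have "inner (b, T b) (s, T s) = 0" using q(2) by metis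
    then show ?thesis by (simp add: inner_prod_def inner_eq_Re_cinner)
  qed
  have eq0: "cinner b s + cinner (T b) (T s) = 0" if s: "s \<in> ell2_fin" for s
  proof -
    have "Re (\<i> * (cinner b s + cinner (T b) (T s))) = 0"
      using Re0[OF ell2_fin_scaleC[OF s, of \<i>]] T_scaleC[of s \<i>] s fin_subset_DM
      by (auto simp: cinner_scaleC_right distrib_left)
    then show ?thesis using Re0[OF s] by (simp add: complex_eq_iff)
  qed
  have "cinner (- b) (ell2_unit j) = cinner (T b) (T (ell2_unit j))" for j
    using eq0[OF ell2_fin_unit[of j]] by (simp add: cinner_minus_left add_eq_0_iff)
  from adjoint_on_units[OF this] have Tb: "T b \<in> DM" "T (T b) = - b" by auto
  have "cinner b b = - cinner (T b) (T b)"
    using T_sym[OF Tb(1) b(1)] Tb(2) by (simp add: cinner_minus_left)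
  then have "(norm b)\<^sup>2 = - (norm (T b))\<^sup>2"
    unfolding cinner_self by (metis of_real_eq_iff of_real_minus)
  then have "norm b = 0" "norm (T b) = 0"
    using zero_le_power2[of "norm b"] zero_le_power2[of "norm (T b)"] by (auto simp: add_nonneg_eq_0_iff)
  then have "fst q = x" "snd q = T x" using b b_def by auto
  then have "y \<longlonglongrightarrow> x" "(\<lambda>n. T (y n)) \<longlonglongrightarrow> T x" using y by auto
  then have "\<forall>\<^sub>F n in sequentially. dist (y n) x < \<epsilon> \<and> dist (T (y n)) (T x) < \<epsilon>"
    using \<epsilon> by (intro eventually_conj tendstoD)
  then obtain n where "dist (y n) x < \<epsilon>" "dist (T (y n)) (T x) < \<epsilon>"
    using eventually_happens' sequentially_bot by blast
  then show ?thesis using y(1) by (intro bexI[of _ "y n"]) (auto simp: dist_norm norm_minus_commute)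
qed

end

section \<open>Diagonalisation of the finite sections\<close>

text \<open>If a nonzero polynomial in \<open>S\<close> annihilates a nonzero vector, then splitting off a root \<open>r\<close> either
  shows that the vector is an eigenvector for \<open>r\<close>, or replaces it by \<open>S y - r y\<close> and lowers the degree.\<close>

lemma eigenvector_from_polynomial:
  fixes S :: "'a::complex_hilbert_space \<Rightarrow> 'a" and p :: "complex poly"
  assumes S: "\<And>x y. S (x + y) = S x + S y" "\<And>c x. S (c *\<^sub>C x) = c *\<^sub>C S x"
    and W: "\<And>x y. x \<in> W \<Longrightarrow> y \<in> W \<Longrightarrow> x + y \<in> W" "\<And>c x. x \<in> W \<Longrightarrow> c *\<^sub>C x \<in> W" "\<And>x. x \<in> W \<Longrightarrow> S x \<in> W"
  shows "p \<noteq> 0 \<Longrightarrow> degree p = m \<Longrightarrow> m \<le> N \<Longrightarrow> y \<in> W \<Longrightarrow> y \<noteq> 0 \<Longrightarrow>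
    (\<Sum>j\<le>N. coeff p j *\<^sub>C (S ^^ j) y) = 0 \<Longrightarrow> \<exists>z\<in>W. z \<noteq> 0 \<and> (\<exists>r. S z = r *\<^sub>C z)"
proof (induction m arbitrary: p y)
  case 0
  obtain c where c: "p = [:c:]" using 0(2) degree_eq_zeroE by blast
  have "(\<Sum>j\<le>N. coeff p j *\<^sub>C (S ^^ j) y) = (\<Sum>j\<in>{0}. coeff p j *\<^sub>C (S ^^ j) y)"
    by (rule sum.mono_neutral_right) (auto simp: c coeff_pCons scaleC_zero_left split: nat.splits)
  then have "c *\<^sub>C y = 0" using 0(6) by (simp add: c)
  then have "cmod c * norm y = 0" by (metis norm_scaleC norm_zero)
  then show ?case using 0(1,5) c by simp
next
  case (Suc m)
  have "\<not> constant (poly p)" using Suc(3) by (simp add: constant_degree)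
  then obtain r where "poly p r = 0" using fundamental_theorem_of_algebra by blast
  then obtain q where q: "p = [:- r, 1:] * q" unfolding poly_eq_0_iff_dvd by (rule dvdE)
  have q0: "q \<noteq> 0" using Suc(2) q by auto
  have dq: "degree q = m" using Suc(3) q0 unfolding q by (subst (asm) degree_mult_eq) auto
  define x where "x = S y + (- r) *\<^sub>C y"
  have xW: "x \<in> W" using W Suc(5) by (simp add: x_def)
  have Sj: "(S ^^ j) (a + c *\<^sub>C b) = (S ^^ j) a + c *\<^sub>C (S ^^ j) b" for j a c b
    by (induction j) (auto simp: S)
  have cp: "coeff p j = (case j of 0 \<Rightarrow> 0 | Suc i \<Rightarrow> coeff q i) - r * coeff q j" for j
    unfolding q by (simp add: coeff_pCons split: nat.splits)
  have qN: "coeff q N = 0" using dq Suc(4) by (intro coeff_eq_0) simp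
  have "(\<Sum>j\<le>N. coeff q j *\<^sub>C (S ^^ j) x)
      = (\<Sum>j\<le>N. coeff q j *\<^sub>C (S ^^ Suc j) y) + (\<Sum>j\<le>N. (- r * coeff q j) *\<^sub>C (S ^^ j) y)"
    unfolding x_def Sj sum.distrib[symmetric]
    by (intro sum.cong refl) (simp add: scaleC_add_right scaleC_scaleC funpow_swap1 mult.commute)
  also have "(\<Sum>j\<le>N. coeff q j *\<^sub>C (S ^^ Suc j) y) = (\<Sum>j\<le>Suc N. (case j of 0 \<Rightarrow> 0 | Suc i \<Rightarrow> coeff q i) *\<^sub>C (S ^^ j) y)"
    unfolding sum.atMost_Suc_shift by (simp add: scaleC_zero_left)
  also have "\<dots> = (\<Sum>j\<le>N. (case j of 0 \<Rightarrow> 0 | Suc i \<Rightarrow> coeff q i) *\<^sub>C (S ^^ j) y)"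
    by (simp add: qN scaleC_zero_left)
  also have "\<dots> + (\<Sum>j\<le>N. (- r * coeff q j) *\<^sub>C (S ^^ j) y) = (\<Sum>j\<le>N. coeff p j *\<^sub>C (S ^^ j) y)"
    unfolding sum.distrib[symmetric] scaleC_add_left[symmetric] by (intro sum.cong refl) (simp add: cp)
  finally have ann: "(\<Sum>j\<le>N. coeff q j *\<^sub>C (S ^^ j) x) = 0" using Suc(7) by simp
  show ?case
  proof (cases "x = 0")
    case True
    then have "S y = r *\<^sub>C y"
      unfolding x_def by (simp add: scaleC_minus_left)
    then show ?thesis using Suc(5,6) by blast
  next
    case False
    show ?thesis by (rule Suc(1)[OF q0 dq _ xW False ann]) (use Suc(4) in simp)
  qed
qed

text \<open>The finite section is treated as the operator \<open>trunc\<close> on sequences, so that its eigenvectors can be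
  compared with the infinite matrix directly; it lives on the sequences \<open>V\<close> supported in \<open>{..n}\<close>.\<close>

locale hermitian_section =
  fixes M :: "nat \<Rightarrow> nat \<Rightarrow> complex" and n :: nat
  assumes hermitian: "M i j = cnj (M j i)"
begin

definition V :: "ell2 set" where
  "V = {x. \<forall>k>n. ell2_nth x k = 0}"

definition trunc :: "ell2 \<Rightarrow> ell2" where
  "trunc x = (\<Sum>i\<le>n. (\<Sum>k\<le>n. M i k * ell2_nth x k) *\<^sub>C ell2_unit i)"

lemma trunc_nth: "ell2_nth (trunc x) i = (if i \<le> n then \<Sum>k\<le>n. M i k * ell2_nth x k else 0)"
proof -
  have "ell2_nth (trunc x) i = (\<Sum>j\<le>n. if j = i then \<Sum>k\<le>n. M j k * ell2_nth x k else 0)"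
    unfolding trunc_def ell2_nth_sum by (intro sum.cong refl) (auto simp: ell2_nth_scaleC ell2_nth_unit)
  then show ?thesis by simp
qed

lemma trunc_add: "trunc (x + y) = trunc x + trunc y"
  by (rule ell2_eqI) (simp add: trunc_nth ell2_nth_add distrib_left sum.distrib)

lemma trunc_scaleC: "trunc (c *\<^sub>C x) = c *\<^sub>C trunc x"
  by (rule ell2_eqI) (simp add: trunc_nth ell2_nth_scaleC sum_distrib_left mult.left_commute)

lemma trunc_V: "trunc x \<in> V"
  by (simp add: V_def trunc_nth)

lemma cinner_V: "x \<in> V \<or> y \<in> V \<Longrightarrow> cinner x y = (\<Sum>k\<le>n. cnj (ell2_nth x k) * ell2_nth y k)"
  by (rule cinner_ell2_finite) (auto simp: V_def)

lemma trunc_sym: "cinner (trunc x) y = cinner x (trunc y)"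
proof -
  have "cinner (trunc x) y = (\<Sum>i\<le>n. \<Sum>k\<le>n. cnj (ell2_nth x k) * (M k i * ell2_nth y i))"
    using trunc_V[of x]
    by (simp add: cinner_V trunc_nth sum_distrib_left sum_distrib_right hermitian[symmetric]
        mult.commute mult.left_commute)
  also have "\<dots> = (\<Sum>k\<le>n. \<Sum>i\<le>n. cnj (ell2_nth x k) * (M k i * ell2_nth y i))"
    by (rule sum.swap)
  also have "\<dots> = cinner x (trunc y)"
    using trunc_V[of y] by (simp add: cinner_V trunc_nth sum_distrib_left)
  finally show ?thesis .
qed

text \<open>The iterates of \<open>trunc\<close> on \<open>y\<close> have only \<open>n + 1\<close> coordinates that can be nonzero, so \<open>n + 2\<close> of
  them are linearly dependent. In matrix terms: write them as the columns of a square matrix of size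
  \<open>n + 2\<close>; its last row vanishes, so it is singular, and a vector in its kernel gives the coefficients.\<close>

lemma annihilating_polynomial:
  assumes y: "y \<in> V"
  shows "\<exists>p. p \<noteq> 0 \<and> degree p \<le> Suc n \<and> (\<Sum>j\<le>Suc n. coeff p j *\<^sub>C (trunc ^^ j) y) = 0"
proof -
  let ?N = "Suc (Suc n)"
  have yV: "(trunc ^^ j) y \<in> V" for j by (cases j) (auto simp: y trunc_V)
  define G where "G = Matrix.mat ?N ?N (\<lambda>(i, j). ell2_nth ((trunc ^^ j) y) i)"
  have G: "G \<in> carrier_mat ?N ?N" by (simp add: G_def)
  have "transpose_mat G *\<^sub>v unit_vec ?N (Suc n) = 0\<^sub>v ?N"
  proof (rule eq_vecI)
    fix i assume "i < dim_vec (0\<^sub>v ?N :: complex Matrix.vec)"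
    then have i: "i < ?N" by simp
    have "(transpose_mat G *\<^sub>v unit_vec ?N (Suc n)) $ i = G $$ (Suc n, i)"
      using G i by (simp add: scalar_prod_right_unit[of _ ?N])
    also have "\<dots> = 0" using i yV[of i] by (simp add: G_def V_def)
    finally show "(transpose_mat G *\<^sub>v unit_vec ?N (Suc n)) $ i = 0\<^sub>v ?N $ i" using i by simp
  qed (use G in simp)
  moreover have "unit_vec ?N (Suc n) \<noteq> (0\<^sub>v ?N :: complex Matrix.vec)"
    using unit_vec_nonzero[of "Suc n" ?N] by simp
  ultimately have "\<exists>v. v \<in> carrier_vec ?N \<and> v \<noteq> 0\<^sub>v ?N \<and> transpose_mat G *\<^sub>v v = 0\<^sub>v ?N"
    by (intro exI[of _ "unit_vec ?N (Suc n)"] conjI unit_vec_carrier)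
  then have "det (transpose_mat G) = 0"
    using det_0_iff_vec_prod_zero[of "transpose_mat G" ?N] G by simp
  then have "det G = 0" using det_transpose[OF G] by simp
  then obtain a where a: "a \<in> carrier_vec ?N" "a \<noteq> 0\<^sub>v ?N" "G *\<^sub>v a = 0\<^sub>v ?N"
    using det_0_iff_vec_prod_zero[OF G] by auto
  define p where "p = (\<Sum>j\<le>Suc n. monom (a $ j) j)"
  have cp: "coeff p i = (if i \<le> Suc n then a $ i else 0)" for i
    unfolding p_def coeff_sum by simp
  have "degree p \<le> Suc n" by (rule degree_le) (simp add: cp)
  moreover have "p \<noteq> 0"
  proof
    assume "p = 0"
    then have "a $ i = 0" if "i < ?N" for i using cp[of i] that by simp
    then have "a = 0\<^sub>v ?N" using a(1) by (intro eq_vecI) auto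
    then show False using a(2) by simp
  qed
  moreover have "(\<Sum>j\<le>Suc n. coeff p j *\<^sub>C (trunc ^^ j) y) = 0"
  proof (rule ell2_eqI)
    fix i
    show "ell2_nth (\<Sum>j\<le>Suc n. coeff p j *\<^sub>C (trunc ^^ j) y) i = ell2_nth 0 i"
    proof (cases "i \<le> n")
      case True
      have "0 = (G *\<^sub>v a) $ i" using a(3) True by simp
      also have "\<dots> = (\<Sum>j<?N. ell2_nth ((trunc ^^ j) y) i * a $ j)"
        using True a(1) by (simp add: G_def scalar_prod_def lessThan_atLeast0)
      finally show ?thesis
        unfolding ell2_nth_sum ell2_nth_zero lessThan_Suc_atMost by (simp add: cp ell2_nth_scaleC mult.commute)
    next
      case False
      then have "ell2_nth ((trunc ^^ j) y) i = 0" for j using yV[of j] by (simp add: V_def)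
      then show ?thesis
        unfolding ell2_nth_sum ell2_nth_zero by (intro sum.neutral) (simp add: ell2_nth_scaleC)
    qed
  qed
  ultimately show ?thesis by blast
qed

definition eigensystem :: "nat \<Rightarrow> (nat \<Rightarrow> ell2) \<Rightarrow> (nat \<Rightarrow> real) \<Rightarrow> bool" where
  "eigensystem k w d \<longleftrightarrow> corthonormal {..<k} w \<and> (\<forall>j<k. w j \<in> V \<and> trunc (w j) = of_real (d j) *\<^sub>C w j)"

lemma V_add: "x \<in> V \<Longrightarrow> y \<in> V \<Longrightarrow> x + y \<in> V"
  and V_scaleC: "x \<in> V \<Longrightarrow> c *\<^sub>C x \<in> V"
  by (auto simp: V_def ell2_nth_add ell2_nth_scaleC)

lemma V_sum: "(\<And>i. i \<in> I \<Longrightarrow> f i \<in> V) \<Longrightarrow> (\<Sum>i\<in>I. f i) \<in> V"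
  by (induction I rule: infinite_finite_induct) (auto simp: V_def ell2_nth_zero ell2_nth_add)

text \<open>The orthogonal complement of the system in \<open>V\<close> is invariant because the section is symmetric, so it
  contains an eigenvector as soon as it contains a nonzero vector \<open>y\<close>; the eigenvalue is real, again by
  symmetry.\<close>

lemma extend_eigensystem:
  assumes w: "eigensystem k w d" and y: "y \<in> V" "y \<noteq> 0" "\<And>j. j < k \<Longrightarrow> cinner (w j) y = 0"
  shows "\<exists>w' d'. eigensystem (Suc k) w' d'"
proof -
  define W where "W = {x \<in> V. \<forall>j<k. cinner (w j) x = 0}"
  have W1: "x + z \<in> W" if "x \<in> W" "z \<in> W" for x z
    using that by (auto simp: W_def V_add cinner_add_right)
  have W2: "c *\<^sub>C x \<in> W" if "x \<in> W" for c x
    using that by (auto simp: W_def V_scaleC cinner_scaleC_right)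
  have W3: "trunc x \<in> W" if x: "x \<in> W" for x
    unfolding W_def
  proof (intro CollectI conjI allI impI trunc_V)
    fix j assume j: "j < k"
    have "cinner (w j) (trunc x) = cinner (of_real (d j) *\<^sub>C w j) x"
      using w j by (simp add: eigensystem_def trunc_sym[symmetric])
    then show "cinner (w j) (trunc x) = 0" using x j by (simp add: W_def cinner_scaleC_left)
  qed
  obtain p where p: "p \<noteq> 0" "degree p \<le> Suc n" "(\<Sum>j\<le>Suc n. coeff p j *\<^sub>C (trunc ^^ j) y) = 0"
    using annihilating_polynomial[OF y(1)] by blast
  have "y \<in> W" using y by (simp add: W_def)
  then obtain z r where z: "z \<in> W" "z \<noteq> 0" "trunc z = r *\<^sub>C z"
    using eigenvector_from_polynomial[of trunc W p "degree p" "Suc n" y, OF trunc_add trunc_scaleC W1 W2 W3 p(1) refl p(2) _ y(2) p(3)]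
    by blast
  have "cnj r * cinner z z = r * cinner z z"
    using trunc_sym[of z z] z(3) by (simp add: cinner_scaleC_left cinner_scaleC_right)
  moreover have "cinner z z \<noteq> 0" using z(2) by (simp add: cinner_self)
  ultimately have "cnj r = r" by simp
  then have r: "r = of_real (Re r)" by (simp add: complex_eq_iff)
  define e where "e = complex_of_real (inverse (norm z)) *\<^sub>C z"
  have e: "e \<in> W" "trunc e = of_real (Re r) *\<^sub>C e"
    unfolding e_def using W2[OF z(1)] z(3) r by (auto simp: trunc_scaleC scaleC_scaleC mult.commute)
  have "norm e = 1" using z(2) by (simp add: e_def norm_scaleC norm_inverse)
  then have ee: "cinner e e = 1" by (simp add: cinner_self)
  have we: "cinner (w j) e = 0" "cinner e (w j) = 0" if "j < k" for j
    using e(1) that cinner_commute[of e "w j"] by (auto simp: W_def)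
  have "eigensystem (Suc k) (w(k := e)) (d(k := Re r))"
    using w e ee we unfolding eigensystem_def corthonormal_def W_def by (auto simp: less_Suc_eq)
  then show ?thesis by blast
qed

lemma coordinate_norms:
  assumes "x \<in> V" shows "(\<Sum>i\<le>n. (cmod (cinner x (ell2_unit i)))\<^sup>2) = (norm x)\<^sup>2"
proof -
  have "complex_of_real ((norm x)\<^sup>2) = (\<Sum>k\<le>n. cnj (ell2_nth x k) * ell2_nth x k)"
    unfolding cinner_self[symmetric] using assms by (intro cinner_V) simp
  also have "\<dots> = of_real (\<Sum>k\<le>n. (cmod (ell2_nth x k))\<^sup>2)"
    by (simp add: complex_norm_square[symmetric] mult.commute)
  finally have "(norm x)\<^sup>2 = (\<Sum>k\<le>n. (cmod (ell2_nth x k))\<^sup>2)" using of_real_eq_iff by blast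
  moreover have "cmod (cinner x (ell2_unit i)) = cmod (ell2_nth x i)" for i
    by (metis cinner_commute cinner_ell2_unit complex_mod_cnj)
  ultimately show ?thesis by simp
qed

lemma eigensystem_count:
  assumes "eigensystem k w d"
  shows "real k = (\<Sum>i\<le>n. \<Sum>j<k. (cmod (cinner (w j) (ell2_unit i)))\<^sup>2)"
proof -
  have "(\<Sum>i\<le>n. (cmod (cinner (w j) (ell2_unit i)))\<^sup>2) = 1" if "j < k" for j
  proof -
    have "norm (w j) = 1"
      using assms that by (intro norm_eq_one_if_cinner) (simp add: eigensystem_def corthonormal_def)
    then show ?thesis using assms that coordinate_norms[of "w j"] by (simp add: eigensystem_def)
  qed
  then have "real k = (\<Sum>j<k. \<Sum>i\<le>n. (cmod (cinner (w j) (ell2_unit i)))\<^sup>2)" by simp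
  then show ?thesis using sum.swap[of "\<lambda>j i. (cmod (cinner (w j) (ell2_unit i)))\<^sup>2" "{..n}" "{..<k}"] by simp
qed

lemma norm_unit: "norm (ell2_unit i) = 1"
  by (rule norm_eq_one_if_cinner) (simp add: cinner_ell2_unit ell2_nth_unit)

lemma unit_V: "i \<le> n \<Longrightarrow> ell2_unit i \<in> V"
  by (simp add: V_def ell2_nth_unit)

text \<open>A largest orthonormal system of eigenvectors satisfies Parseval's identity, as it cannot be extended.
  Summing Bessel's inequality, or Parseval's identity, over the unit vectors counts its members.\<close>

lemma eigenbasis_exists:
  "\<exists>w d. corthonormal {..n} w \<and> (\<forall>j\<le>n. w j \<in> V \<and> trunc (w j) = of_real (d j) *\<^sub>C w j) \<and>
     (\<forall>x\<in>V. (\<Sum>j\<le>n. (cmod (cinner (w j) x))\<^sup>2) = (norm x)\<^sup>2)"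
proof -
  \<comment> \<open>Bessel bounds the size of every system, so a largest one exists.\<close>
  have bound: "k \<le> Suc n" if "eigensystem k w d" for k w d
  proof -
    have "real k \<le> (\<Sum>i\<le>n. (norm (ell2_unit i))\<^sup>2)"
      unfolding eigensystem_count[OF that] using that
      by (intro sum_mono Bessel_inequality) (auto simp: eigensystem_def)
    then show ?thesis by (simp add: norm_unit)
  qed
  define K where "K = (GREATEST k. \<exists>w d. eigensystem k w d)"
  have "\<exists>w d. eigensystem 0 w d" by (simp add: eigensystem_def corthonormal_def)
  then have "\<exists>w d. eigensystem K w d"
    unfolding K_def using bound by (intro GreatestI_nat[of "\<lambda>k. \<exists>w d. eigensystem k w d" 0 "Suc n"]) auto
  then obtain w d where w: "eigensystem K w d" by blast
  have max: "\<not> eigensystem (Suc K) w' d'" for w' d'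
    using Greatest_le_nat[of "\<lambda>k. \<exists>w d. eigensystem k w d" "Suc K" "Suc n"] bound unfolding K_def[symmetric] by auto
  have parseval: "(\<Sum>j<K. (cmod (cinner (w j) x))\<^sup>2) = (norm x)\<^sup>2" if x: "x \<in> V" for x
  proof -
    define y where "y = x + (- 1) *\<^sub>C (\<Sum>j<K. cinner (w j) x *\<^sub>C w j)"
    have yV: "y \<in> V" unfolding y_def
      using w x by (intro V_add V_scaleC V_sum) (auto simp: eigensystem_def)
    have "cinner (w j) y = 0" if j: "j < K" for j
    proof -
      have "cinner (w j) (\<Sum>i<K. cinner (w i) x *\<^sub>C w i) = (\<Sum>i<K. if i = j then cinner (w i) x else 0)"
        unfolding cinner_sum_right cinner_scaleC_right
        using w j by (intro sum.cong refl) (auto simp: eigensystem_def corthonormal_def)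
      then show ?thesis using j by (simp add: y_def cinner_add_right cinner_scaleC_right)
    qed
    then have "y = 0" using extend_eigensystem[OF w yV] max by blast
    then have "x - (\<Sum>j<K. cinner (w j) x *\<^sub>C w j) = 0" by (simp add: y_def scaleC_minus_one)
    then show ?thesis using norm_diff_projection[of "{..<K}" w x] w by (simp add: eigensystem_def)
  qed
  have "real K = (\<Sum>i\<le>n. (norm (ell2_unit i))\<^sup>2)"
    unfolding eigensystem_count[OF w] by (intro sum.cong refl parseval unit_V) simp
  then have "K = Suc n" by (simp add: norm_unit)
  then have "{..<K} = {..n}" by auto
  then show ?thesis using w parseval unfolding eigensystem_def
    by (intro exI[of _ w] exI[of _ d]) (auto simp: \<open>K = Suc n\<close>)
qed

end

lemma mat_adjoint_carrier: "B \<in> carrier_mat n m \<Longrightarrow> mat_adjoint B \<in> carrier_mat m n"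
  unfolding mat_adjoint_def by (intro carrier_matI) simp_all

lemma mat_adjoint_index:
  "B \<in> carrier_mat n m \<Longrightarrow> i < m \<Longrightarrow> j < n \<Longrightarrow> mat_adjoint B $$ (i, j) = cnj (B $$ (j, i))"
  by (auto simp: mat_adjoint_def mat_of_rows_index)

text \<open>For two diagonalisations of the same matrix, the unitary matrix that relates them couples only
  equal eigenvalues, hence it also intertwines the diagonal matrices of the values of \<open>f\<close>.\<close>

lemma matrix_function_diagonalised:
  assumes P: "P \<in> carrier_mat n n" "P * mat_adjoint P = 1\<^sub>m n"
    and B: "B = P * mat_diag n (\<lambda>i. complex_of_real (d i)) * mat_adjoint P"
  shows "matrix_function f B = P * mat_diag n (\<lambda>i. complex_of_real (f (d i))) * mat_adjoint P"
proof -
  have n: "dim_row B = n" unfolding B using P(1) by simp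
  let ?C = "P * mat_diag n (\<lambda>i. complex_of_real (f (d i))) * mat_adjoint P"
  have "C = ?C" if Q: "Q \<in> carrier_mat n n" "Q * mat_adjoint Q = 1\<^sub>m n"
    and BQ: "B = Q * mat_diag n (\<lambda>i. complex_of_real (e i)) * mat_adjoint Q"
    and C: "C = Q * mat_diag n (\<lambda>i. complex_of_real (f (e i))) * mat_adjoint Q" for C Q e
  proof -
    define P' where "P' = mat_adjoint P"
    define Q' where "Q' = mat_adjoint Q"
    have c: "P' \<in> carrier_mat n n" "Q' \<in> carrier_mat n n"
      unfolding P'_def Q'_def using P Q by (auto intro: mat_adjoint_carrier)
    have PP: "P' * P = 1\<^sub>m n" using mat_mult_left_right_inverse[OF P(1) c(1)] P(2) by (simp add: P'_def)
    have QQ: "Q' * Q = 1\<^sub>m n" using mat_mult_left_right_inverse[OF Q(1) c(2)] Q(2) by (simp add: Q'_def)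
    have PP2: "P * P' = 1\<^sub>m n" and QQ2: "Q * Q' = 1\<^sub>m n" using P Q by (simp_all add: P'_def Q'_def)
    let ?D = "\<lambda>g. mat_diag n (\<lambda>i. complex_of_real (g i))"
    have D: "?D g \<in> carrier_mat n n" for g by simp
    define W where "W = Q' * P"
    have W: "W \<in> carrier_mat n n" unfolding W_def using c P by simp
    have "Q' * B * P = Q' * (P * ?D d * P') * P" unfolding B P'_def ..
    also have "\<dots> = W * ?D d * (P' * P)"
      unfolding W_def using P c D by (simp add: assoc_mult_mat[of _ n n _ n _ n] mult_carrier_mat[of _ n n _ n])
    finally have "Q' * B * P = W * ?D d"
      unfolding PP right_mult_one_mat[OF mult_carrier_mat[OF W D[of d]]] .
    moreover have "Q' * B * P = Q' * (Q * ?D e * Q') * P" unfolding BQ Q'_def ..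
    then have "Q' * B * P = (Q' * Q) * ?D e * W"
      unfolding W_def using P Q c D by (simp add: assoc_mult_mat[of _ n n _ n _ n] mult_carrier_mat[of _ n n _ n])
    then have "Q' * B * P = ?D e * W" unfolding QQ left_mult_one_mat[OF D[of e]] .
    ultimately have WD: "W * ?D d = ?D e * W" by simp
    have "W * ?D (\<lambda>i. f (d i)) = ?D (\<lambda>i. f (e i)) * W"
    proof (rule eq_matI)
      fix i j assume "i < dim_row (?D (\<lambda>i. f (e i)) * W)" "j < dim_col (?D (\<lambda>i. f (e i)) * W)"
      then have ij: "i < n" "j < n" using W by (auto simp: mat_diag_def)
      have "(W * ?D d) $$ (i, j) = (?D e * W) $$ (i, j)" using WD by simp
      then have "W $$ (i, j) * of_real (d j) = of_real (e i) * W $$ (i, j)"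
        using ij W by (simp add: mat_diag_mult_right mat_diag_mult_left)
      then have "W $$ (i, j) = 0 \<or> d j = e i" by (auto simp: mult.commute)
      then show "(W * ?D (\<lambda>i. f (d i))) $$ (i, j) = (?D (\<lambda>i. f (e i)) * W) $$ (i, j)"
        using ij W by (auto simp: mat_diag_mult_right mat_diag_mult_left)
    qed (use W in \<open>auto simp: mat_diag_def\<close>)
    note WF = this
    \<comment> \<open>Insert \<open>Q * Q' = 1\<close> on the left and move the diagonal matrix through \<open>W\<close>.\<close>
    have "?C = (Q * Q') * P * ?D (\<lambda>i. f (d i)) * P'"
      using P(1) by (simp add: QQ2 P'_def)
    also have "\<dots> = Q * (W * ?D (\<lambda>i. f (d i))) * P'"
      unfolding W_def using P Q c D by (simp add: assoc_mult_mat[of _ n n _ n _ n] mult_carrier_mat[of _ n n _ n])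
    also have "\<dots> = Q * ?D (\<lambda>i. f (e i)) * Q' * (P * P')"
      unfolding WF unfolding W_def using P Q c D by (simp add: assoc_mult_mat[of _ n n _ n _ n] mult_carrier_mat[of _ n n _ n])
    also have "\<dots> = C" unfolding PP2 C Q'_def[symmetric] using Q c D by simp
    finally show ?thesis ..
  qed
  then show ?thesis
    unfolding matrix_function_def Let_def n using P B
    by (intro the_equality) blast+
qed

context hermitian_section
begin

text \<open>The eigenvectors vanish beyond the index \<open>n\<close>, so the finite products with the truncated \<open>u\<close> and \<open>v\<close>
  are inner products in the sequence space.\<close>

lemma section_form:
  assumes w: "corthonormal {..n} w" "\<And>j. j \<le> n \<Longrightarrow> w j \<in> V"
    and eig: "\<And>j. j \<le> n \<Longrightarrow> trunc (w j) = of_real (d j) *\<^sub>C w j"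
  shows "(matrix_function f (section_mat M n) *\<^sub>v section_vec v n) \<bullet>c section_vec u n
    = (\<Sum>j\<le>n. of_real (f (d j)) * (cinner u (w j) * cinner (w j) v))"
proof -
  let ?N = "Suc n"
  define P where "P = Matrix.mat ?N ?N (\<lambda>(i, j). ell2_nth (w j) i)"
  define P' where "P' = mat_adjoint P"
  have P: "P \<in> carrier_mat ?N ?N" by (simp add: P_def)
  have P': "P' \<in> carrier_mat ?N ?N" unfolding P'_def by (rule mat_adjoint_carrier[OF P])
  have Pi: "P $$ (i, j) = ell2_nth (w j) i" if "i \<le> n" "j \<le> n" for i j using that by (simp add: P_def)
  have P'i: "P' $$ (i, j) = cnj (ell2_nth (w i) j)" if "i \<le> n" "j \<le> n" for i j
    unfolding P'_def using that by (subst mat_adjoint_index[OF P]) (auto simp: Pi)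
  let ?D = "\<lambda>g. mat_diag ?N (\<lambda>i. complex_of_real (g i))"
  have prod: "(X * Y) $$ (i, j) = (\<Sum>k\<le>n. X $$ (i, k) * Y $$ (k, j))"
    if "X \<in> carrier_mat ?N ?N" "Y \<in> carrier_mat ?N ?N" "i \<le> n" "j \<le> n" for X Y :: "complex mat" and i j
    using that by (simp add: scalar_prod_def atLeast0LessThan lessThan_Suc_atMost)
  have "P' * P = 1\<^sub>m ?N"
  proof (rule eq_matI)
    fix i j assume "i < dim_row (1\<^sub>m ?N :: complex mat)" "j < dim_col (1\<^sub>m ?N :: complex mat)"
    then have ij: "i \<le> n" "j \<le> n" by auto
    have "(P' * P) $$ (i, j) = cinner (w i) (w j)"
      using ij w(2) by (simp add: prod[OF P' P] Pi P'i cinner_V)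
    then show "(P' * P) $$ (i, j) = (1\<^sub>m ?N :: complex mat) $$ (i, j)" using ij w(1) by (simp add: corthonormal_def)
  qed (use P P' in auto)
  then have PP: "P * P' = 1\<^sub>m ?N" by (rule mat_mult_left_right_inverse[OF P' P])
  let ?B = "section_mat M n"
  have B: "?B \<in> carrier_mat ?N ?N" by (simp add: section_mat_def)
  have "?B * P = P * ?D d"
  proof (rule eq_matI)
    fix i j assume "i < dim_row (P * ?D d)" "j < dim_col (P * ?D d)"
    then have ij: "i \<le> n" "j \<le> n" using P by (auto simp: mat_diag_def)
    have "(?B * P) $$ (i, j) = ell2_nth (trunc (w j)) i"
      using ij by (subst prod[OF B P ij]) (simp add: Pi trunc_nth section_mat_def)
    also have "\<dots> = (P * ?D d) $$ (i, j)"
      using ij by (simp add: eig ell2_nth_scaleC mat_diag_mult_right[OF P] Pi mult.commute)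
    finally show "(?B * P) $$ (i, j) = (P * ?D d) $$ (i, j)" .
  qed (use P B in \<open>auto simp: mat_diag_def\<close>)
  then have "?B * P * P' = P * ?D d * P'" by simp
  then have BD: "?B = P * ?D d * mat_adjoint P"
    using B P P' by (simp add: assoc_mult_mat[of _ ?N ?N _ ?N _ ?N] mult_carrier_mat[of _ ?N ?N _ ?N] PP flip: P'_def)
  have fB: "matrix_function f ?B = P * ?D (\<lambda>j. f (d j)) * P'"
    unfolding P'_def by (rule matrix_function_diagonalised[OF P _ BD]) (use PP in \<open>simp add: P'_def\<close>)
  have C: "matrix_function f ?B $$ (i, k) = (\<Sum>j\<le>n. ell2_nth (w j) i * of_real (f (d j)) * cnj (ell2_nth (w j) k))"
    if "i \<le> n" "k \<le> n" for i k
    unfolding fB using that P P' by (subst prod) (auto simp: mat_diag_mult_right[OF P] Pi P'i)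
  have Cc: "matrix_function f ?B \<in> carrier_mat ?N ?N" unfolding fB using P P' by (simp add: mult_carrier_mat[of _ _ ?N])
  have "(matrix_function f ?B *\<^sub>v section_vec v n) \<bullet>c section_vec u n
      = (\<Sum>i\<le>n. (\<Sum>k\<le>n. matrix_function f ?B $$ (i, k) * ell2_nth v k) * cnj (ell2_nth u i))"
    using Cc by (simp add: scalar_prod_def section_vec_def atLeast0LessThan lessThan_Suc_atMost
        del: sum.atMost_Suc sum.lessThan_Suc)
  also have "\<dots> = (\<Sum>i\<le>n. \<Sum>k\<le>n. \<Sum>j\<le>n. of_real (f (d j)) *
      ((cnj (ell2_nth u i) * ell2_nth (w j) i) * (cnj (ell2_nth (w j) k) * ell2_nth v k)))"
    by (simp add: C sum_distrib_left sum_distrib_right mult_ac)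
  also have "\<dots> = (\<Sum>i\<le>n. \<Sum>j\<le>n. \<Sum>k\<le>n. of_real (f (d j)) *
      ((cnj (ell2_nth u i) * ell2_nth (w j) i) * (cnj (ell2_nth (w j) k) * ell2_nth v k)))"
    by (intro sum.cong refl sum.swap)
  also have "\<dots> = (\<Sum>j\<le>n. \<Sum>i\<le>n. \<Sum>k\<le>n. of_real (f (d j)) *
      ((cnj (ell2_nth u i) * ell2_nth (w j) i) * (cnj (ell2_nth (w j) k) * ell2_nth v k)))"
    by (rule sum.swap)
  also have "\<dots> = (\<Sum>j\<le>n. of_real (f (d j)) * (cinner u (w j) * cinner (w j) v))"
  proof (intro sum.cong refl)
    fix j assume "j \<in> {..n}"
    then have wj: "w j \<in> V" using w(2) by simp
    have "cinner u (w j) * cinner (w j) v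
        = (\<Sum>i\<le>n. \<Sum>k\<le>n. (cnj (ell2_nth u i) * ell2_nth (w j) i) * (cnj (ell2_nth (w j) k) * ell2_nth v k))"
      unfolding cinner_V[OF disjI2[OF wj]] cinner_V[OF disjI1[OF wj]] by (rule sum_product)
    then show "(\<Sum>i\<le>n. \<Sum>k\<le>n. of_real (f (d j)) *
      ((cnj (ell2_nth u i) * ell2_nth (w j) i) * (cnj (ell2_nth (w j) k) * ell2_nth v k)))
      = of_real (f (d j)) * (cinner u (w j) * cinner (w j) v)"
      by (simp only: sum_distrib_left)
  qed
  finally show ?thesis .
qed

end

section \<open>Convergence of functions of the finite sections\<close>

context matrix_representation
begin

text \<open>A finite sequence is eventually supported in \<open>{..n}\<close>. From then on, the first \<open>n + 1\<close> coordinates of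
  its image under the infinite matrix are those of its image under the finite section.\<close>

lemma section_approximation:
  obtains w :: "nat \<Rightarrow> nat \<Rightarrow> ell2" and d :: "nat \<Rightarrow> nat \<Rightarrow> real" where
    "\<And>n. corthonormal {..n} (w n)"
    "\<And>x. x \<in> ell2_fin \<Longrightarrow> \<forall>\<^sub>F n in sequentially. (\<Sum>j\<le>n. (cmod (cinner (w n j) x))\<^sup>2) = (norm x)\<^sup>2"
    "\<And>x. x \<in> ell2_fin \<Longrightarrow>
      \<forall>\<^sub>F n in sequentially. \<forall>j\<le>n. cinner (w n j) (T x) = of_real (d n j) * cinner (w n j) x"
    "\<And>f u v n. (matrix_function f (section_mat M n) *\<^sub>v section_vec v n) \<bullet>c section_vec u n
      = (\<Sum>j\<le>n. of_real (f (d n j)) * (cinner u (w n j) * cinner (w n j) v))"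
proof -
  have H: "hermitian_section M" by unfold_locales (rule hermitian)
  have "\<forall>n. \<exists>w d. corthonormal {..n} w \<and>
      (\<forall>j\<le>n. w j \<in> hermitian_section.V n \<and> hermitian_section.trunc M n (w j) = of_real (d j) *\<^sub>C w j) \<and>
      (\<forall>x\<in>hermitian_section.V n. (\<Sum>j\<le>n. (cmod (cinner (w j) x))\<^sup>2) = (norm x)\<^sup>2)"
    using hermitian_section.eigenbasis_exists[OF H] by blast
  then obtain w d where wd: "\<And>n. corthonormal {..n} (w n) \<and>
      (\<forall>j\<le>n. w n j \<in> hermitian_section.V n \<and> hermitian_section.trunc M n (w n j) = of_real (d n j) *\<^sub>C w n j) \<and>
      (\<forall>x\<in>hermitian_section.V n. (\<Sum>j\<le>n. (cmod (cinner (w n j) x))\<^sup>2) = (norm x)\<^sup>2)"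
    by metis
  have fin: "\<forall>\<^sub>F n in sequentially. x \<in> hermitian_section.V n" if x: "x \<in> ell2_fin" for x
  proof -
    obtain m where m: "\<And>k. k \<ge> m \<Longrightarrow> ell2_nth x k = 0" using x unfolding ell2_fin_iff by blast
    have "x \<in> hermitian_section.V n" if "n \<ge> m" for n
      using m that by (simp add: hermitian_section.V_def[OF H])
    then show ?thesis unfolding eventually_sequentially by blast
  qed
  have eig: "cinner (w n j) (T x) = of_real (d n j) * cinner (w n j) x"
    if x: "x \<in> ell2_fin" "x \<in> hermitian_section.V n" and j: "j \<le> n" for x n j
  proof -
    have Tx: "ell2_nth (T x) i = ell2_nth (hermitian_section.trunc M n x) i" if "i \<le> n" for i
    proof -
      have "(\<Sum>k. M i k * ell2_nth x k) = (\<Sum>k\<le>n. M i k * ell2_nth x k)"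
        by (rule suminf_finite) (use x(2) in \<open>auto simp: hermitian_section.V_def[OF H]\<close>)
      then show ?thesis
        using that x(1) fin_subset_DM by (simp add: T_nth subsetD hermitian_section.trunc_nth[OF H])
    qed
    have wV: "w n j \<in> hermitian_section.V n" using wd j by blast
    have "cinner (w n j) (T x) = cinner (w n j) (hermitian_section.trunc M n x)"
      using wV by (simp add: hermitian_section.cinner_V[OF H, of _ n] Tx)
    also have "\<dots> = cinner (of_real (d n j) *\<^sub>C w n j) x"
      using wd j by (simp add: hermitian_section.trunc_sym[OF H, symmetric])
    finally show ?thesis by (simp add: cinner_scaleC_left)
  qed
  show thesis
  proof (rule that)
    show "corthonormal {..n} (w n)" for n using wd by blast
    show "\<forall>\<^sub>F n in sequentially. (\<Sum>j\<le>n. (cmod (cinner (w n j) x))\<^sup>2) = (norm x)\<^sup>2" if "x \<in> ell2_fin" for x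
      using fin[OF that] by eventually_elim (use wd in blast)
    show "\<forall>\<^sub>F n in sequentially. \<forall>j\<le>n. cinner (w n j) (T x) = of_real (d n j) * cinner (w n j) x"
      if "x \<in> ell2_fin" for x
      using fin[OF that] by eventually_elim (use eig that in blast)
    show "(matrix_function f (section_mat M n) *\<^sub>v section_vec v n) \<bullet>c section_vec u n
      = (\<Sum>j\<le>n. of_real (f (d n j)) * (cinner u (w n j) * cinner (w n j) v))" for f u v n
      by (rule hermitian_section.section_form[OF H]) (use wd in blast)+
  qed
qed

end

lemma tendsto_unique_at_right:
  fixes g h :: "real \<Rightarrow> real"
  assumes g: "(g \<longlongrightarrow> g s) (at_right s)" and h: "(h \<longlongrightarrow> h s) (at_right s)"
    and dense: "\<And>p. s < p \<Longrightarrow> \<exists>r. s < r \<and> r < p \<and> g r = h r"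
  shows "g s = h s"
proof (rule ccontr)
  assume ne: "g s \<noteq> h s"
  have "((\<lambda>r. g r - h r) \<longlongrightarrow> g s - h s) (at_right s)" using g h by (rule tendsto_diff)
  then have "\<forall>\<^sub>F r in at_right s. g r - h r \<noteq> 0"
    by (rule tendsto_imp_eventually_ne) (simp add: ne)
  then obtain p where p: "s < p" "\<And>r. s < r \<Longrightarrow> r < p \<Longrightarrow> g r - h r \<noteq> 0"
    unfolding eventually_at_right_field by blast
  then show False using dense[OF p(1)] by auto
qed

context spectral
begin

lemma distr_at_right: "(distr x \<longlongrightarrow> distr x s) (at_right s)"
  unfolding distr_eq by (intro tendsto_power tendsto_norm E_at_right)

end

text \<open>At a common continuity point both values are the limit of the same weights. Common continuity points
  are dense, and distribution functions are right-continuous.\<close>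

lemma distr_eq_if_same_weights:
  assumes 1: "spectral_approximation D A E C w d" and 2: "spectral_approximation D' A' E' C' w' d"
    and x: "x \<in> C" "x' \<in> C'"
    and same: "\<And>n j. j \<le> n \<Longrightarrow> cinner (w n j) x = cinner (w' n j) x'"
  shows "spectral.distr E x = spectral.distr E' x'"
proof
  fix s
  interpret P: spectral_approximation D A E C w d by fact
  interpret Q: spectral_approximation D' A' E' C' w' d by fact
  have eq: "P.distr x r = Q.distr x' r" if "isCont (P.distr x) r" "isCont (Q.distr x') r" for r
  proof -
    have "P.weighted (\<lambda>_. 1) {..r} n x = Q.weighted (\<lambda>_. 1) {..r} n x'" for n
      unfolding P.weighted_def Q.weighted_def P.eig_index_def Q.eig_index_def using same by simp
    then show ?thesis
      using P.distr_limit[OF x(1) that(1)] Q.distr_limit[OF x(2) that(2)] LIMSEQ_unique by simp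
  qed
  show "P.distr x s = Q.distr x' s"
  proof (rule tendsto_unique_at_right[OF P.distr_at_right Q.distr_at_right])
    fix p assume "s < p"
    then obtain r where "r \<in> {s<..<p}" "r \<notin> {a. \<not> isCont (P.distr x) a} \<union> {a. \<not> isCont (Q.distr x') a}"
      using real_interval_avoid_countable_set[of s p "{a. \<not> isCont (P.distr x) a} \<union> {a. \<not> isCont (Q.distr x') a}"]
        mono_ctble_discont[OF P.mono_distr[of x]] mono_ctble_discont[OF Q.mono_distr[of x']] by auto
    then show "\<exists>r. s < r \<and> r < p \<and> P.distr x r = Q.distr x' r" using eq[of r] by auto
  qed
qed

text \<open>Integrability is given on intervals whose endpoints are not eigenvalues. As the eigenvalues are
  countable, every interval has such an interval around it.\<close>

lemma small_oscillation_everywhere: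
  assumes E: "spectral_family D A E" and A: "self_adjoint_operator D A"
    and \<phi>: "orthonormal_basis (\<phi> :: nat \<Rightarrow> 'a::complex_hilbert_space)"
    and f: "RS_integrable_operator f D A E"
  shows "small_oscillation f (spectral.distr E (x::'a)) a b"
proof -
  interpret spectral D A E by unfold_locales fact
  obtain a' where a': "a - 1 < a'" "a' < a" "\<not> eigenvalue_of D A a'"
    using real_interval_avoid_countable_set[OF _ countable_eigenvalues[OF A \<phi>], of "a - 1" a] by auto
  define c where "c = max a b"
  obtain b' where b': "c < b'" "b' < c + 1" "\<not> eigenvalue_of D A b'"
    using real_interval_avoid_countable_set[OF _ countable_eigenvalues[OF A \<phi>], of c "c + 1"] by auto
  have ab: "a' < b'" "b < b'" using a' b' by (auto simp: c_def)
  have "RS_integrable f (distr x) a' b'"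
    using f a'(3) b'(3) ab(1) unfolding RS_integrable_operator_def distr_eq by blast
  then show ?thesis
    using small_oscillation_subinterval[OF RS_integrable_imp_small_oscillation mono_distr a'(2) ab(2)] by blast
qed

text \<open>The eigenvectors of the finite sections, and their images under the isomorphism, approximate both the
  matrix operator and \<open>A\<close>. The first approximation gives the limit; the second one transports the
  integrability of \<open>f\<close> from the spectral family \<open>E\<close> to \<open>F\<close>.\<close>

theorem theorem18:
  fixes D :: "'a::complex_hilbert_space set" and A :: "'a \<Rightarrow> 'a"
    and \<phi> :: "nat \<Rightarrow> 'a" and M :: "nat \<Rightarrow> nat \<Rightarrow> complex"
    and E :: "real \<Rightarrow> 'a \<Rightarrow> 'a" and F :: "real \<Rightarrow> ell2 \<Rightarrow> ell2"
    and u v :: ell2 and f :: "real \<Rightarrow> real"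
  assumes "self_adjoint_operator D A"
    and "has_matrix_representation D A \<phi> M"
    and "spectral_family D A E"
    and "spectral_family (matrix_domain M) (matrix_operator M) F"
    and "u \<in> ell2_fin" and "v \<in> ell2_fin"
    and "RS_integrable_operator f D A E"
    and "\<exists>a>0. \<exists>b>0. \<forall>x. \<bar>f x\<bar> \<le> a + b * x\<^sup>2"
  shows "(\<lambda>n. (matrix_function f (section_mat M n) *\<^sub>v section_vec v n) \<bullet>c section_vec u n)
           \<longlonglongrightarrow> form_value f F u v"
proof -
  interpret R: matrix_representation D A \<phi> M by unfold_locales fact+
  obtain a b where ab: "a > 0" "b > 0" "\<And>x. \<bar>f x\<bar> \<le> a + b * x\<^sup>2" using assms(8) by blast
  obtain w d where w: "\<And>n. corthonormal {..n} (w n)"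
    "\<And>x. x \<in> ell2_fin \<Longrightarrow> \<forall>\<^sub>F n in sequentially. (\<Sum>j\<le>n. (cmod (cinner (w n j) x))\<^sup>2) = (norm x)\<^sup>2"
    "\<And>x. x \<in> ell2_fin \<Longrightarrow>
      \<forall>\<^sub>F n in sequentially. \<forall>j\<le>n. cinner (w n j) (R.T x) = of_real (d n j) * cinner (w n j) x"
    "\<And>f u v n. (matrix_function f (section_mat M n) *\<^sub>v section_vec v n) \<bullet>c section_vec u n
      = (\<Sum>j\<le>n. of_real (f (d n j)) * (cinner u (w n j) * cinner (w n j) v))"
    by (rule R.section_approximation) blast
  have finDM: "x \<in> R.DM" if "x \<in> ell2_fin" for x using that R.fin_subset_DM by blast
  interpret F: spectral_approximation R.DM R.T F ell2_fin w d
    by unfold_locales (use assms(4) w R.finite_sequences_core in blast)+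
  note iso = cinner_iso[OF R.basis] norm_iso[OF R.basis] basis_iso_diff[OF R.basis]
  interpret E: spectral_approximation D A E "R.U ` ell2_fin" "\<lambda>n j. R.U (w n j)" d
  proof unfold_locales
    show "spectral_family D A E" by fact
    show "corthonormal {..n} (\<lambda>j. R.U (w n j))" for n
      using w(1)[of n] by (simp add: corthonormal_def iso)
    show "\<exists>y\<in>R.U ` ell2_fin. norm (x - y) < \<epsilon> \<and> norm (A x - A y) < \<epsilon>" if x: "x \<in> D" and \<epsilon>: "\<epsilon> > 0" for x \<epsilon>
    proof -
      obtain z where z: "z \<in> R.DM" "x = R.U z" using x R.domain_image by blast
      obtain y where y: "y \<in> ell2_fin" "norm (z - y) < \<epsilon>" "norm (R.T z - R.T y) < \<epsilon>"
        using R.finite_sequences_core[OF z(1) \<epsilon>] by blast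
      have "norm (x - R.U y) < \<epsilon>" "norm (A x - A (R.U y)) < \<epsilon>"
        unfolding z(2) R.intertwine[OF z(1), symmetric] R.intertwine[OF finDM[OF y(1)], symmetric]
          iso(3)[symmetric] iso(2) using y by simp_all
      then show ?thesis using y(1) by blast
    qed
    show "\<forall>\<^sub>F n in sequentially. (\<Sum>j\<le>n. (cmod (cinner (R.U (w n j)) x))\<^sup>2) = (norm x)\<^sup>2"
      if "x \<in> R.U ` ell2_fin" for x
      using that w(2) by (auto simp: iso)
    show "\<forall>\<^sub>F n in sequentially. \<forall>j\<le>n. cinner (R.U (w n j)) (A x) = of_real (d n j) * cinner (R.U (w n j)) x"
      if "x \<in> R.U ` ell2_fin" for x
      using that w(3) finDM by (auto simp: iso simp flip: R.intertwine)
  qed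
  have osc: "small_oscillation f (F.distr x) p q" if x: "x \<in> ell2_fin" for x p q
  proof -
    have "E.distr (R.U x) = F.distr x"
      by (rule distr_eq_if_same_weights[OF E.spectral_approximation_axioms F.spectral_approximation_axioms])
        (use x in \<open>auto simp: iso\<close>)
    then show ?thesis
      using small_oscillation_everywhere[OF assms(3,1) R.basis assms(7), of "R.U x" p q] by simp
  qed
  define B where "B n u v = (\<Sum>j\<le>n. of_real (f (d n j)) * (cinner u (w n j) * cinner (w n j) v))" for n u v
  have "(\<lambda>n. B n u v) \<longlonglongrightarrow> form_value f F u v"
  proof (rule polarization_limit[where V = ell2_fin])
    show "sesquilinear_on ell2_fin (B n)" for n
      unfolding sesquilinear_on_def B_def
      by (simp add: cinner_add_left cinner_add_right cinner_scaleC_left cinner_scaleC_right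
          algebra_simps sum.distrib sum_distrib_left)
    have dom: "x \<in> F.form_domain f" if "x \<in> ell2_fin" for x
      by (rule F.form_value_integral(1)[OF finDM[OF that] osc[OF that] ab])
    show "sesquilinear_on ell2_fin (form_value f F)"
      unfolding sesquilinear_on_def
      by (intro ballI allI conjI; rule F.form_value_sesquilinear[OF dom dom dom]; assumption)
    show "(\<lambda>n. B n x x) \<longlonglongrightarrow> form_value f F x x" if x: "x \<in> ell2_fin" for x
    proof -
      note I = F.form_value_integral[OF finDM[OF x] osc[OF x] ab]
      obtain L where L: "\<And>a b. a < b \<Longrightarrow> has_RS_integral f (F.distr x) a b (L a b)"
          "((\<lambda>(a, b). L a b) \<longlongrightarrow> Re (form_value f F x x)) (at_bot \<times>\<^sub>F at_top)"
        using I(2) by blast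
      have "(\<lambda>n. F.weighted f UNIV n x) \<longlonglongrightarrow> Re (form_value f F x x)"
        by (rule F.weighted_limit[OF x osc[OF x] L ab])
      then have "(\<lambda>n. complex_of_real (F.weighted f UNIV n x)) \<longlonglongrightarrow> of_real (Re (form_value f F x x))"
        by (rule tendsto_of_real)
      moreover have "complex_of_real (F.weighted f UNIV n x) = B n x x" for n
      proof -
        have "cinner x y * cinner y x = of_real ((cmod (cinner y x))\<^sup>2)" for y :: ell2
          using complex_norm_square[of "cinner y x"] cinner_commute[of x y] by (simp add: mult.commute)
        then show ?thesis by (simp add: F.weighted_def F.eig_index_def B_def atMost_def)
      qed
      moreover have "complex_of_real (Re (form_value f F x x)) = form_value f F x x"
        using I(3) by (simp add: complex_eq_iff)
      ultimately show ?thesis by simp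
    qed
  qed (use assms(5,6) ell2_fin_scaleC ell2_fin_add in auto)
  then show ?thesis unfolding w(4) B_def .
qed

end
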